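(* Let $\mu=\sum_{\lambda\in\Lambda}c_\lambda\delta_\lambda$ with $\Lambda\subset\mathbb R$ locally finite and $c_\lambda$ positive integers, be a temperate distribution whose Fourier transform is a measure $\hat\mu=\sum_{\gamma\in\Gamma}b_\gamma\delta_\gamma$ ($\Gamma\subset\mathbb R$ countable) such that $|\hat\mu|$ is also a temperate distribution. Let $A=\{a_n\}_{n\in\mathbb Z}$ be the multiset in which each $\lambda\in\Lambda$ occurs $c_\lambda$ times, enumerated so that $a_n\le a_{n+1}$, and assume $0\notin A$. Let $$f(z)=(1-z/a_0)\prod_{n=1}^\infty(1-z/a_n)(1-z/a_{-n}),\qquad g(z)=\sum_{\gamma\in\Gamma,\ 0<\gamma<1}b_\gamma\frac{e^{2\pi i\gamma z}-1}{\gamma}.$$ Then $F(z)=e^{g(z)}f(z)$ is an almost periodic entire function.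
   Context: The Fourier transform is taken in the sense of tempered distributions with the convention $\hat\varphi(\lambda)=\int_{\mathbb R}\varphi(t)e^{-2\pi i\lambda t}\,dt$. An entire function $F$ is almost periodic if it is almost periodic in the strip $\mathbb C$: for every $-\infty<\alpha\le\beta<\infty$ and every $\varepsilon>0$ the set $\{\tau\in\mathbb R:\ \sup_{x\in\mathbb R,\ \alpha\le y\le\beta}|F(x+\tau+iy)-F(x+iy)|<\varepsilon\}$ is relatively dense in $\mathbb R$ (meets every interval of some length $L$ depending on $\varepsilon,\alpha,\beta$). *)

theory Defs
  imports "HOL-Analysis.Analysis"
begin

fun vderiv :: "nat \<Rightarrow> (real \<Rightarrow> complex) \<Rightarrow> real \<Rightarrow> complex" where
  "vderiv 0 \<phi> = \<phi>"
| "vderiv (Suc m) \<phi> = (\<lambda>t. vector_derivative (vderiv m \<phi>) (at t))"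

definition schwartz :: "(real \<Rightarrow> complex) \<Rightarrow> bool" where
  "schwartz \<phi> \<longleftrightarrow>
     (\<forall>m t. vderiv m \<phi> differentiable (at t)) \<and>
     (\<forall>k m. bounded (range (\<lambda>t. \<bar>t\<bar> ^ k * norm (vderiv m \<phi> t))))"

definition schwartz_seminorm :: "nat \<Rightarrow> nat \<Rightarrow> (real \<Rightarrow> complex) \<Rightarrow> real" where
  "schwartz_seminorm k m \<phi> = (SUP t. \<bar>t\<bar> ^ k * norm (vderiv m \<phi> t))"

definition fourier :: "(real \<Rightarrow> complex) \<Rightarrow> real \<Rightarrow> complex" where
  "fourier \<phi> \<xi> = (LINT t|lborel. \<phi> t * exp (- (2 * pi * \<i>) * complex_of_real (\<xi> * t)))"

definition pair_discrete :: "real set \<Rightarrow> (real \<Rightarrow> complex) \<Rightarrow> (real \<Rightarrow> complex) \<Rightarrow> complex" where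
  "pair_discrete S w \<phi> = (\<Sum>\<^sub>\<infinity>x\<in>S. w x * \<phi> x)"

text \<open>The discrete measure \<open>\<Sum>_{x\<in>S} w x \<delta>_x\<close> is a temperate distribution:
  it acts on every Schwartz function (the integral converges absolutely) and the
  resulting linear functional is continuous, i.e. bounded by finitely many Schwartz seminorms.\<close>
definition tempered_discrete :: "real set \<Rightarrow> (real \<Rightarrow> complex) \<Rightarrow> bool" where
  "tempered_discrete S w \<longleftrightarrow>
     (\<forall>\<phi>. schwartz \<phi> \<longrightarrow> ((\<lambda>x. norm (w x * \<phi> x)) summable_on S)) \<and>
     (\<exists>(C::real) (K::nat). \<forall>\<phi>. schwartz \<phi> \<longrightarrow>
        norm (pair_discrete S w \<phi>) \<le> C * (\<Sum>k\<in>{..K}. \<Sum>m\<in>{..K}. schwartz_seminorm k m \<phi>))"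

definition almost_periodic_entire :: "(complex \<Rightarrow> complex) \<Rightarrow> bool" where
  "almost_periodic_entire F \<longleftrightarrow>
     F holomorphic_on UNIV \<and>
     (\<forall>\<alpha> \<beta> \<epsilon>. \<alpha> \<le> \<beta> \<longrightarrow> \<epsilon> > 0 \<longrightarrow>
        (\<exists>L>0. \<forall>x0. \<exists>\<tau>\<in>{x0..x0+L}.
           (\<exists>\<delta><\<epsilon>. \<forall>x y. \<alpha> \<le> y \<longrightarrow> y \<le> \<beta> \<longrightarrow>
              norm (F (Complex (x + \<tau>) y) - F (Complex x y)) \<le> \<delta>)))"

end

theory Submission
  imports Defs "HOL-Complex_Analysis.Complex_Analysis" "HOL-Probability.Probability"
begin

text \<open>
  Testing \<open>\<mu>\<close> against mollified one-sided exponentials shows that, for \<open>Im z > 0\<close>, the sum of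
  \<open>1 / (z - a n)\<close> (up to a constant) equals \<open>- 2 \<pi> i \<Sum> b \<gamma> exp (2 \<pi> i \<gamma> z)\<close> over the
  frequencies \<open>\<gamma> > 0\<close>.
  Its imaginary part is a Poisson sum with relatively dense almost periods. Since the masses are
  integers, these almost periods preserve the number of points in suitable cells exactly, so that the
  number of points in an interval depends, up to a bounded error, only on its length. Hence
  \<open>a n + a (- n)\<close> is bounded, and the symmetric product \<open>f\<close> converges. Integrating its logarithmic
  derivative, the factor \<open>exp g\<close> cancels exactly the small frequencies, whose primitives need not
  converge absolutely: in the upper half plane \<open>F z = C exp (K z - \<Sum> (b \<gamma> / \<gamma>) exp (2 \<pi> i \<gamma> z))\<close>
  with \<open>\<gamma> \<ge> 1\<close> and \<open>K\<close> purely imaginary, which is almost periodic on every horizontal line.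
  The zeros of \<open>f\<close> are real, so \<open>|f (x + i y)|\<close> grows with \<open>|y|\<close> and \<open>F\<close> is bounded on
  horizontal strips; the three lines theorem carries almost periodicity over to all strips.
\<close>

subsection \<open>Relatively dense sets\<close>

definition relatively_dense :: "real set \<Rightarrow> bool" where
  "relatively_dense T \<longleftrightarrow> (\<exists>L>0. \<forall>x. \<exists>\<tau>\<in>{x..x+L}. \<tau> \<in> T)"

lemma relatively_dense_mono: "relatively_dense S \<Longrightarrow> S \<subseteq> T \<Longrightarrow> relatively_dense T"
  unfolding relatively_dense_def by blast

lemma relatively_dense_of_finite_range:
  fixes q :: "real \<Rightarrow> 'a"
  assumes "finite (range q)"
  shows "relatively_dense {\<tau>. \<exists>s. q (s + \<tau>) = q s}"
proof -
  obtain R where R: "finite R" "range q = q ` R"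
    using assms by (metis finite_subset_image subset_refl)
  define B where "B = Max (insert 0 (abs ` R))"
  have abs_le: "\<bar>s\<bar> \<le> B" if "s \<in> R" for s
    using that R(1) unfolding B_def by (intro Max_ge) auto
  have "B \<ge> 0" using R(1) unfolding B_def by (intro Max_ge) auto
  show ?thesis
    unfolding relatively_dense_def
  proof (intro exI[of _ "2 * B + 1"] conjI allI)
    fix x
    obtain s where s: "s \<in> R" "q (x + B) = q s" using R(2) by (metis rangeI imageE)
    then have "x + B - s \<in> {\<tau>. \<exists>s. q (s + \<tau>) = q s}" by (auto intro!: exI[of _ s])
    then show "\<exists>\<tau>\<in>{x..x + (2 * B + 1)}. \<tau> \<in> {\<tau>. \<exists>s. q (s + \<tau>) = q s}"
      using abs_le[OF s(1)] by (intro bexI[of _ "x + B - s"]) auto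
  qed (use \<open>B \<ge> 0\<close> in auto)
qed

lemma norm_cis_diff: "norm (cis s - cis t) = norm (cis (s - t) - 1)"
proof -
  have "cis s - cis t = cis t * (cis (s - t) - 1)" by (simp add: algebra_simps cis_mult)
  then show ?thesis by (simp add: norm_mult)
qed

lemma norm_cis_diff_le: "norm (cis s - cis t) \<le> \<bar>s - t\<bar>"
  using iexp_approx1[of "s - t" 0] unfolding norm_cis_diff by (simp add: cis_conv_exp)

lemma norm_cis_minus_1_le: "norm (cis t - 1) \<le> 2"
  using norm_triangle_ineq4[of "cis t" 1] by simp

lemma cis_2pi_frac: "cis (2 * pi * frac u) = cis (2 * pi * u)"
proof -
  have "cis (2 * pi * u) = cis (2 * pi * frac u) * cis (2 * pi * of_int \<lfloor>u\<rfloor>)"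
    by (simp add: frac_def cis_mult algebra_simps)
  then show ?thesis by (simp add: cis_multiple_2pi)
qed

lemma norm_cis_diff_less_of_same_cell:
  assumes "K > 0" and same_cell: "\<lfloor>K * frac (s / (2 * pi))\<rfloor> = \<lfloor>K * frac (t / (2 * pi))\<rfloor>"
  shows "norm (cis s - cis t) < 2 * pi / K"
proof -
  define u v where "u = s / (2 * pi)" and "v = t / (2 * pi)"
  have "\<bar>K * frac u - K * frac v\<bar> < 1"
    using same_cell unfolding u_def v_def by linarith
  then have frac_diff: "\<bar>frac u - frac v\<bar> < 1 / K"
    using assms(1) abs_mult[of K "frac u - frac v"] by (simp add: right_diff_distrib field_simps)
  have "cis s = cis (2 * pi * frac u)" "cis t = cis (2 * pi * frac v)"
    by (simp_all add: cis_2pi_frac u_def v_def)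
  then have "norm (cis s - cis t) \<le> \<bar>2 * pi * frac u - 2 * pi * frac v\<bar>"
    by (simp only: norm_cis_diff_le)
  also have "\<dots> = 2 * pi * \<bar>frac u - frac v\<bar>"
    by (simp add: abs_mult flip: right_diff_distrib)
  also have "\<dots> < 2 * pi * (1 / K)"
    using frac_diff by (intro mult_strict_left_mono) auto
  finally show ?thesis by simp
qed

lemma relatively_dense_cis_near_1:
  assumes "finite S" "\<eta> > 0"
  shows "relatively_dense {\<tau>. \<forall>\<theta>\<in>S. norm (cis (\<theta> * \<tau>) - 1) < \<eta>}"
proof -
  obtain K :: nat where "2 * pi / \<eta> < real K" using reals_Archimedean2 by blast
  moreover from this have "real K > 0" using assms(2) by (smt (verit) divide_pos_pos pi_gt_zero)
  ultimately have K: "real K > 0" "2 * pi / real K < \<eta>"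
    using assms(2) by (simp_all add: field_simps)
  define cell where "cell t = restrict (\<lambda>\<theta>. \<lfloor>real K * frac (\<theta> * t / (2 * pi))\<rfloor>) S" for t
  have "\<lfloor>real K * frac u\<rfloor> \<in> {0..int K}" for u :: real
  proof -
    have "real K * frac u \<le> real K * 1"
      using frac_lt_1[of u] by (intro mult_left_mono) auto
    then show ?thesis by (auto simp: floor_le_iff)
  qed
  then have "range cell \<subseteq> PiE S (\<lambda>_. {0..int K})" by (auto simp: cell_def)
  then have "finite (range cell)"
    by (rule finite_subset) (intro finite_PiE assms(1) finite_atLeastAtMost_int)
  then have "relatively_dense {\<tau>. \<exists>s. cell (s + \<tau>) = cell s}"
    by (rule relatively_dense_of_finite_range)
  then show ?thesis
  proof (rule relatively_dense_mono, safe)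
    fix \<tau> s \<theta> assume same_cell: "cell (s + \<tau>) = cell s" and "\<theta> \<in> S"
    have "\<lfloor>real K * frac (\<theta> * (s + \<tau>) / (2 * pi))\<rfloor> = \<lfloor>real K * frac (\<theta> * s / (2 * pi))\<rfloor>"
      using fun_cong[OF same_cell, of \<theta>] \<open>\<theta> \<in> S\<close> by (simp add: cell_def)
    then have "norm (cis (\<theta> * (s + \<tau>)) - cis (\<theta> * s)) < 2 * pi / real K"
      by (rule norm_cis_diff_less_of_same_cell[OF K(1)])
    then show "norm (cis (\<theta> * \<tau>) - 1) < \<eta>"
      using K(2) unfolding norm_cis_diff by (simp add: algebra_simps)
  qed
qed

lemma infsum_weighted_cis_le:
  fixes w :: "'i \<Rightarrow> real"
  assumes w: "w summable_on I" "\<And>i. i \<in> I \<Longrightarrow> w i \<ge> 0"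
    and S: "finite S" "S \<subseteq> I" and near: "\<And>i. i \<in> S \<Longrightarrow> norm (cis (t i) - 1) \<le> \<eta>"
  shows "(\<Sum>\<^sub>\<infinity>i\<in>I. w i * norm (cis (t i) - 1)) \<le> 2 * (infsum w I - sum w S) + sum w S * \<eta>"
proof -
  define h where "h i = w i * norm (cis (t i) - 1)" for i
  have h_le: "h i \<le> 2 * w i" if "i \<in> I" for i
    unfolding h_def using mult_left_mono[OF norm_cis_minus_1_le w(2)[OF that], of "t i"] by simp
  have h_summable: "h summable_on I"
    by (rule summable_on_comparison_test[OF summable_on_cmult_right[OF w(1), of 2] h_le])
       (use w(2) in \<open>auto simp: h_def\<close>)
  have tail: "w summable_on (I - S)" "h summable_on (I - S)"
    using w(1) h_summable by (auto intro: summable_on_subset_banach)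
  have "infsum h I = infsum h (I - S) + sum h S"
    using infsum_Un_disjoint[OF tail(2) summable_on_finite[OF S(1), of h]] S
    by (simp add: Un_absorb2 infsum_finite Un_commute Int_commute)
  also have "infsum h (I - S) \<le> (\<Sum>\<^sub>\<infinity>i\<in>I - S. 2 * w i)"
    by (rule infsum_mono[OF tail(2) summable_on_cmult_right[OF tail(1)]]) (use h_le in auto)
  also have "\<dots> = 2 * (infsum w I - sum w S)"
    using infsum_Diff[OF w(1) summable_on_finite[OF S(1), of w] S(2)] S(1)
    by (simp add: infsum_cmult_right')
  also have "sum h S \<le> (\<Sum>i\<in>S. w i * \<eta>)"
    unfolding h_def using near w(2) S(2) by (intro sum_mono mult_left_mono) auto
  also have "\<dots> = sum w S * \<eta>" by (simp add: sum_distrib_right)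
  finally show ?thesis by (simp add: h_def)
qed

lemma relatively_dense_weighted_cis_near_1:
  fixes w \<theta> :: "'i \<Rightarrow> real"
  assumes w: "w summable_on I" "\<And>i. i \<in> I \<Longrightarrow> w i \<ge> 0" and "finite E" "\<eta> > 0"
  shows "relatively_dense {\<tau>. (\<Sum>\<^sub>\<infinity>i\<in>I. w i * norm (cis (\<theta> i * \<tau>) - 1)) < \<eta> \<and>
           (\<forall>\<kappa>\<in>E. norm (cis (\<kappa> * \<tau>) - 1) < \<eta>)}"
proof -
  have "eventually (\<lambda>S. dist (sum w S) (infsum w I) < \<eta> / 4) (finite_subsets_at_top I)"
    using has_sum_infsum[OF w(1)] \<open>\<eta> > 0\<close> unfolding has_sum_def by (intro tendstoD) auto
  then obtain S where S: "finite S" "S \<subseteq> I" "dist (sum w S) (infsum w I) < \<eta> / 4"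
    unfolding eventually_finite_subsets_at_top by blast
  have S_nonneg: "sum w S \<ge> 0" using w(2) S(2) by (intro sum_nonneg) auto
  define \<eta>' where "\<eta>' = min \<eta> (\<eta> / (2 * (sum w S + 1)))"
  have \<eta>': "\<eta>' > 0" "\<eta>' \<le> \<eta>" "sum w S * \<eta>' \<le> \<eta> / 2"
  proof -
    show "\<eta>' > 0" "\<eta>' \<le> \<eta>" using \<open>\<eta> > 0\<close> S_nonneg by (auto simp: \<eta>'_def)
    have "sum w S * \<eta>' \<le> (sum w S + 1) * (\<eta> / (2 * (sum w S + 1)))"
      using S_nonneg \<open>\<eta>' > 0\<close> by (intro mult_mono) (auto simp: \<eta>'_def)
    also have "\<dots> = \<eta> / 2" using S_nonneg by (simp add: field_simps)
    finally show "sum w S * \<eta>' \<le> \<eta> / 2" .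
  qed
  have "relatively_dense {\<tau>. \<forall>\<kappa>\<in>E \<union> \<theta> ` S. norm (cis (\<kappa> * \<tau>) - 1) < \<eta>'}"
    using assms(3) S(1) \<eta>'(1) by (intro relatively_dense_cis_near_1) auto
  then show ?thesis
  proof (rule relatively_dense_mono, intro subsetI CollectI conjI ballI)
    fix \<tau> assume \<tau>: "\<tau> \<in> {\<tau>. \<forall>\<kappa>\<in>E \<union> \<theta> ` S. norm (cis (\<kappa> * \<tau>) - 1) < \<eta>'}"
    then show "norm (cis (\<kappa> * \<tau>) - 1) < \<eta>" if "\<kappa> \<in> E" for \<kappa>
      using that \<eta>'(2) by force
    have "(\<Sum>\<^sub>\<infinity>i\<in>I. w i * norm (cis (\<theta> i * \<tau>) - 1))
        \<le> 2 * (infsum w I - sum w S) + sum w S * \<eta>'"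
      by (rule infsum_weighted_cis_le[OF w S(1,2)]) (use \<tau> in \<open>auto intro: less_imp_le\<close>)
    also have "\<dots> < 2 * (\<eta> / 4) + \<eta> / 2"
      using S(3) \<eta>'(3) abs_ge_self[of "infsum w I - sum w S"]
      by (intro add_less_le_mono) (simp_all add: dist_real_def abs_minus_commute)
    finally show "(\<Sum>\<^sub>\<infinity>i\<in>I. w i * norm (cis (\<theta> i * \<tau>) - 1)) < \<eta>" by simp
  qed
qed

subsection \<open>Dominated sums\<close>

lemma infsum_diff:
  fixes f g :: "'i \<Rightarrow> 'c :: real_normed_vector"
  assumes "f summable_on A" "g summable_on A"
  shows "(\<Sum>\<^sub>\<infinity>i\<in>A. f i - g i) = infsum f A - infsum g A"
  using infsum_add[OF assms(1) iffD2[OF summable_on_uminus assms(2)]] by (simp add: infsum_uminus)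

lemma infsum_dominated_convergence:
  fixes f :: "'b \<Rightarrow> 'i \<Rightarrow> 'c :: banach"
  assumes dominated: "eventually (\<lambda>y. \<forall>i\<in>I. norm (f y i) \<le> M i) F"
    and M: "M summable_on I"
    and lim: "\<And>i. i \<in> I \<Longrightarrow> ((\<lambda>y. f y i) \<longlongrightarrow> l i) F"
    and F: "F \<noteq> bot"
  shows "((\<lambda>y. infsum (f y) I) \<longlongrightarrow> infsum l I) F"
proof -
  define Y where "Y = {y. \<forall>i\<in>I. norm (f y i) \<le> M i}"
  have ev_Y: "eventually (\<lambda>y. y \<in> Y) F" using dominated by (simp add: Y_def)
  have "norm (l i) \<le> M i" if "i \<in> I" for i
    by (rule tendsto_upperbound[OF tendsto_norm[OF lim[OF that]] eventually_mono[OF ev_Y] F])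
       (use that in \<open>auto simp: Y_def\<close>)
  then have "(\<lambda>i. norm (l i)) summable_on I"
    by (intro summable_on_comparison_test[OF M]) auto
  then have "(sum l \<longlongrightarrow> infsum l I) (finite_subsets_at_top I)"
    using has_sum_infsum[OF abs_summable_summable] by (simp add: has_sum_def)
  moreover have "uniform_limit Y (\<lambda>X y. \<Sum>i\<in>X. f y i) (\<lambda>y. infsum (f y) I)
      (finite_subsets_at_top I)"
    by (rule Weierstrass_m_test_general[OF _ M]) (simp add: Y_def)
  moreover have "eventually (\<lambda>X. ((\<lambda>y. \<Sum>i\<in>X. f y i) \<longlongrightarrow> sum l X) F) (finite_subsets_at_top I)"
    unfolding eventually_finite_subsets_at_top
    by (intro exI[of _ "{}"]) (auto intro!: tendsto_sum lim)
  ultimately show ?thesis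
    using ev_Y by (intro swap_uniform_limit'[where S = Y and g = "sum l"
        and F = "finite_subsets_at_top I" and f = "\<lambda>X y. \<Sum>i\<in>X. f y i"]) auto
qed

lemma has_field_derivative_infsum_dominated:
  fixes f f' :: "'i \<Rightarrow> complex \<Rightarrow> complex"
  assumes deriv: "\<And>i w. i \<in> I \<Longrightarrow> w \<in> cball z r \<Longrightarrow> (f i has_field_derivative f' i w) (at w)"
    and dominated: "\<And>i w. i \<in> I \<Longrightarrow> w \<in> cball z r \<Longrightarrow> norm (f i w) \<le> M i"
    and M: "M summable_on I" and r: "r > 0"
  shows "((\<lambda>w. \<Sum>\<^sub>\<infinity>i\<in>I. f i w) has_field_derivative (\<Sum>\<^sub>\<infinity>i\<in>I. f' i z)) (at z)"
proof -
  let ?F = "finite_subsets_at_top I"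
  have partial_deriv: "((\<lambda>w. \<Sum>i\<in>X. f i w) has_field_derivative (\<Sum>i\<in>X. f' i w)) (at w)"
    if "X \<subseteq> I" "w \<in> cball z r" for X w
    using that by (intro DERIV_sum deriv) auto
  have partial_cont: "continuous_on (cball z r) (\<lambda>w. \<Sum>i\<in>X. f i w)" if "X \<subseteq> I" for X
    by (rule DERIV_continuous_on, rule has_field_derivative_at_within, rule partial_deriv[OF that])
  have limit: "uniform_limit (cball z r) (\<lambda>X w. \<Sum>i\<in>X. f i w) (\<lambda>w. \<Sum>\<^sub>\<infinity>i\<in>I. f i w) ?F"
    by (rule Weierstrass_m_test_general[OF dominated M])
  have partial: "\<forall>\<^sub>F X in ?F. continuous_on (cball z r) (\<lambda>w. \<Sum>i\<in>X. f i w) \<and>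
      (\<forall>w\<in>ball z r. ((\<lambda>w. \<Sum>i\<in>X. f i w) has_field_derivative (\<Sum>i\<in>X. f' i w)) (at w))"
    unfolding eventually_finite_subsets_at_top
    using partial_deriv partial_cont by (intro exI[of _ "{}"]) auto
  obtain g' where
    "\<And>w. w \<in> ball z r \<Longrightarrow> ((\<lambda>w. \<Sum>\<^sub>\<infinity>i\<in>I. f i w) has_field_derivative g' w) (at w) \<and>
      ((\<lambda>X. \<Sum>i\<in>X. f' i w) \<longlongrightarrow> g' w) ?F"
    by (rule has_complex_derivative_uniform_limit[OF partial limit finite_subsets_at_top_neq_bot r])
       blast
  then have "((\<lambda>w. \<Sum>\<^sub>\<infinity>i\<in>I. f i w) has_field_derivative g' z) (at z)"
    and "((\<lambda>i. f' i z) has_sum g' z) I"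
    using r by (simp_all add: has_sum_def)
  then show ?thesis by (simp add: infsumI)
qed

lemma has_integral_infsum_dominated:
  fixes f :: "'i \<Rightarrow> real \<Rightarrow> 'c :: banach"
  assumes int: "\<And>i. i \<in> I \<Longrightarrow> (f i has_integral J i) {p..q}"
    and cont: "\<And>i. i \<in> I \<Longrightarrow> continuous_on {p..q} (f i)"
    and dominated: "\<And>i u. i \<in> I \<Longrightarrow> u \<in> {p..q} \<Longrightarrow> norm (f i u) \<le> M i"
    and M: "M summable_on I"
  shows "J summable_on I" "((\<lambda>u. \<Sum>\<^sub>\<infinity>i\<in>I. f i u) has_integral (\<Sum>\<^sub>\<infinity>i\<in>I. J i)) {p..q}"
proof -
  let ?F = "finite_subsets_at_top I"
  have "uniform_limit {p..q} (\<lambda>X u. \<Sum>i\<in>X. f i u) (\<lambda>u. \<Sum>\<^sub>\<infinity>i\<in>I. f i u) ?F"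
    by (rule Weierstrass_m_test_general[OF dominated M])
  then have limit: "uniform_limit {p..q} (\<lambda>X u. \<Sum>i\<in>X \<inter> I. f i u) (\<lambda>u. \<Sum>\<^sub>\<infinity>i\<in>I. f i u) ?F"
    by (rule uniform_limit_cong[THEN iffD1, rotated 2])
       (auto simp: eventually_finite_subsets_at_top Int_absorb2 intro!: exI[of _ "{}"])
  have partial_cont: "continuous_on {p..q} (\<lambda>u. \<Sum>i\<in>X \<inter> I. f i u)" for X
    by (intro continuous_on_sum cont) auto
  obtain K L where K: "\<And>X. ((\<lambda>u. \<Sum>i\<in>X \<inter> I. f i u) has_integral K X) {p..q}"
    and L: "((\<lambda>u. \<Sum>\<^sub>\<infinity>i\<in>I. f i u) has_integral L) {p..q}" "(K \<longlongrightarrow> L) ?F"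
    using uniform_limit_integral[OF limit partial_cont] by (metis finite_subsets_at_top_neq_bot)
  have K_eq: "K X = sum J X" if "finite X" "X \<subseteq> I" for X
    using has_integral_unique[OF K has_integral_sum[of "X \<inter> I" f J]] that int
    by (simp add: Int_absorb2 subset_iff)
  have "(J has_sum L) I"
    unfolding has_sum_def
  proof (rule Lim_transform_eventually[OF L(2)])
    show "\<forall>\<^sub>F X in ?F. K X = sum J X"
      unfolding eventually_finite_subsets_at_top using K_eq by (intro exI[of _ "{}"]) auto
  qed
  then show "J summable_on I" "((\<lambda>u. \<Sum>\<^sub>\<infinity>i\<in>I. f i u) has_integral (\<Sum>\<^sub>\<infinity>i\<in>I. J i)) {p..q}"
    using L(1) by (auto simp: has_sum_imp_summable infsumI)
qed

subsection \<open>Exponential series\<close>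

definition freq_exp :: "real \<Rightarrow> complex \<Rightarrow> complex" where
  "freq_exp \<gamma> z = exp (2 * pi * \<i> * complex_of_real \<gamma> * z)"

lemma freq_exp_0 [simp]: "freq_exp \<gamma> 0 = 1"
  by (simp add: freq_exp_def)

lemma norm_freq_exp: "norm (freq_exp \<gamma> z) = exp (- 2 * pi * Im z * \<gamma>)"
  by (simp add: freq_exp_def norm_exp_eq_Re mult_ac)

lemma freq_exp_add: "freq_exp \<gamma> (z + w) = freq_exp \<gamma> z * freq_exp \<gamma> w"
  by (simp add: freq_exp_def distrib_left exp_add)

lemma freq_exp_of_real: "freq_exp \<gamma> (of_real t) = cis (2 * pi * \<gamma> * t)"
  by (simp add: freq_exp_def cis_conv_exp mult_ac)

lemma freq_exp_has_field_derivative: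
  "(freq_exp \<gamma> has_field_derivative 2 * pi * \<i> * of_real \<gamma> * freq_exp \<gamma> z) (at z)"
  unfolding freq_exp_def by (auto intro!: derivative_eq_intros)

lemma norm_exp_diff_le:
  fixes u v :: complex
  assumes "Re u \<le> m" "Re v \<le> m"
  shows "norm (exp u - exp v) \<le> exp m * norm (u - v)"
proof (rule field_differentiable_bound[where S = "{w. Re w \<le> m}" and f' = exp])
  show "convex {w. Re w \<le> m}" by (rule convex_halfspace_Re_le)
  show "(exp has_field_derivative exp w) (at w within {w. Re w \<le> m})" for w :: complex
    by (rule has_field_derivative_at_within[OF DERIV_exp])
qed (use assms in \<open>auto simp: norm_exp_eq_Re\<close>)

lemma norm_freq_exp_diff_le:
  assumes "0 \<le> \<gamma>" "\<gamma> \<le> R" "\<bar>Im z\<bar> \<le> S" "\<bar>Im w\<bar> \<le> S"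
  shows "norm (freq_exp \<gamma> z - freq_exp \<gamma> w) \<le> 2 * pi * \<gamma> * norm (z - w) * exp (2 * pi * R * S)"
proof -
  let ?a = "2 * pi * \<i> * complex_of_real \<gamma>"
  have Re_le: "Re (?a * u) \<le> 2 * pi * R * S" if "\<bar>Im u\<bar> \<le> S" for u
  proof -
    have "\<gamma> * - Im u \<le> \<gamma> * \<bar>Im u\<bar>" using assms(1) by (intro mult_left_mono) auto
    also have "\<dots> \<le> R * S" using assms that by (intro mult_mono) auto
    finally have "2 * pi * (\<gamma> * - Im u) \<le> 2 * pi * (R * S)" by (intro mult_left_mono) auto
    then show ?thesis by (simp add: mult_ac)
  qed
  have "norm (freq_exp \<gamma> z - freq_exp \<gamma> w) \<le> exp (2 * pi * R * S) * norm (?a * z - ?a * w)"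
    unfolding freq_exp_def by (intro norm_exp_diff_le Re_le assms)
  also have "norm (?a * z - ?a * w) = norm ?a * norm (z - w)"
    by (simp only: norm_mult flip: right_diff_distrib)
  also have "norm ?a = 2 * pi * \<gamma>" using assms(1) by (simp add: norm_mult)
  finally show ?thesis by (simp only: mult_ac)
qed

definition exp_series :: "real set \<Rightarrow> (real \<Rightarrow> complex) \<Rightarrow> complex \<Rightarrow> complex" where
  "exp_series A \<beta> z = (\<Sum>\<^sub>\<infinity>\<gamma>\<in>A. \<beta> \<gamma> * freq_exp \<gamma> z)"

definition exp_summable :: "real set \<Rightarrow> (real \<Rightarrow> complex) \<Rightarrow> real \<Rightarrow> bool" where
  "exp_summable A \<beta> y \<longleftrightarrow> (\<lambda>\<gamma>. norm (\<beta> \<gamma>) * exp (- 2 * pi * y * \<gamma>)) summable_on A"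

lemma exp_summable_subset: "exp_summable B \<beta> y \<Longrightarrow> A \<subseteq> B \<Longrightarrow> exp_summable A \<beta> y"
  unfolding exp_summable_def by (rule summable_on_subset_banach)

lemma exp_summable_mono:
  assumes "exp_summable A \<alpha> y" "\<And>\<gamma>. \<gamma> \<in> A \<Longrightarrow> norm (\<beta> \<gamma>) \<le> norm (\<alpha> \<gamma>)"
  shows "exp_summable A \<beta> y"
  using assms(1) unfolding exp_summable_def
  by (rule summable_on_comparison_test) (use assms(2) in \<open>auto intro: mult_right_mono\<close>)

lemma norm_exp_series_term:
  "norm (\<beta> \<gamma> * freq_exp \<gamma> z) = norm (\<beta> \<gamma>) * exp (- 2 * pi * Im z * \<gamma>)"
  by (simp only: norm_mult norm_freq_exp)

lemma exp_series_abs_summable: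
  "exp_summable A \<beta> (Im z) \<Longrightarrow> (\<lambda>\<gamma>. norm (\<beta> \<gamma> * freq_exp \<gamma> z)) summable_on A"
  by (simp only: exp_summable_def norm_exp_series_term)

lemma exp_series_summable:
  "exp_summable A \<beta> (Im z) \<Longrightarrow> (\<lambda>\<gamma>. \<beta> \<gamma> * freq_exp \<gamma> z) summable_on A"
  by (rule abs_summable_summable[OF exp_series_abs_summable])

lemma norm_exp_series_le:
  assumes "exp_summable A \<beta> (Im z)"
  shows "norm (exp_series A \<beta> z) \<le> (\<Sum>\<^sub>\<infinity>\<gamma>\<in>A. norm (\<beta> \<gamma>) * exp (- 2 * pi * Im z * \<gamma>))"
  using norm_infsum_bound[OF exp_series_abs_summable[OF assms]]
  by (simp only: exp_series_def norm_exp_series_term)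

lemma exp_series_Un_disjoint:
  assumes "exp_summable (A \<union> B) \<beta> (Im z)" "A \<inter> B = {}"
  shows "exp_series (A \<union> B) \<beta> z = exp_series A \<beta> z + exp_series B \<beta> z"
  unfolding exp_series_def
  by (intro infsum_Un_disjoint exp_series_summable exp_summable_subset[OF assms(1)] assms(2)) auto

definition exp_deviation :: "real set \<Rightarrow> (real \<Rightarrow> complex) \<Rightarrow> real \<Rightarrow> real \<Rightarrow> real" where
  "exp_deviation A \<beta> y \<tau> =
     (\<Sum>\<^sub>\<infinity>\<gamma>\<in>A. norm (\<beta> \<gamma>) * exp (- 2 * pi * y * \<gamma>) * norm (cis (2 * pi * \<gamma> * \<tau>) - 1))"

lemma relatively_dense_exp_deviation_less:
  assumes "exp_summable A \<beta> y" "finite E" "\<eta> > 0"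
  shows "relatively_dense {\<tau>. exp_deviation A \<beta> y \<tau> < \<eta> \<and> (\<forall>\<kappa>\<in>E. norm (cis (\<kappa> * \<tau>) - 1) < \<eta>)}"
  using assms unfolding exp_summable_def exp_deviation_def
  by (intro relatively_dense_weighted_cis_near_1) auto

lemma norm_exp_series_shift_le:
  assumes "exp_summable A \<beta> (Im z)"
  shows "norm (exp_series A \<beta> (z + of_real \<tau>) - exp_series A \<beta> z) \<le> exp_deviation A \<beta> (Im z) \<tau>"
proof -
  define \<beta>' where "\<beta>' \<gamma> = \<beta> \<gamma> * (cis (2 * pi * \<gamma> * \<tau>) - 1)" for \<gamma>
  have "\<beta> \<gamma> * freq_exp \<gamma> (z + of_real \<tau>) - \<beta> \<gamma> * freq_exp \<gamma> z = \<beta>' \<gamma> * freq_exp \<gamma> z" for \<gamma>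
    unfolding freq_exp_add freq_exp_of_real \<beta>'_def by (simp add: algebra_simps)
  then have "exp_series A \<beta> (z + of_real \<tau>) - exp_series A \<beta> z = exp_series A \<beta>' z"
    unfolding exp_series_def using assms
    by (subst infsum_diff[symmetric]) (auto intro: exp_series_summable)
  moreover have "exp_summable A \<beta>' (Im z)"
  proof (rule exp_summable_mono[where \<alpha> = "\<lambda>\<gamma>. 2 * \<beta> \<gamma>"])
    show "exp_summable A (\<lambda>\<gamma>. 2 * \<beta> \<gamma>) (Im z)"
      using summable_on_cmult_right[OF assms[unfolded exp_summable_def], of 2]
      by (simp add: exp_summable_def norm_mult mult_ac)
    show "norm (\<beta>' \<gamma>) \<le> norm (2 * \<beta> \<gamma>)" for \<gamma>
      using mult_left_mono[OF norm_cis_minus_1_le, of "norm (\<beta> \<gamma>)" "2 * pi * \<gamma> * \<tau>"]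
      by (simp add: \<beta>'_def norm_mult mult.commute)
  qed
  ultimately show ?thesis
    using norm_exp_series_le[of A \<beta>' z]
    by (simp add: \<beta>'_def exp_deviation_def norm_mult mult_ac)
qed

lemma exp_series_has_field_derivative:
  assumes "exp_summable A \<beta> y" "y < Im z" "A \<subseteq> {0..}"
  shows "(exp_series A \<beta> has_field_derivative
           exp_series A (\<lambda>\<gamma>. 2 * pi * \<i> * of_real \<gamma> * \<beta> \<gamma>) z) (at z)"
proof -
  have "((\<lambda>w. \<Sum>\<^sub>\<infinity>\<gamma>\<in>A. \<beta> \<gamma> * freq_exp \<gamma> w) has_field_derivative
      (\<Sum>\<^sub>\<infinity>\<gamma>\<in>A. \<beta> \<gamma> * (2 * pi * \<i> * of_real \<gamma> * freq_exp \<gamma> z))) (at z)"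
  proof (rule has_field_derivative_infsum_dominated)
    show "(\<lambda>\<gamma>. norm (\<beta> \<gamma>) * exp (- 2 * pi * y * \<gamma>)) summable_on A"
      using assms(1) by (simp only: exp_summable_def)
    show "norm (\<beta> \<gamma> * freq_exp \<gamma> w) \<le> norm (\<beta> \<gamma>) * exp (- 2 * pi * y * \<gamma>)"
      if "\<gamma> \<in> A" "w \<in> cball z (Im z - y)" for \<gamma> w
    proof -
      have "\<bar>Im (z - w)\<bar> \<le> Im z - y" using abs_Im_le_cmod[of "z - w"] that(2)
        by (simp add: dist_norm)
      then have "2 * pi * y * \<gamma> \<le> 2 * pi * Im w * \<gamma>"
        using that(1) assms(3) by (intro mult_right_mono mult_left_mono) auto
      then show ?thesis unfolding norm_exp_series_term by (intro mult_left_mono) auto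
    qed
    show "((\<lambda>w. \<beta> \<gamma> * freq_exp \<gamma> w) has_field_derivative
        \<beta> \<gamma> * (2 * pi * \<i> * of_real \<gamma> * freq_exp \<gamma> w)) (at w)" for \<gamma> w
      by (rule DERIV_cmult[OF freq_exp_has_field_derivative])
  qed (use assms(2) in auto)
  then show ?thesis by (simp add: exp_series_def[abs_def] mult_ac)
qed

lemma exp_series_vertical_tendsto_0:
  assumes "exp_summable A \<beta> y0" "A \<subseteq> {0<..}"
  shows "((\<lambda>y. exp_series A \<beta> (\<i> * of_real y)) \<longlongrightarrow> 0) at_top"
proof -
  have "((\<lambda>y. \<Sum>\<^sub>\<infinity>\<gamma>\<in>A. \<beta> \<gamma> * freq_exp \<gamma> (\<i> * of_real y)) \<longlongrightarrow> (\<Sum>\<^sub>\<infinity>\<gamma>\<in>A. 0)) at_top"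
  proof (rule infsum_dominated_convergence)
    show "(\<lambda>\<gamma>. norm (\<beta> \<gamma>) * exp (- 2 * pi * y0 * \<gamma>)) summable_on A"
      using assms(1) by (simp only: exp_summable_def)
    show "\<forall>\<^sub>F y in at_top. \<forall>\<gamma>\<in>A. norm (\<beta> \<gamma> * freq_exp \<gamma> (\<i> * of_real y))
        \<le> norm (\<beta> \<gamma>) * exp (- 2 * pi * y0 * \<gamma>)"
      using eventually_ge_at_top[of y0]
    proof eventually_elim
      case (elim y)
      then show ?case
        unfolding norm_exp_series_term using assms(2)
        by (auto intro!: mult_left_mono mult_right_mono)
    qed
    show "((\<lambda>y. \<beta> \<gamma> * freq_exp \<gamma> (\<i> * of_real y)) \<longlongrightarrow> 0) at_top" if "\<gamma> \<in> A" for \<gamma>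
    proof (rule tendsto_norm_zero_cancel)
      have "\<gamma> > 0" using that assms(2) by auto
      then have "((\<lambda>y. exp (- 2 * pi * y * \<gamma>)) \<longlongrightarrow> 0) at_top" by real_asymp
      from tendsto_mult_right_zero[OF this, of "norm (\<beta> \<gamma>)"]
      show "((\<lambda>y. norm (\<beta> \<gamma> * freq_exp \<gamma> (\<i> * of_real y))) \<longlongrightarrow> 0) at_top"
        by (simp add: norm_exp_series_term)
    qed
  qed auto
  then show ?thesis by (simp add: exp_series_def)
qed

text \<open>The primitive of \<open>2 * pi * \<i> * exp_series A \<beta>\<close> that vanishes at \<open>0\<close>.  The subtraction
  of \<open>1\<close> makes it converge even if \<open>\<Sum> \<bar>\<beta> \<gamma>\<bar> / \<gamma>\<close> diverges at the small frequencies.\<close>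

definition primitive_term :: "(real \<Rightarrow> complex) \<Rightarrow> complex \<Rightarrow> real \<Rightarrow> complex" where
  "primitive_term \<beta> z \<gamma> = \<beta> \<gamma> * (freq_exp \<gamma> z - 1) / complex_of_real \<gamma>"

definition primitive_series :: "real set \<Rightarrow> (real \<Rightarrow> complex) \<Rightarrow> complex \<Rightarrow> complex" where
  "primitive_series A \<beta> z = (\<Sum>\<^sub>\<infinity>\<gamma>\<in>A. primitive_term \<beta> z \<gamma>)"

lemma norm_primitive_term_diff_le:
  assumes "0 < \<gamma>" "\<gamma> \<le> R" "\<bar>Im z\<bar> \<le> S" "\<bar>Im w\<bar> \<le> S"
  shows "norm (primitive_term \<beta> z \<gamma> - primitive_term \<beta> w \<gamma>)
    \<le> 2 * pi * norm (z - w) * exp (2 * pi * R * S) * norm (\<beta> \<gamma>)"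
proof -
  have "primitive_term \<beta> z \<gamma> - primitive_term \<beta> w \<gamma>
      = \<beta> \<gamma> / of_real \<gamma> * (freq_exp \<gamma> z - freq_exp \<gamma> w)"
    using assms(1) by (simp add: primitive_term_def field_simps)
  also have "norm \<dots> = norm (\<beta> \<gamma>) / \<gamma> * norm (freq_exp \<gamma> z - freq_exp \<gamma> w)"
    using assms(1) by (simp add: norm_mult norm_divide)
  also have "\<dots> \<le> norm (\<beta> \<gamma>) / \<gamma> * (2 * pi * \<gamma> * norm (z - w) * exp (2 * pi * R * S))"
    using assms by (intro mult_left_mono norm_freq_exp_diff_le) auto
  also have "\<dots> = 2 * pi * norm (z - w) * exp (2 * pi * R * S) * norm (\<beta> \<gamma>)"
    using assms(1) by simp
  finally show ?thesis .
qed

lemma norm_primitive_term_le: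
  assumes "0 < \<gamma>" "\<gamma> \<le> R" "norm z \<le> S"
  shows "norm (primitive_term \<beta> z \<gamma>)
    \<le> 2 * pi * S * exp (2 * pi * R * S) * norm (\<beta> \<gamma>)"
proof -
  have "\<bar>Im z\<bar> \<le> S" using abs_Im_le_cmod[of z] assms(3) by linarith
  then have "norm (primitive_term \<beta> z \<gamma>)
      \<le> 2 * pi * norm z * exp (2 * pi * R * S) * norm (\<beta> \<gamma>)"
    using norm_primitive_term_diff_le[OF assms(1,2), of z S 0 \<beta>] by (simp add: primitive_term_def)
  also have "\<dots> \<le> 2 * pi * S * exp (2 * pi * R * S) * norm (\<beta> \<gamma>)"
    using assms(3) by (intro mult_right_mono mult_left_mono) auto
  finally show ?thesis .
qed

lemma primitive_series_summable:
  assumes "(\<lambda>\<gamma>. norm (\<beta> \<gamma>)) summable_on A" "A \<subseteq> {0<..R}"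
  shows "(\<lambda>\<gamma>. primitive_term \<beta> z \<gamma>) summable_on A"
proof (rule abs_summable_summable, rule summable_on_comparison_test)
  show "(\<lambda>\<gamma>. 2 * pi * norm z * exp (2 * pi * R * norm z) * norm (\<beta> \<gamma>)) summable_on A"
    by (rule summable_on_cmult_right[OF assms(1)])
  show "norm (primitive_term \<beta> z \<gamma>)
      \<le> 2 * pi * norm z * exp (2 * pi * R * norm z) * norm (\<beta> \<gamma>)" if "\<gamma> \<in> A" for \<gamma>
    using that assms(2) by (intro norm_primitive_term_le) auto
qed auto

lemma norm_primitive_series_diff_le:
  assumes "(\<lambda>\<gamma>. norm (\<beta> \<gamma>)) summable_on A" "A \<subseteq> {0<..R}" "\<bar>Im z\<bar> \<le> S" "\<bar>Im w\<bar> \<le> S"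
  shows "norm (primitive_series A \<beta> z - primitive_series A \<beta> w)
    \<le> 2 * pi * norm (z - w) * exp (2 * pi * R * S) * (\<Sum>\<^sub>\<infinity>\<gamma>\<in>A. norm (\<beta> \<gamma>))"
proof -
  define t where "t \<gamma> = primitive_term \<beta> z \<gamma> - primitive_term \<beta> w \<gamma>" for \<gamma>
  let ?C = "2 * pi * norm (z - w) * exp (2 * pi * R * S)"
  have t_le: "norm (t \<gamma>) \<le> ?C * norm (\<beta> \<gamma>)" if "\<gamma> \<in> A" for \<gamma>
    unfolding t_def using that assms by (intro norm_primitive_term_diff_le) auto
  have majorant: "(\<lambda>\<gamma>. ?C * norm (\<beta> \<gamma>)) summable_on A"
    by (rule summable_on_cmult_right[OF assms(1)])
  have t_summable: "(\<lambda>\<gamma>. norm (t \<gamma>)) summable_on A"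
    by (rule summable_on_comparison_test[OF majorant t_le]) auto
  have "primitive_series A \<beta> z - primitive_series A \<beta> w = infsum t A"
    unfolding primitive_series_def t_def
    by (intro infsum_diff[symmetric] primitive_series_summable[OF assms(1,2)])
  also have "norm \<dots> \<le> (\<Sum>\<^sub>\<infinity>\<gamma>\<in>A. norm (t \<gamma>))" by (rule norm_infsum_bound[OF t_summable])
  also have "\<dots> \<le> (\<Sum>\<^sub>\<infinity>\<gamma>\<in>A. ?C * norm (\<beta> \<gamma>))" by (rule infsum_mono[OF t_summable majorant t_le])
  finally show ?thesis by (simp only: infsum_cmult_right')
qed

lemma primitive_series_has_field_derivative:
  assumes "(\<lambda>\<gamma>. norm (\<beta> \<gamma>)) summable_on A" "A \<subseteq> {0<..R}"
  shows "(primitive_series A \<beta> has_field_derivative 2 * pi * \<i> * exp_series A \<beta> z) (at z)"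
proof -
  define S where "S = norm z + 1"
  have "(primitive_series A \<beta> has_field_derivative
      (\<Sum>\<^sub>\<infinity>\<gamma>\<in>A. \<beta> \<gamma> * (2 * pi * \<i> * of_real \<gamma> * freq_exp \<gamma> z - 0) / of_real \<gamma>)) (at z)"
    unfolding primitive_series_def[abs_def]
  proof (rule has_field_derivative_infsum_dominated)
    show "(\<lambda>\<gamma>. 2 * pi * S * exp (2 * pi * R * S) * norm (\<beta> \<gamma>)) summable_on A"
      by (rule summable_on_cmult_right[OF assms(1)])
    show "norm (primitive_term \<beta> w \<gamma>) \<le> 2 * pi * S * exp (2 * pi * R * S) * norm (\<beta> \<gamma>)"
      if "\<gamma> \<in> A" "w \<in> cball z 1" for \<gamma> w
    proof (rule norm_primitive_term_le)
      show "norm w \<le> S"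
        using that(2) norm_triangle_ineq[of "w - z" z]
        by (simp add: S_def dist_norm norm_minus_commute)
    qed (use that assms(2) in auto)
    show "((\<lambda>w. primitive_term \<beta> w \<gamma>) has_field_derivative
        \<beta> \<gamma> * (2 * pi * \<i> * of_real \<gamma> * freq_exp \<gamma> w - 0) / of_real \<gamma>) (at w)" for \<gamma> w
      unfolding primitive_term_def
      by (intro DERIV_cdivide DERIV_cmult DERIV_diff freq_exp_has_field_derivative DERIV_const)
  qed auto
  also have "(\<Sum>\<^sub>\<infinity>\<gamma>\<in>A. \<beta> \<gamma> * (2 * pi * \<i> * of_real \<gamma> * freq_exp \<gamma> z - 0) / of_real \<gamma>)
      = (\<Sum>\<^sub>\<infinity>\<gamma>\<in>A. 2 * pi * \<i> * (\<beta> \<gamma> * freq_exp \<gamma> z))"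
    by (rule infsum_cong) (use assms(2) in auto)
  finally show ?thesis by (simp only: infsum_cmult_right' exp_series_def)
qed

lemma primitive_series_holomorphic:
  assumes "(\<lambda>\<gamma>. norm (\<beta> \<gamma>)) summable_on A" "A \<subseteq> {0<..R}"
  shows "primitive_series A \<beta> holomorphic_on S"
  unfolding holomorphic_on_def field_differentiable_def
  by (intro ballI exI, rule has_field_derivative_at_within,
      rule primitive_series_has_field_derivative[OF assms])

subsection \<open>Schwartz functions\<close>

definition rapidly_decreasing :: "(real \<Rightarrow> complex) \<Rightarrow> bool" where
  "rapidly_decreasing f \<longleftrightarrow> (\<forall>k. \<exists>C. \<forall>t. \<bar>t\<bar> ^ k * norm (f t) \<le> C)"

lemma schwartz_iff_rapidly_decreasing:
  "schwartz \<phi> \<longleftrightarrow> (\<forall>m t. vderiv m \<phi> differentiable (at t)) \<and> (\<forall>m. rapidly_decreasing (vderiv m \<phi>))"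
proof -
  have "bounded (range (\<lambda>t. \<bar>t\<bar> ^ k * norm (f t))) \<longleftrightarrow> (\<exists>C. \<forall>t. \<bar>t\<bar> ^ k * norm (f t) \<le> C)"
    for k and f :: "real \<Rightarrow> complex"
    by (simp add: bounded_iff abs_mult)
  then show ?thesis unfolding schwartz_def rapidly_decreasing_def by auto
qed

lemma rapidly_decreasing_add:
  assumes "rapidly_decreasing f" "rapidly_decreasing g"
  shows "rapidly_decreasing (\<lambda>t. f t + g t)"
  unfolding rapidly_decreasing_def
proof
  fix k
  obtain B C where bounds: "\<And>t. \<bar>t\<bar> ^ k * norm (f t) \<le> B" "\<And>t. \<bar>t\<bar> ^ k * norm (g t) \<le> C"
    using assms unfolding rapidly_decreasing_def by blast
  have "\<bar>t\<bar> ^ k * norm (f t + g t) \<le> B + C" for t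
  proof -
    have "\<bar>t\<bar> ^ k * norm (f t + g t) \<le> \<bar>t\<bar> ^ k * (norm (f t) + norm (g t))"
      by (intro mult_left_mono norm_triangle_ineq) auto
    also have "\<dots> \<le> B + C" unfolding distrib_left by (intro add_mono bounds)
    finally show ?thesis .
  qed
  then show "\<exists>C. \<forall>t. \<bar>t\<bar> ^ k * norm (f t + g t) \<le> C" by blast
qed

lemma rapidly_decreasing_cmult:
  assumes "rapidly_decreasing f"
  shows "rapidly_decreasing (\<lambda>t. c * f t)"
  unfolding rapidly_decreasing_def
proof
  fix k
  obtain B where "\<And>t. \<bar>t\<bar> ^ k * norm (f t) \<le> B"
    using assms unfolding rapidly_decreasing_def by blast
  then have "norm c * (\<bar>t\<bar> ^ k * norm (f t)) \<le> norm c * B" for t by (intro mult_left_mono) auto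
  then show "\<exists>C. \<forall>t. \<bar>t\<bar> ^ k * norm (c * f t) \<le> C" by (auto simp: norm_mult mult_ac)
qed

lemma rapidly_decreasing_mult_of_real:
  assumes "rapidly_decreasing f"
  shows "rapidly_decreasing (\<lambda>t. of_real t * f t)"
  unfolding rapidly_decreasing_def
proof
  fix k
  obtain B where "\<And>t. \<bar>t\<bar> ^ Suc k * norm (f t) \<le> B"
    using assms unfolding rapidly_decreasing_def by blast
  then show "\<exists>C. \<forall>t. \<bar>t\<bar> ^ k * norm (of_real t * f t) \<le> C" by (auto simp: norm_mult mult_ac)
qed

lemma schwartz_of_derivative_closed:
  assumes deriv: "\<And>\<phi>. \<phi> \<in> P \<Longrightarrow> \<exists>\<psi>\<in>P. \<forall>t. (\<phi> has_vector_derivative \<psi> t) (at t)"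
    and decreasing: "\<And>\<phi>. \<phi> \<in> P \<Longrightarrow> rapidly_decreasing \<phi>"
    and "\<phi> \<in> P"
  shows "schwartz \<phi>"
proof -
  have "vderiv m \<phi> \<in> P" for m
  proof (induction m)
    case (Suc m)
    then obtain \<psi> where \<psi>: "\<psi> \<in> P" "\<And>t. (vderiv m \<phi> has_vector_derivative \<psi> t) (at t)"
      using deriv by blast
    then have "vderiv (Suc m) \<phi> = \<psi>"
      by (auto intro!: ext vector_derivative_at)
    then show ?case using \<psi> by simp
  qed (simp add: assms(3))
  moreover have "\<psi> differentiable (at t)" if "\<psi> \<in> P" for \<psi> t
    using deriv[OF that] differentiableI_vector by blast
  ultimately show ?thesis unfolding schwartz_iff_rapidly_decreasing using decreasing by blast
qed

lemma schwartz_vderiv: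
  assumes "schwartz \<phi>"
  shows "schwartz (vderiv m \<phi>)"
proof -
  have "vderiv k (vderiv m \<phi>) = vderiv (k + m) \<phi>" for k by (induction k) auto
  then show ?thesis using assms unfolding schwartz_def by simp
qed

lemma schwartz_imp_continuous:
  assumes "schwartz \<phi>"
  shows "continuous_on UNIV \<phi>"
proof (rule continuous_at_imp_continuous_on, rule ballI)
  fix t
  have "vderiv 0 \<phi> differentiable (at t)" using assms unfolding schwartz_def by blast
  then show "isCont \<phi> t" by (simp add: differentiable_imp_continuous_within)
qed

lemma schwartz_inverse_square_bound:
  assumes "schwartz \<phi>"
  obtains C where "\<And>t. norm (\<phi> t) \<le> C * inverse (1 + t\<^sup>2)"
proof -
  have "rapidly_decreasing \<phi>"
    using assms unfolding schwartz_iff_rapidly_decreasing by (metis vderiv.simps(1))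
  then obtain B C where bounds: "\<And>t. \<bar>t\<bar> ^ 0 * norm (\<phi> t) \<le> B" "\<And>t. \<bar>t\<bar> ^ 2 * norm (\<phi> t) \<le> C"
    unfolding rapidly_decreasing_def by blast
  have "norm (\<phi> t) \<le> (B + C) * inverse (1 + t\<^sup>2)" for t
  proof -
    have "norm (\<phi> t) * (1 + t\<^sup>2) \<le> B + C"
      using add_mono[OF bounds[of t]] by (simp add: algebra_simps)
    moreover have "1 + t\<^sup>2 > 0" by (simp add: add_pos_nonneg)
    ultimately show ?thesis by (simp add: field_simps)
  qed
  then show ?thesis using that by blast
qed

lemma schwartz_imp_integrable:
  assumes "schwartz \<phi>"
  shows "integrable lborel \<phi>"
proof -
  obtain C where bound: "\<And>t. norm (\<phi> t) \<le> C * inverse (1 + t\<^sup>2)"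
    using schwartz_inverse_square_bound[OF assms] by blast
  have "integrable lborel (\<lambda>t::real. inverse (1 + t\<^sup>2))"
    using integrable_inverse_1_plus_square
    unfolding set_integrable_def einterval_eq_UNIV indicator_UNIV by simp
  then have "integrable lborel (\<lambda>t. C * inverse (1 + t\<^sup>2))" by (rule integrable_mult_right)
  moreover have "\<phi> \<in> borel_measurable borel"
    by (rule borel_measurable_continuous_onI[OF schwartz_imp_continuous[OF assms]])
  ultimately show ?thesis
    by (elim Bochner_Integration.integrable_bound) (auto intro!: AE_I2 order.trans[OF bound])
qed

lemma schwartz_tendsto_0:
  assumes "schwartz \<phi>"
  shows "(\<phi> \<longlongrightarrow> 0) at_top" "(\<phi> \<longlongrightarrow> 0) at_bot"
proof -
  obtain C where "\<And>t. norm (\<phi> t) \<le> C * inverse (1 + t\<^sup>2)"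
    using schwartz_inverse_square_bound[OF assms] by blast
  then have bound: "\<forall>\<^sub>F t in F. norm (\<phi> t) \<le> C * inverse (1 + t\<^sup>2)" for F by simp
  have "((\<lambda>t. C * inverse (1 + t\<^sup>2)) \<longlongrightarrow> 0) at_top" "((\<lambda>t. C * inverse (1 + t\<^sup>2)) \<longlongrightarrow> 0) at_bot"
    by real_asymp+
  then show "(\<phi> \<longlongrightarrow> 0) at_top" "(\<phi> \<longlongrightarrow> 0) at_bot"
    by (auto intro: Lim_null_comparison[OF bound])
qed

lemma integral_vector_derivative_eq_0:
  fixes f :: "real \<Rightarrow> 'a :: euclidean_space"
  assumes "\<And>t. (f has_vector_derivative f' t) (at t)" "continuous_on UNIV f'" "integrable lborel f'"
    and "(f \<longlongrightarrow> 0) at_top" "(f \<longlongrightarrow> 0) at_bot"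
  shows "(LINT t|lborel. f' t) = 0"
proof -
  have "(LBINT t=-\<infinity>..\<infinity>. f' t) = 0 - 0"
  proof (rule interval_integral_FTC_integrable)
    show "isCont f' t" for t using assms(2) by (simp add: continuous_on_eq_continuous_at)
    show "set_integrable lborel (einterval (- \<infinity>) \<infinity>) f'"
      using assms(3) by (simp add: set_integrable_def einterval_def)
    show "((f \<circ> real_of_ereal) \<longlongrightarrow> 0) (at_right (- \<infinity>))" "((f \<circ> real_of_ereal) \<longlongrightarrow> 0) (at_left \<infinity>)"
      using assms(4,5) by (simp_all add: ereal_tendsto_simps1)
  qed (use assms(1) in simp_all)
  then show ?thesis
    by (simp add: interval_lebesgue_integral_def set_lebesgue_integral_def einterval_def)
qed

subsection \<open>Fourier transforms of Schwartz functions\<close>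

lemma freq_exp_has_vector_derivative:
  "((\<lambda>t. freq_exp t z) has_vector_derivative 2 * pi * \<i> * z * freq_exp t z) (at t)"
proof -
  have "((\<lambda>w. exp (2 * pi * \<i> * w * z)) has_field_derivative
      2 * pi * \<i> * z * exp (2 * pi * \<i> * w * z)) (at w)" for w
    by (auto intro!: derivative_eq_intros)
  from has_vector_derivative_real_field[OF this[of "of_real t"]]
  show ?thesis by (simp add: o_def freq_exp_def[abs_def])
qed

lemma continuous_on_freq_exp: "continuous_on A (\<lambda>t. freq_exp t z)"
  unfolding freq_exp_def by (intro continuous_intros)

lemma norm_freq_exp_minus_of_real [simp]: "norm (freq_exp t (- of_real \<xi>)) = 1"
  by (simp add: norm_freq_exp)

lemma fourier_eq_freq_exp: "fourier \<phi> \<xi> = (LINT t|lborel. \<phi> t * freq_exp t (- of_real \<xi>))"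
  unfolding fourier_def freq_exp_def
  by (intro Bochner_Integration.integral_cong refl) (simp add: mult_ac)

lemma integrable_mult_freq_exp:
  assumes "integrable lborel \<phi>"
  shows "integrable lborel (\<lambda>t. \<phi> t * freq_exp t (- of_real \<xi>))"
proof (rule Bochner_Integration.integrable_bound[OF assms])
  show "(\<lambda>t. \<phi> t * freq_exp t (- of_real \<xi>)) \<in> borel_measurable lborel"
    using assms by (intro borel_measurable_times)
      (auto intro!: borel_measurable_continuous_onI continuous_on_freq_exp)
qed (simp add: norm_mult)

lemma fourier_add:
  assumes "integrable lborel \<phi>" "integrable lborel \<psi>"
  shows "fourier (\<lambda>t. \<phi> t + \<psi> t) \<xi> = fourier \<phi> \<xi> + fourier \<psi> \<xi>"
  unfolding fourier_eq_freq_exp distrib_right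
  by (intro Bochner_Integration.integral_add integrable_mult_freq_exp assms)

lemma fourier_cmult: "fourier (\<lambda>t. c * \<phi> t) \<xi> = c * fourier \<phi> \<xi>"
  unfolding fourier_eq_freq_exp mult.assoc by (rule integral_mult_right_zero)

lemma fourier_vector_derivative:
  assumes "schwartz \<phi>" and deriv: "\<And>t. (\<phi> has_vector_derivative \<psi> t) (at t)"
  shows "fourier \<psi> \<xi> = 2 * pi * \<i> * of_real \<xi> * fourier \<phi> \<xi>"
proof -
  let ?e = "\<lambda>t. freq_exp t (- of_real \<xi>)"
  let ?a = "2 * pi * \<i> * of_real \<xi>"
  define W where "W t = \<psi> t * ?e t - ?a * (\<phi> t * ?e t)" for t
  have "\<psi> = vderiv 1 \<phi>" using deriv by (auto intro!: ext vector_derivative_at[symmetric])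
  then have "schwartz \<psi>" using schwartz_vderiv[OF assms(1), of 1] by (simp only:)
  then have integrable: "integrable lborel (\<lambda>t. \<phi> t * ?e t)" "integrable lborel (\<lambda>t. \<psi> t * ?e t)"
    using assms(1) by (auto intro: integrable_mult_freq_exp schwartz_imp_integrable)
  have "(LINT t|lborel. W t) = 0"
  proof (rule integral_vector_derivative_eq_0)
    show "((\<lambda>t. \<phi> t * ?e t) has_vector_derivative W t) (at t)" for t
      using has_vector_derivative_mult[OF deriv[of t]
          freq_exp_has_vector_derivative[of "- of_real \<xi>"]]
      by (simp add: W_def algebra_simps)
    show "continuous_on UNIV W"
      unfolding W_def using assms(1) \<open>schwartz \<psi>\<close>
      by (intro continuous_intros continuous_on_freq_exp schwartz_imp_continuous)
    show "integrable lborel W"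
      unfolding W_def
      by (intro Bochner_Integration.integrable_diff integrable_mult_right integrable)
    have "((\<lambda>t. \<phi> t * ?e t) \<longlongrightarrow> 0) F" if "(\<phi> \<longlongrightarrow> 0) F" for F
      by (rule tendsto_norm_zero_cancel) (use tendsto_norm_zero[OF that] in \<open>simp add: norm_mult\<close>)
    then show "((\<lambda>t. \<phi> t * ?e t) \<longlongrightarrow> 0) at_top" "((\<lambda>t. \<phi> t * ?e t) \<longlongrightarrow> 0) at_bot"
      using schwartz_tendsto_0[OF assms(1)] by blast+
  qed
  then have "(LINT t|lborel. \<psi> t * ?e t) = ?a * (LINT t|lborel. \<phi> t * ?e t)"
    unfolding W_def using integrable by (subst (asm) Bochner_Integration.integral_diff) auto
  then show ?thesis unfolding fourier_eq_freq_exp .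
qed

subsection \<open>Gaussians\<close>

definition gaussian :: "real \<Rightarrow> complex \<Rightarrow> real \<Rightarrow> complex" where
  "gaussian q \<kappa> t = exp (- of_real (q * t\<^sup>2) + \<kappa> * of_real t)"

lemma norm_gaussian: "norm (gaussian q \<kappa> t) = exp (- q * t\<^sup>2 + Re \<kappa> * t)"
  by (simp add: gaussian_def norm_exp_eq_Re)

lemma gaussian_of_real: "gaussian q (of_real \<kappa>) t = of_real (exp (- q * t\<^sup>2 + \<kappa> * t))"
  by (simp add: gaussian_def exp_of_real[symmetric])

lemma continuous_on_gaussian: "continuous_on A (gaussian q \<kappa>)"
  unfolding gaussian_def by (intro continuous_intros)

lemma gaussian_measurable [measurable]: "gaussian q \<kappa> \<in> borel_measurable borel"
  by (rule borel_measurable_continuous_onI[OF continuous_on_gaussian])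

lemma power_le_fact_exp:
  fixes x :: real
  assumes "x \<ge> 0"
  shows "x ^ n \<le> fact n * exp x"
proof -
  have "(\<Sum>k\<in>{n}. x ^ k /\<^sub>R fact k) \<le> (\<Sum>k. x ^ k /\<^sub>R fact k)"
    by (rule sum_le_suminf[OF summable_exp_generic]) (use assms in auto)
  then have "x ^ n / fact n \<le> exp x"
    by (simp add: exp_def divide_inverse_commute)
  then show ?thesis by (simp add: field_simps)
qed

lemma power_mult_norm_gaussian_le:
  assumes "q > 0"
  shows "\<bar>t\<bar> ^ k * norm (gaussian q \<kappa> t) \<le> fact k * exp ((1 + \<bar>Re \<kappa>\<bar>)\<^sup>2 / (4 * q))"
proof -
  define c where "c = 1 + \<bar>Re \<kappa>\<bar>"
  have "\<bar>t\<bar> ^ k * norm (gaussian q \<kappa> t) \<le> (fact k * exp \<bar>t\<bar>) * exp (- q * t\<^sup>2 + \<bar>Re \<kappa>\<bar> * \<bar>t\<bar>)"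
    unfolding norm_gaussian
    by (intro mult_mono power_le_fact_exp) (auto simp flip: abs_mult)
  also have "\<dots> = fact k * exp (- q * t\<^sup>2 + c * \<bar>t\<bar>)"
    by (simp add: c_def algebra_simps flip: exp_add)
  also have "\<dots> \<le> fact k * exp (c\<^sup>2 / (4 * q))"
  proof -
    have "0 \<le> (2 * q * \<bar>t\<bar> - c)\<^sup>2 / (4 * q)" using assms by simp
    also have "\<dots> = c\<^sup>2 / (4 * q) - (- q * t\<^sup>2 + c * \<bar>t\<bar>)"
      using assms by (simp add: field_simps power2_eq_square)
    finally show ?thesis by simp
  qed
  finally show ?thesis by (simp add: c_def)
qed

lemma rapidly_decreasing_poly_gaussian:
  assumes "q > 0"
  shows "rapidly_decreasing (\<lambda>t. poly p (of_real t) * gaussian q \<kappa> t)"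
proof (induction p)
  case 0
  show ?case by (auto simp: rapidly_decreasing_def)
next
  case (pCons a p)
  have "rapidly_decreasing (gaussian q \<kappa>)"
    using power_mult_norm_gaussian_le[OF assms] unfolding rapidly_decreasing_def by blast
  then have "rapidly_decreasing
      (\<lambda>t. a * gaussian q \<kappa> t + of_real t * (poly p (of_real t) * gaussian q \<kappa> t))"
    by (intro rapidly_decreasing_add rapidly_decreasing_cmult
        rapidly_decreasing_mult_of_real[OF pCons.IH])
  then show ?case by (simp add: algebra_simps)
qed

lemma poly_gaussian_has_vector_derivative:
  "((\<lambda>t. poly p (of_real t) * gaussian q \<kappa> t) has_vector_derivative
     poly (pderiv p + p * [:\<kappa>, - 2 * of_real q:]) (of_real t) * gaussian q \<kappa> t) (at t)"
proof -
  have "((\<lambda>z. poly p z * exp (- of_real q * z\<^sup>2 + \<kappa> * z)) has_field_derivative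
     poly (pderiv p + p * [:\<kappa>, - 2 * of_real q:]) z * exp (- of_real q * z\<^sup>2 + \<kappa> * z)) (at z)" for z
    by (auto intro!: derivative_eq_intros poly_DERIV simp: algebra_simps)
  from has_vector_derivative_real_field[OF this[of "of_real t"]]
  show ?thesis by (simp add: gaussian_def o_def)
qed

lemma schwartz_poly_gaussian:
  assumes "q > 0"
  shows "schwartz (\<lambda>t. poly p (of_real t) * gaussian q \<kappa> t)"
proof (rule schwartz_of_derivative_closed)
  let ?P = "range (\<lambda>p t. poly p (of_real t) * gaussian q \<kappa> t)"
  fix \<phi> assume "\<phi> \<in> ?P"
  then obtain p where \<phi>: "\<phi> = (\<lambda>t. poly p (of_real t) * gaussian q \<kappa> t)" by auto
  show "\<exists>\<psi>\<in>?P. \<forall>t. (\<phi> has_vector_derivative \<psi> t) (at t)"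
    unfolding \<phi>
    by (intro bexI[OF _ rangeI[of _ "pderiv p + p * [:\<kappa>, - 2 * of_real q:]"]] allI
        poly_gaussian_has_vector_derivative)
  show "rapidly_decreasing \<phi>"
    unfolding \<phi> by (rule rapidly_decreasing_poly_gaussian[OF assms])
qed (rule rangeI)

lemma schwartz_gaussian:
  assumes "q > 0"
  shows "schwartz (gaussian q \<kappa>)"
proof -
  have "(\<lambda>t. poly [:1:] (of_real t) * gaussian q \<kappa> t) = gaussian q \<kappa>" by (rule ext) simp
  then show ?thesis using schwartz_poly_gaussian[OF assms, of "[:1:]" \<kappa>] by (simp only:)
qed

lemma integrable_gaussian: "q > 0 \<Longrightarrow> integrable lborel (gaussian q \<kappa>)"
  by (intro schwartz_imp_integrable schwartz_gaussian)

lemma fourier_gaussian_pi: "fourier (gaussian pi 0) \<xi> = of_real (exp (- (pi * \<xi>\<^sup>2)))"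
proof -
  define s where "s = sqrt (2 * pi)"
  have s: "s > 0" "s\<^sup>2 = 2 * pi" by (auto simp: s_def)
  have rescale: "s *\<^sub>R (std_normal_density (s * t) *\<^sub>R iexp (- s * \<xi> * (s * t)))
      = gaussian pi 0 t * freq_exp t (- of_real \<xi>)" for t
  proof -
    have "s * std_normal_density (s * t) = exp (- (pi * t\<^sup>2))"
      using s(1) by (simp add: std_normal_density_def power_mult_distrib s(2) flip: s_def)
    moreover have "iexp (- s * \<xi> * (s * t)) = freq_exp t (- of_real \<xi>)"
      unfolding freq_exp_def using s(2)
      by (intro arg_cong[where f = exp])
         (simp add: algebra_simps power2_eq_square flip: of_real_mult)
    ultimately show ?thesis
      by (simp add: gaussian_def scaleR_conv_of_real exp_of_real
          flip: of_real_minus of_real_mult mult.assoc)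
  qed
  have "of_real (exp (- ((s * \<xi>)\<^sup>2 / 2))) = char std_normal_distribution (- s * \<xi>)"
    by (simp add: char_std_normal_distribution)
  also have "\<dots> = (LINT x|lborel. std_normal_density x *\<^sub>R iexp (- s * \<xi> * x))"
    unfolding char_def by (subst integral_density) (auto simp: normal_density_nonneg)
  also have "\<dots>
      = s *\<^sub>R (LINT t|lborel. std_normal_density (0 + s * t) *\<^sub>R iexp (- s * \<xi> * (0 + s * t)))"
    using s(1) by (subst lborel_integral_real_affine[of s _ 0]) auto
  also have "\<dots> = fourier (gaussian pi 0) \<xi>"
    unfolding fourier_eq_freq_exp add_0 integral_scaleR_right[symmetric] rescale ..
  finally show ?thesis by (simp add: power_mult_distrib s(2))
qed

lemma fourier_gaussian:
  assumes "r > 0"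
  shows "fourier (gaussian (pi / r\<^sup>2) (2 * pi * \<i> * of_real x)) \<xi>
    = of_real (r * exp (- (pi * (r * (\<xi> - x))\<^sup>2)))"
proof -
  let ?g = "gaussian (pi / r\<^sup>2) (2 * pi * \<i> * of_real x)"
  have "?g (0 + r * t) * freq_exp (0 + r * t) (- of_real \<xi>)
      = gaussian pi 0 t * freq_exp t (- of_real (r * (\<xi> - x)))" for t
    using assms unfolding gaussian_def freq_exp_def mult_exp_exp
    by (intro arg_cong[where f = exp]) (simp add: field_simps power_mult_distrib)
  then have "fourier ?g \<xi> = r *\<^sub>R fourier (gaussian pi 0) (r * (\<xi> - x))"
    unfolding fourier_eq_freq_exp using assms
    by (subst lborel_integral_real_affine[of r _ 0]) auto
  then show ?thesis by (simp add: fourier_gaussian_pi scaleR_conv_of_real)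
qed

lemma integral_gaussian_pi: "(LINT v|lborel. gaussian pi 0 v) = 1"
  using fourier_gaussian_pi[of 0] by (simp add: fourier_eq_freq_exp)

lemma integral_half_gaussian_pi: "(LINT v|lborel. indicator {..<0} v *\<^sub>R gaussian pi 0 v) = 1 / 2"
proof -
  let ?g = "gaussian pi 0"
  have integrable: "integrable lborel (\<lambda>v. indicator A v *\<^sub>R ?g v)" if "A \<in> sets borel" for A
    using that by (intro integrable_mult_indicator integrable_gaussian) auto
  have "(LINT v|lborel. indicator {..<0} v *\<^sub>R ?g v)
      = (LINT v|lborel. indicator {..<0} (0 + - 1 * v) *\<^sub>R ?g (0 + - 1 * v))"
    by (subst lborel_integral_real_affine[of "- 1" _ 0]) auto
  also have "\<dots> = (LINT v|lborel. indicator {0<..} v *\<^sub>R ?g v)"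
    by (intro Bochner_Integration.integral_cong) (auto simp: gaussian_def indicator_def)
  finally have reflect: "(LINT v|lborel. indicator {..<0} v *\<^sub>R ?g v)
      = (LINT v|lborel. indicator {0<..} v *\<^sub>R ?g v)" .
  have "AE v in lborel. v \<noteq> (0::real)" by (rule AE_lborel_singleton)
  then have "AE v in lborel. ?g v = indicator {..<0} v *\<^sub>R ?g v + indicator {0<..} v *\<^sub>R ?g v"
    by eventually_elim (auto simp: indicator_def)
  then have "(LINT v|lborel. ?g v)
      = (LINT v|lborel. indicator {..<0} v *\<^sub>R ?g v + indicator {0<..} v *\<^sub>R ?g v)"
    by (intro integral_cong_AE) auto
  also have "\<dots>
      = (LINT v|lborel. indicator {..<0} v *\<^sub>R ?g v) + (LINT v|lborel. indicator {0<..} v *\<^sub>R ?g v)"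
    by (intro Bochner_Integration.integral_add integrable) auto
  finally show ?thesis unfolding integral_gaussian_pi reflect[symmetric] by (simp add: mult.commute)
qed

subsection \<open>Mollified one-sided exponentials\<close>

lemma half_line_integral_has_vector_derivative:
  fixes g :: "real \<Rightarrow> complex"
  assumes "continuous_on UNIV g" and integrable: "integrable lborel g"
  shows "((\<lambda>s. LINT v|lborel. indicator {..<s} v *\<^sub>R g v) has_vector_derivative g s) (at s)"
proof -
  have split: "(LINT v|lborel. indicator {..<u} v *\<^sub>R g v)
      = (LBINT v=-\<infinity>..s-1. g v) + (LBINT v=s-1..u. g v)" for u :: real
  proof -
    have "(LBINT v=-\<infinity>..s-1. g v) + (LBINT v=s-1..u. g v) = (LBINT v=-\<infinity>..u. g v)"
    proof (rule interval_integral_sum)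
      show "interval_lebesgue_integrable lborel (min (- \<infinity>) (min (ereal (s - 1)) (ereal u)))
              (max (- \<infinity>) (max (ereal (s - 1)) (ereal u))) g"
        using integrable_mult_indicator[OF _ integrable]
        by (auto simp: interval_lebesgue_integrable_def set_integrable_def max_def)
    qed
    then show ?thesis by (simp add: interval_lebesgue_integral_def set_lebesgue_integral_def)
  qed
  have "((\<lambda>u. LBINT v=s-1..u. g v) has_vector_derivative g s) (at s within {s-1..s+1})"
    by (rule interval_integral_FTC2) (use assms in \<open>auto intro: continuous_on_subset\<close>)
  then have "((\<lambda>u. LBINT v=s-1..u. g v) has_vector_derivative g s) (at s)"
    by (subst (asm) at_within_Icc_at) auto
  then show ?thesis unfolding split
    using has_vector_derivative_add[OF has_vector_derivative_const[of "LBINT v=-\<infinity>..s-1. g v"]]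
    by force
qed

text \<open>The convolution of the one-sided exponential \<open>t \<mapsto> exp (2 \<pi> i z t)\<close> on \<open>t > 0\<close> with the
  Gaussian \<open>exp (- \<pi> (t/r)\<^sup>2) / r\<close>, written as a half-line integral.\<close>

definition smooth_exp :: "real \<Rightarrow> complex \<Rightarrow> real \<Rightarrow> complex" where
  "smooth_exp r z t =
     (LINT v|lborel. indicator {..<t / r} v *\<^sub>R gaussian pi (- (2 * pi * \<i> * z * of_real r)) v)
       * freq_exp t z"

lemma smooth_exp_has_vector_derivative:
  assumes "r > 0"
  shows "(smooth_exp r z has_vector_derivative
     2 * pi * \<i> * z * smooth_exp r z t + of_real (1 / r) * gaussian (pi / r\<^sup>2) 0 t) (at t)"
proof -
  define \<kappa> where "\<kappa> = - (2 * pi * \<i> * z * of_real r)"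
  define Q where "Q s = (LINT v|lborel. indicator {..<s} v *\<^sub>R gaussian pi \<kappa> v)" for s :: real
  have "(Q has_vector_derivative gaussian pi \<kappa> (t / r)) (at (t / r))"
    unfolding Q_def
    by (rule half_line_integral_has_vector_derivative
        [OF continuous_on_gaussian integrable_gaussian]) simp
  moreover have "((\<lambda>t. t / r) has_vector_derivative 1 / r) (at t)"
    using assms
    by (auto intro!: derivative_eq_intros simp flip: has_real_derivative_iff_has_vector_derivative)
  ultimately have "((\<lambda>t. Q (t / r)) has_vector_derivative (1 / r) *\<^sub>R gaussian pi \<kappa> (t / r)) (at t)"
    using vector_diff_chain_at[of "\<lambda>t. t / r" "1 / r" t Q] by (simp add: o_def)
  from has_vector_derivative_mult[OF this freq_exp_has_vector_derivative[of z t]]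
  have "(smooth_exp r z has_vector_derivative Q (t / r) * (2 * pi * \<i> * z * freq_exp t z)
      + (1 / r) *\<^sub>R gaussian pi \<kappa> (t / r) * freq_exp t z) (at t)"
    by (simp add: smooth_exp_def[abs_def] Q_def \<kappa>_def)
  moreover have "gaussian pi \<kappa> (t / r) * freq_exp t z = gaussian (pi / r\<^sup>2) 0 t"
    unfolding gaussian_def freq_exp_def mult_exp_exp \<kappa>_def using assms
    by (intro arg_cong[where f = exp]) (simp add: field_simps power2_eq_square)
  ultimately show ?thesis
    by (simp add: smooth_exp_def Q_def \<kappa>_def scaleR_conv_of_real mult_ac)
qed

definition one_sided_decay :: "real \<Rightarrow> real \<Rightarrow> real" where
  "one_sided_decay y t = (if t \<ge> 0 then exp (- 2 * pi * y * t) else exp (- (pi / 2) * t\<^sup>2))"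

definition smooth_exp_majorant :: "real \<Rightarrow> real \<Rightarrow> real" where
  "smooth_exp_majorant y v = norm (gaussian pi (of_real (2 * pi * y)) v)
     + norm (gaussian pi (of_real (- 2 * pi * y)) v) + norm (gaussian (pi / 2) 0 v)"

lemma integrable_smooth_exp_majorant: "integrable lborel (smooth_exp_majorant y)"
  unfolding smooth_exp_majorant_def
  by (intro Bochner_Integration.integrable_add integrable_norm integrable_gaussian) auto

lemma norm_gaussian_le_majorant:
  assumes "0 < r" "r \<le> 1" "Im z > 0"
  shows "norm (gaussian pi (- (2 * pi * \<i> * z * of_real r)) v) \<le> smooth_exp_majorant (Im z) v"
proof -
  have "norm (gaussian pi (- (2 * pi * \<i> * z * of_real r)) v)
      = exp (- pi * v\<^sup>2 + 2 * pi * Im z * (r * v))"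
    by (simp add: norm_gaussian mult_ac)
  also have "\<dots> \<le> exp (- pi * v\<^sup>2 + 2 * pi * Im z * \<bar>v\<bar>)"
  proof -
    have "r * v \<le> \<bar>r * v\<bar>" by simp
    also have "\<dots> \<le> \<bar>v\<bar>" using assms by (simp add: abs_mult mult_left_le_one_le)
    finally show ?thesis using assms by simp
  qed
  also have "\<dots> \<le> exp (- pi * v\<^sup>2 + 2 * pi * Im z * v) + exp (- pi * v\<^sup>2 - 2 * pi * Im z * v)"
    by (cases "v \<ge> 0") auto
  also have "\<dots> \<le> smooth_exp_majorant (Im z) v" by (simp add: smooth_exp_majorant_def norm_gaussian)
  finally show ?thesis .
qed

lemma norm_gaussian_exp_le_decay:
  assumes "0 < r" "r \<le> 1" "Im z > 0" "v < t / r"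
  shows "norm (gaussian pi (- (2 * pi * \<i> * z * of_real r)) v) * exp (- 2 * pi * Im z * t)
    \<le> smooth_exp_majorant (Im z) v * one_sided_decay (Im z) t"
proof (cases "t \<ge> 0")
  case True
  then show ?thesis
    using norm_gaussian_le_majorant[OF assms(1-3), of v] by (simp add: one_sided_decay_def)
next
  case False
  have "r * v < t" using assms by (simp add: field_simps)
  have "t / r \<le> t" using False assms by (simp add: field_simps mult_le_cancel_left2)
  then have "v < t" using assms(4) by simp
  have "norm (gaussian pi (- (2 * pi * \<i> * z * of_real r)) v) * exp (- 2 * pi * Im z * t)
      = exp (- pi * v\<^sup>2) * exp (- (2 * pi * Im z) * (t - r * v))"
    by (simp add: norm_gaussian algebra_simps flip: exp_add)
  also have "\<dots> \<le> exp (- pi * v\<^sup>2) * 1"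
    using \<open>r * v < t\<close> assms by (intro mult_left_mono) (auto simp: mult_nonneg_nonneg)
  also have "\<dots> \<le> exp (- (pi / 2) * v\<^sup>2) * exp (- (pi / 2) * t\<^sup>2)"
  proof -
    have "t\<^sup>2 \<le> v\<^sup>2" using \<open>v < t\<close> False by (simp add: abs_le_square_iff[symmetric])
    then have "pi * t\<^sup>2 \<le> pi * v\<^sup>2" by simp
    then show ?thesis unfolding mult_exp_exp mult_1_right exp_le_cancel_iff by linarith
  qed
  also have "\<dots> \<le> smooth_exp_majorant (Im z) v * exp (- (pi / 2) * t\<^sup>2)"
    by (intro mult_right_mono) (auto simp: smooth_exp_majorant_def norm_gaussian)
  finally show ?thesis using False by (simp add: one_sided_decay_def)
qed

lemma norm_smooth_exp_le:
  assumes "0 < r" "r \<le> 1" "Im z > 0"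
  shows "norm (smooth_exp r z t)
    \<le> (LINT v|lborel. smooth_exp_majorant (Im z) v) * one_sided_decay (Im z) t"
proof -
  let ?g = "gaussian pi (- (2 * pi * \<i> * z * of_real r))"
  let ?h = "\<lambda>v. indicator {..<t / r} v *\<^sub>R ?g v * freq_exp t z"
  have "norm (smooth_exp r z t) = norm (LINT v|lborel. ?h v)"
    unfolding smooth_exp_def by (subst integral_mult_left_zero) simp
  also have "\<dots> \<le> (LINT v|lborel. norm (?h v))" by (rule integral_norm_bound)
  also have "\<dots> \<le> (LINT v|lborel. smooth_exp_majorant (Im z) v * one_sided_decay (Im z) t)"
  proof (rule integral_mono)
    show "integrable lborel (\<lambda>v. norm (?h v))"
      by (intro integrable_norm integrable_mult_left integrable_mult_indicator
          integrable_gaussian) auto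
    show "integrable lborel (\<lambda>v. smooth_exp_majorant (Im z) v * one_sided_decay (Im z) t)"
      by (intro integrable_mult_left integrable_smooth_exp_majorant)
    show "norm (?h v) \<le> smooth_exp_majorant (Im z) v * one_sided_decay (Im z) t" for v
      using norm_gaussian_exp_le_decay[OF assms, of v t]
      by (cases "v < t / r")
        (simp_all add: norm_mult norm_freq_exp mult_ac smooth_exp_majorant_def one_sided_decay_def)
  qed
  finally show ?thesis by simp
qed

lemma power_mult_one_sided_decay_le:
  assumes "y > 0"
  shows "\<bar>t\<bar> ^ k * one_sided_decay y t
    \<le> fact k / (2 * pi * y) ^ k + fact k * exp (1 / (2 * pi))"
proof (cases "t \<ge> 0")
  case True
  have "(2 * pi * y * t) ^ k * exp (- 2 * pi * y * t)
      \<le> (fact k * exp (2 * pi * y * t)) * exp (- 2 * pi * y * t)"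
    using True assms by (intro mult_right_mono power_le_fact_exp) auto
  then have "(2 * pi * y * t) ^ k * exp (- 2 * pi * y * t) \<le> fact k"
    by (simp add: mult.assoc mult_exp_exp)
  then have "t ^ k * exp (- 2 * pi * y * t) \<le> fact k / (2 * pi * y) ^ k"
    using assms by (simp add: field_simps power_mult_distrib)
  then show ?thesis using True by (simp add: one_sided_decay_def add_increasing2)
next
  case False
  then show ?thesis using power_mult_norm_gaussian_le[of "pi / 2" t k 0] assms
    by (simp add: one_sided_decay_def norm_gaussian add_increasing)
qed

lemma rapidly_decreasing_smooth_exp:
  assumes "0 < r" "r \<le> 1" "Im z > 0"
  shows "rapidly_decreasing (smooth_exp r z)"
  unfolding rapidly_decreasing_def
proof (intro allI exI)
  fix k t
  define C where "C = (LINT v|lborel. smooth_exp_majorant (Im z) v)"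
  have "C \<ge> 0" unfolding C_def
    by (intro Bochner_Integration.integral_nonneg) (simp add: smooth_exp_majorant_def)
  have "\<bar>t\<bar> ^ k * norm (smooth_exp r z t) \<le> \<bar>t\<bar> ^ k * (C * one_sided_decay (Im z) t)"
    unfolding C_def by (intro mult_left_mono norm_smooth_exp_le assms) auto
  also have "\<dots> = C * (\<bar>t\<bar> ^ k * one_sided_decay (Im z) t)" by simp
  also have "\<dots> \<le> C * (fact k / (2 * pi * Im z) ^ k + fact k * exp (1 / (2 * pi)))"
    by (intro mult_left_mono power_mult_one_sided_decay_le assms(3) \<open>C \<ge> 0\<close>)
  finally show "\<bar>t\<bar> ^ k * norm (smooth_exp r z t)
      \<le> (LINT v|lborel. smooth_exp_majorant (Im z) v)
          * (fact k / (2 * pi * Im z) ^ k + fact k * exp (1 / (2 * pi)))"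
    by (simp only: C_def)
qed

lemma schwartz_smooth_exp:
  assumes "0 < r" "r \<le> 1" "Im z > 0"
  shows "schwartz (smooth_exp r z)"
proof -
  define q where "q = pi / r\<^sup>2"
  have "q > 0" using assms by (simp add: q_def)
  define comb where "comb = (\<lambda>(c, p) t. c * smooth_exp r z t + poly p (of_real t) * gaussian q 0 t)"
  show ?thesis
  proof (rule schwartz_of_derivative_closed[where P = "range comb"])
    have "smooth_exp r z = comb (1, 0)" by (simp add: comb_def)
    then show "smooth_exp r z \<in> range comb" by blast
  next
    fix \<phi> assume "\<phi> \<in> range comb"
    then obtain c p where \<phi>: "\<phi> = (\<lambda>t. c * smooth_exp r z t + poly p (of_real t) * gaussian q 0 t)"
      by (auto simp: comb_def)
    show "rapidly_decreasing \<phi>"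
      unfolding \<phi> by (intro rapidly_decreasing_add rapidly_decreasing_cmult
          rapidly_decreasing_smooth_exp rapidly_decreasing_poly_gaussian assms \<open>q > 0\<close>)
    define p' where "p' = pderiv p + p * [:0, - 2 * of_real q:]"
    have "(\<phi> has_vector_derivative
        c * (2 * pi * \<i> * z * smooth_exp r z t + of_real (1 / r) * gaussian q 0 t)
          + poly p' (of_real t) * gaussian q 0 t) (at t)" for t
      unfolding \<phi> p'_def q_def
      by (intro has_vector_derivative_add poly_gaussian_has_vector_derivative
          has_vector_derivative_mult_right smooth_exp_has_vector_derivative assms(1))
    then have "\<forall>t. (\<phi> has_vector_derivative
        comb (c * (2 * pi * \<i> * z), p' + [:c * of_real (1 / r):]) t) (at t)"
      by (simp add: comb_def algebra_simps)
    then show "\<exists>\<psi>\<in>range comb. \<forall>t. (\<phi> has_vector_derivative \<psi> t) (at t)" by blast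
  qed
qed

definition smoothed_cauchy :: "real \<Rightarrow> complex \<Rightarrow> real \<Rightarrow> complex" where
  "smoothed_cauchy r z x = of_real (exp (- (pi * (r * x)\<^sup>2))) / (2 * pi * \<i> * (of_real x - z))"

lemma fourier_smooth_exp:
  assumes "0 < r" "r \<le> 1" "Im z > 0"
  shows "fourier (smooth_exp r z) \<xi> = smoothed_cauchy r z \<xi>"
proof -
  let ?g = "gaussian (pi / r\<^sup>2) 0"
  have schwartz: "schwartz (smooth_exp r z)" "schwartz ?g"
    using assms by (auto intro: schwartz_smooth_exp schwartz_gaussian)
  have "2 * pi * \<i> * of_real \<xi> * fourier (smooth_exp r z) \<xi>
      = fourier (\<lambda>t. 2 * pi * \<i> * z * smooth_exp r z t + of_real (1 / r) * ?g t) \<xi>"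
    by (rule fourier_vector_derivative[symmetric,
          OF schwartz(1) smooth_exp_has_vector_derivative[OF assms(1)]])
  also have "\<dots> = 2 * pi * \<i> * z * fourier (smooth_exp r z) \<xi> + of_real (1 / r) * fourier ?g \<xi>"
    using schwartz_imp_integrable[OF schwartz(1)] schwartz_imp_integrable[OF schwartz(2)]
    by (subst fourier_add) (auto simp only: fourier_cmult intro!: integrable_mult_right)
  also have "of_real (1 / r) * fourier ?g \<xi> = of_real (exp (- (pi * (r * \<xi>)\<^sup>2)))"
    using fourier_gaussian[OF assms(1), of 0 \<xi>] assms(1) by simp
  finally have "(2 * pi * \<i> * (of_real \<xi> - z)) * fourier (smooth_exp r z) \<xi>
      = of_real (exp (- (pi * (r * \<xi>)\<^sup>2)))"
    by (simp add: algebra_simps)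
  moreover have "of_real \<xi> - z \<noteq> 0" using assms(3) by (auto simp: complex_eq_iff)
  ultimately show ?thesis by (simp add: smoothed_cauchy_def field_simps)
qed

lemma tendsto_indicator_scaled_half_line:
  fixes t v :: real
  assumes r: "\<And>n. 0 < r n" "r \<longlonglongrightarrow> 0"
  shows "(\<lambda>n. indicator {..<t / r n} v :: real)
    \<longlonglongrightarrow> indicator (if t = 0 then {..<0} else if t > 0 then UNIV else {}) v"
    (is "_ \<longlonglongrightarrow> indicator ?J v")
proof -
  have "filterlim r (at_right 0) sequentially"
    using r less_imp_neq[OF r(1), symmetric] by (simp add: filterlim_at)
  then have inverse_at_top: "filterlim (\<lambda>n. inverse (r n)) at_top sequentially"
    by (rule filterlim_compose[OF filterlim_inverse_at_top_right])
  have "eventually (\<lambda>n. v < t / r n \<longleftrightarrow> v \<in> ?J) sequentially"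
  proof (cases t "0 :: real" rule: linorder_cases)
    case less
    then have "filterlim (\<lambda>n. t * inverse (r n)) at_bot sequentially"
      by (intro filterlim_tendsto_neg_mult_at_bot[OF tendsto_const _ inverse_at_top])
    then have "eventually (\<lambda>n. t * inverse (r n) < v) sequentially"
      by (simp add: filterlim_at_bot_dense)
    then show ?thesis by eventually_elim (use less in \<open>simp add: divide_inverse\<close>)
  next
    case greater
    then have "filterlim (\<lambda>n. t * inverse (r n)) at_top sequentially"
      by (intro filterlim_tendsto_pos_mult_at_top[OF tendsto_const _ inverse_at_top])
    then have "eventually (\<lambda>n. v < t * inverse (r n)) sequentially"
      by (simp add: filterlim_at_top_dense)
    then show ?thesis by eventually_elim (use greater in \<open>simp add: divide_inverse\<close>)
  qed simp
  then show ?thesis by (intro tendsto_eventually) (auto elim!: eventually_mono simp: indicator_def)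
qed

lemma smooth_exp_tendsto:
  assumes r: "\<And>n. 0 < r n" "\<And>n. r n \<le> 1" "r \<longlonglongrightarrow> 0" and "Im z > 0"
  shows "(\<lambda>n. smooth_exp (r n) z t) \<longlonglongrightarrow> of_real ((1 + sgn t) / 2) * freq_exp t z"
proof -
  define J where "J = (if t = 0 then {..<0} else if t > 0 then UNIV else {} :: real set)"
  define \<kappa> where "\<kappa> n = - (2 * pi * \<i> * z * of_real (r n))" for n
  have "(\<lambda>n. LINT v|lborel. indicator {..<t / r n} v *\<^sub>R gaussian pi (\<kappa> n) v)
      \<longlonglongrightarrow> (LINT v|lborel. indicator J v *\<^sub>R gaussian pi 0 v)"
  proof (rule integral_dominated_convergence[where w = "smooth_exp_majorant (Im z)"])
    show "AE v in lborel. norm (indicator {..<t / r n} v *\<^sub>R gaussian pi (\<kappa> n) v)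
        \<le> smooth_exp_majorant (Im z) v" for n
      using norm_gaussian_le_majorant[OF r(1,2) assms(4), of n] unfolding \<kappa>_def
      by (intro AE_I2) (simp add: indicator_def smooth_exp_majorant_def)
    have "\<kappa> \<longlonglongrightarrow> - (2 * pi * \<i> * z * of_real 0)"
      unfolding \<kappa>_def by (intro tendsto_intros r(3))
    then have "(\<lambda>n. gaussian pi (\<kappa> n) v) \<longlonglongrightarrow> gaussian pi 0 v" for v
      unfolding gaussian_def by (intro tendsto_intros) simp
    then show "AE v in lborel. (\<lambda>n. indicator {..<t / r n} v *\<^sub>R gaussian pi (\<kappa> n) v)
        \<longlonglongrightarrow> indicator J v *\<^sub>R gaussian pi 0 v"
      unfolding J_def
      by (intro AE_I2 tendsto_scaleR tendsto_indicator_scaled_half_line r(1,3))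
  qed (auto simp: J_def integrable_smooth_exp_majorant)
  also have "(LINT v|lborel. indicator J v *\<^sub>R gaussian pi 0 v) = of_real ((1 + sgn t) / 2)"
    by (simp add: J_def integral_gaussian_pi integral_half_gaussian_pi)
  finally show ?thesis
    unfolding smooth_exp_def \<kappa>_def by (rule tendsto_mult_right)
qed

lemma smooth_exp_imaginary_axis:
  "smooth_exp 1 (\<i> * of_real y) t = of_real ((LINT v|lborel. indicator {..<t} v *\<^sub>R
     exp (- pi * v\<^sup>2 + 2 * pi * y * v)) * exp (- 2 * pi * y * t))"
proof -
  have "- (2 * pi * \<i> * (\<i> * of_real y) * of_real 1) = complex_of_real (2 * pi * y)"
    by (simp add: mult_ac)
  moreover have "freq_exp t (\<i> * of_real y) = of_real (exp (- 2 * pi * y * t))"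
    unfolding freq_exp_def exp_of_real[symmetric]
    by (intro arg_cong[where f = exp]) (simp add: algebra_simps)
  ultimately show ?thesis
    unfolding smooth_exp_def by (simp only: gaussian_of_real)
      (simp add: scaleR_conv_of_real integral_complex_of_real flip: of_real_mult)
qed

lemma norm_smooth_exp_ge:
  assumes "y > 0" "t > 0"
  shows "exp (- pi - 2 * pi * y) * exp (- 2 * pi * y * t) \<le> norm (smooth_exp 1 (\<i> * of_real y) t)"
proof -
  define h where "h v = exp (- pi * v\<^sup>2 + 2 * pi * y * v)" for v :: real
  have "h = (\<lambda>v. norm (gaussian pi (of_real (2 * pi * y)) v))"
    by (auto simp: norm_gaussian h_def)
  then have "integrable lborel h" using integrable_norm[OF integrable_gaussian[of pi]] by simp
  have "exp (- pi - 2 * pi * y)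
      = (LINT v|lborel. indicator {-1..0::real} v *\<^sub>R exp (- pi - 2 * pi * y))"
    by simp
  also have "\<dots> \<le> (LINT v|lborel. indicator {..<t} v *\<^sub>R h v)"
  proof (rule integral_mono)
    show "integrable lborel (\<lambda>v. indicator {..<t} v *\<^sub>R h v)"
      by (intro integrable_mult_indicator \<open>integrable lborel h\<close>) auto
    show "indicator {-1..0} v *\<^sub>R exp (- pi - 2 * pi * y) \<le> indicator {..<t} v *\<^sub>R h v" for v
    proof (cases "v \<in> {-1..0}")
      case True
      then have "v\<^sup>2 \<le> 1\<^sup>2" by (intro power2_le_iff_abs_le[THEN iffD2]) auto
      then have "pi * v\<^sup>2 \<le> pi" by simp
      moreover have "2 * pi * y * (-1) \<le> 2 * pi * y * v"
        using True assms by (intro mult_left_mono) auto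
      ultimately have "- pi - 2 * pi * y \<le> - pi * v\<^sup>2 + 2 * pi * y * v" by linarith
      then show ?thesis using True assms by (simp add: h_def)
    qed (simp add: h_def)
  qed auto
  finally have "exp (- pi - 2 * pi * y) \<le> (LINT v|lborel. indicator {..<t} v *\<^sub>R h v)" .
  then show ?thesis
    unfolding smooth_exp_imaginary_axis norm_of_real abs_mult h_def[symmetric]
    by (simp add: mult_right_mono)
qed

subsection \<open>Cauchy and Poisson kernels\<close>

lemma summable_on_int_inverse_square: "(\<lambda>k::int. 1 / (1 + (real_of_int k)\<^sup>2)) summable_on UNIV"
proof -
  let ?f = "\<lambda>k::int. 1 / (1 + (real_of_int k)\<^sup>2)"
  have "summable (\<lambda>n::nat. 1 / (1 + (real n)\<^sup>2))"
  proof (rule summable_comparison_test[OF _ inverse_power_summable[of 2]])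
    show "\<exists>N. \<forall>n\<ge>N. norm (1 / (1 + (real n)\<^sup>2)) \<le> inverse ((real n)\<^sup>2)"
      by (intro exI[of _ 1]) (auto simp: field_simps add_pos_nonneg)
  qed simp
  then have "(\<lambda>n::nat. 1 / (1 + (real n)\<^sup>2)) summable_on UNIV"
    by (intro norm_summable_imp_summable_on) simp
  moreover have "bij_betw int UNIV {0..}"
    by (rule bij_betwI[of _ _ _ nat]) auto
  moreover have "bij_betw (\<lambda>n. - int n) UNIV {..0}"
    by (rule bij_betwI[of _ _ _ "\<lambda>k. nat (- k)"]) auto
  ultimately have "?f summable_on {0..}" "?f summable_on {..0}"
    using summable_on_reindex_bij_betw[of int UNIV "{0..}" ?f]
      summable_on_reindex_bij_betw[of "\<lambda>n. - int n" UNIV "{..0}" ?f] by simp_all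
  then have "?f summable_on ({0..} \<union> {..0})" by (rule summable_on_union)
  moreover have "{0..} \<union> {..0} = (UNIV :: int set)" by auto
  ultimately show ?thesis by simp
qed

lemma one_plus_square_pos: "0 < 1 + (x :: real)\<^sup>2"
  by (simp add: add_pos_nonneg)

lemma inverse_square_le:
  fixes x d :: real
  assumes "0 < d" "d \<le> \<bar>x\<bar>"
  shows "1 / x\<^sup>2 \<le> (1 + 1 / d\<^sup>2) * (1 / (1 + x\<^sup>2))"
proof -
  have "d\<^sup>2 \<le> x\<^sup>2" "0 < x\<^sup>2" using power_mono[OF assms(2), of 2] assms by auto
  then have "1 + x\<^sup>2 \<le> x\<^sup>2 * (1 + 1 / d\<^sup>2)" using assms(1) by (simp add: field_simps)
  then show ?thesis
    using \<open>0 < x\<^sup>2\<close> one_plus_square_pos[of x] by (simp add: divide_le_eq le_divide_eq mult_ac)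
qed

definition cauchy_const :: "complex \<Rightarrow> real" where
  "cauchy_const z = 2 + (1 + 2 * (norm z)\<^sup>2) / (Im z)\<^sup>2"

lemma inverse_dist_square_le:
  assumes "Im z > 0"
  shows "1 / (norm (z - of_real x))\<^sup>2 \<le> cauchy_const z * (1 / (1 + x\<^sup>2))"
proof -
  define d where "d = norm (z - of_real x)"
  have "Im z \<le> d" using abs_Im_le_cmod[of "z - of_real x"] by (simp add: d_def)
  then have "(Im z)\<^sup>2 \<le> d\<^sup>2" "d > 0" using assms by (auto intro: power_mono)
  have "\<bar>x\<bar> \<le> d + norm z"
    unfolding d_def using norm_triangle_ineq[of "of_real x - z" z] by (simp add: norm_minus_commute)
  then have "\<bar>x\<bar>\<^sup>2 \<le> (d + norm z)\<^sup>2" by (intro power_mono) auto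
  also have "\<dots> \<le> 2 * d\<^sup>2 + 2 * (norm z)\<^sup>2"
    using sum_squares_bound[of d "norm z"] by (simp add: power2_eq_square algebra_simps)
  finally have "1 + x\<^sup>2 \<le> 2 * d\<^sup>2 + (1 + 2 * (norm z)\<^sup>2)" by simp
  also have "1 + 2 * (norm z)\<^sup>2 = (1 + 2 * (norm z)\<^sup>2) / (Im z)\<^sup>2 * (Im z)\<^sup>2"
    using assms by simp
  also have "2 * d\<^sup>2 + \<dots> \<le> 2 * d\<^sup>2 + (1 + 2 * (norm z)\<^sup>2) / (Im z)\<^sup>2 * d\<^sup>2"
    by (intro add_left_mono mult_left_mono \<open>(Im z)\<^sup>2 \<le> d\<^sup>2\<close>) auto
  also have "\<dots> = cauchy_const z * d\<^sup>2" by (simp add: cauchy_const_def algebra_simps)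
  finally have "(1 + x\<^sup>2) * 1 \<le> cauchy_const z * d\<^sup>2" by simp
  then show ?thesis using \<open>d > 0\<close> one_plus_square_pos[of x] by (simp add: field_simps d_def)
qed

lemma norm_cauchy_kernel_diff_le:
  assumes "Im z > 0" "Im w > 0"
  shows "norm (1 / (z - of_real x) - 1 / (w - of_real x))
    \<le> norm (w - z) * (cauchy_const z + cauchy_const w) * (1 / (1 + x\<^sup>2))"
proof -
  define d e where "d = norm (z - of_real x)" and "e = norm (w - of_real x)"
  have nonzero: "z \<noteq> of_real x" "w \<noteq> of_real x" using assms by auto
  have "0 \<le> (1 / d - 1 / e)\<^sup>2" by simp
  then have "2 * (1 / (d * e)) \<le> 1 / d\<^sup>2 + 1 / e\<^sup>2"
    by (simp add: power2_diff power_divide)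
  moreover have "0 \<le> 1 / (d * e)" by (simp add: d_def e_def)
  ultimately have "1 / (d * e) \<le> 1 / d\<^sup>2 + 1 / e\<^sup>2" by linarith
  also have "\<dots> \<le> cauchy_const z * (1 / (1 + x\<^sup>2)) + cauchy_const w * (1 / (1 + x\<^sup>2))"
    unfolding d_def e_def by (intro add_mono inverse_dist_square_le assms)
  finally have inverse_le: "1 / (d * e) \<le> (cauchy_const z + cauchy_const w) * (1 / (1 + x\<^sup>2))"
    by (simp only: distrib_right)
  have "1 / (z - of_real x) - 1 / (w - of_real x) = (w - z) / ((z - of_real x) * (w - of_real x))"
    using nonzero by (simp add: field_simps)
  then have "norm (1 / (z - of_real x) - 1 / (w - of_real x)) = norm (w - z) * (1 / (d * e))"
    by (simp add: norm_divide norm_mult d_def e_def)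
  also have "\<dots> \<le> norm (w - z) * ((cauchy_const z + cauchy_const w) * (1 / (1 + x\<^sup>2)))"
    by (rule mult_left_mono[OF inverse_le norm_ge_zero])
  finally show ?thesis by (simp only: mult.assoc)
qed

definition poisson_kernel :: "real \<Rightarrow> real \<Rightarrow> real" where
  "poisson_kernel y u = y / (u\<^sup>2 + y\<^sup>2)"

lemma Im_cauchy_kernel: "Im (1 / (Complex u y - of_real x)) = - poisson_kernel y (u - x)"
  by (simp add: poisson_kernel_def Im_divide)

lemma poisson_kernel_nonneg: "y > 0 \<Longrightarrow> poisson_kernel y u \<ge> 0"
  by (simp add: poisson_kernel_def)

lemma continuous_on_poisson_kernel: "y > 0 \<Longrightarrow> continuous_on A (\<lambda>u. poisson_kernel y (u - x))"
  unfolding poisson_kernel_def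
  by (intro continuous_intros) (auto simp: sum_power2_eq_zero_iff)

lemma poisson_kernel_le:
  assumes "y > 0" "\<bar>u\<bar> \<le> R"
  shows "poisson_kernel y (u - x) \<le> y * cauchy_const (Complex R y) * (1 / (1 + x\<^sup>2))"
proof -
  have "u\<^sup>2 \<le> R\<^sup>2" using assms(2) power_mono[of "\<bar>u\<bar>" R 2] by simp
  then have "cauchy_const (Complex u y) \<le> cauchy_const (Complex R y)"
    unfolding cauchy_const_def by (auto simp: cmod_power2 intro!: divide_right_mono)
  then have "cauchy_const (Complex u y) * (1 / (1 + x\<^sup>2))
      \<le> cauchy_const (Complex R y) * (1 / (1 + x\<^sup>2))"
    by (intro mult_right_mono) auto
  then have "1 / (norm (Complex u y - of_real x))\<^sup>2 \<le> cauchy_const (Complex R y) * (1 / (1 + x\<^sup>2))"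
    using inverse_dist_square_le[of "Complex u y" x] assms(1) by simp
  moreover have "(norm (Complex u y - of_real x))\<^sup>2 = (u - x)\<^sup>2 + y\<^sup>2"
    by (simp add: cmod_power2)
  ultimately have "1 / ((u - x)\<^sup>2 + y\<^sup>2) \<le> cauchy_const (Complex R y) * (1 / (1 + x\<^sup>2))" by simp
  from mult_left_mono[OF this, of y] assms(1) show ?thesis by (simp add: poisson_kernel_def)
qed

definition arctan_weight :: "real \<Rightarrow> real \<Rightarrow> real \<Rightarrow> real \<Rightarrow> real" where
  "arctan_weight y p q x = arctan ((q - x) / y) - arctan ((p - x) / y)"

lemma arctan_weight_nonneg: "y > 0 \<Longrightarrow> p \<le> q \<Longrightarrow> arctan_weight y p q x \<ge> 0"
  unfolding arctan_weight_def by (simp add: arctan_le_iff divide_right_mono)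

lemma arctan_weight_le_pi: "arctan_weight y p q x \<le> pi"
  unfolding arctan_weight_def
  using arctan_ubound[of "(q - x) / y"] arctan_lbound[of "(p - x) / y"] by simp

lemma DERIV_arctan_poisson_kernel:
  assumes "y > 0"
  shows "((\<lambda>u. arctan ((u - x) / y)) has_real_derivative poisson_kernel y (u - x)) (at u)"
proof -
  have "((\<lambda>u. arctan ((u - x) / y)) has_real_derivative
      (1 / y) * inverse (1 + ((u - x) / y)\<^sup>2)) (at u)"
    by (auto intro!: derivative_eq_intros simp: divide_inverse)
  moreover have "1 + ((u - x) / y)\<^sup>2 = ((u - x)\<^sup>2 + y\<^sup>2) / y\<^sup>2"
    using assms by (simp add: field_simps)
  ultimately show ?thesis using assms by (simp add: poisson_kernel_def power2_eq_square)
qed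

lemma has_integral_poisson_kernel:
  assumes "y > 0" "p \<le> q"
  shows "((\<lambda>u. poisson_kernel y (u - x)) has_integral arctan_weight y p q x) {p..q}"
  unfolding arctan_weight_def
proof (rule fundamental_theorem_of_calculus[OF assms(2)])
  fix u
  show "((\<lambda>u. arctan ((u - x) / y)) has_vector_derivative poisson_kernel y (u - x)) (at u within {p..q})"
    using DERIV_arctan_poisson_kernel[OF assms(1), of x u]
    unfolding has_real_derivative_iff_has_vector_derivative
    by (rule has_vector_derivative_at_within)
qed

lemma arctan_weight_inside:
  assumes "y > 0" "d > 0" "p + d \<le> x" "x \<le> q - d"
  shows "arctan_weight y p q x \<ge> pi - 2 * y / d"
proof -
  have "arctan (d / y) \<le> arctan ((q - x) / y)" "arctan (d / y) \<le> arctan ((x - p) / y)"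
    using assms by (auto simp: arctan_le_iff intro!: divide_right_mono)
  moreover have "arctan ((p - x) / y) = - arctan ((x - p) / y)"
    by (simp add: arctan_minus[symmetric] minus_divide_left)
  moreover have "arctan (y / d) = pi / 2 - arctan (d / y)"
    using arctan_inverse[of "d / y"] assms by (simp add: inverse_eq_divide)
  moreover have "arctan (y / d) \<le> y / d" using assms by (intro arctan_le_self) auto
  ultimately show ?thesis unfolding arctan_weight_def by linarith
qed

lemma arctan_weight_outside:
  assumes "y > 0" "d > 0" "p \<le> q" "d \<le> \<bar>s - x\<bar>"
    and nearest: "\<And>u. p < u \<Longrightarrow> u < q \<Longrightarrow> \<bar>s - x\<bar> \<le> \<bar>u - x\<bar>"
  shows "arctan_weight y p q x \<le> (q - p) * y * (1 + 1 / d\<^sup>2) * (1 / (1 + (x - s)\<^sup>2))"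
proof (cases "p = q")
  case False
  then have "p < q" using assms(3) by simp
  obtain u where u: "p < u" "u < q" "arctan_weight y p q x = (q - p) * poisson_kernel y (u - x)"
    unfolding arctan_weight_def
    using MVT2[OF \<open>p < q\<close> DERIV_arctan_poisson_kernel[OF assms(1)], of x] by blast
  have dist: "0 < d" "d \<le> \<bar>x - s\<bar>" using assms(2,4) by (simp_all add: abs_minus_commute)
  have "(x - s)\<^sup>2 \<le> (u - x)\<^sup>2 + y\<^sup>2"
    using power_mono[OF nearest[OF u(1,2)], of 2] by (simp add: power2_commute add_increasing2)
  then have "poisson_kernel y (u - x) \<le> y / (x - s)\<^sup>2"
    unfolding poisson_kernel_def using dist assms(1)
    by (intro divide_left_mono mult_pos_pos) (auto intro: add_nonneg_pos)
  also have "\<dots> \<le> y * ((1 + 1 / d\<^sup>2) * (1 / (1 + (x - s)\<^sup>2)))"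
    using mult_left_mono[OF inverse_square_le[OF dist], of y] assms(1) by simp
  finally have "(q - p) * poisson_kernel y (u - x)
      \<le> (q - p) * (y * ((1 + 1 / d\<^sup>2) * (1 / (1 + (x - s)\<^sup>2))))"
    using assms(3) by (intro mult_left_mono) auto
  then show ?thesis unfolding u(3) by (simp only: mult.assoc)
qed (simp add: arctan_weight_def)

lemma arctan_weight_le_tails:
  assumes "y > 0" "d > 0" "p \<le> q" "x \<le> p - d \<or> x \<ge> q + d"
  defines "K \<equiv> (q - p) * y * (1 + 1 / d\<^sup>2)"
  shows "arctan_weight y p q x \<le> K * (1 / (1 + (x - p)\<^sup>2)) + K * (1 / (1 + (x - q)\<^sup>2))"
proof -
  have "K \<ge> 0" using assms by (simp add: K_def)
  then have nonneg: "0 \<le> K * (1 / (1 + (x - s)\<^sup>2))" for s by simp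
  show ?thesis
    using assms(4)
  proof
    assume "x \<le> p - d"
    then have "arctan_weight y p q x \<le> K * (1 / (1 + (x - p)\<^sup>2))"
      unfolding K_def using assms(2) by (intro arctan_weight_outside[OF assms(1-3)]) auto
    then show ?thesis using nonneg[of q] by linarith
  next
    assume "x \<ge> q + d"
    then have "arctan_weight y p q x \<le> K * (1 / (1 + (x - q)\<^sup>2))"
      unfolding K_def using assms(2) by (intro arctan_weight_outside[OF assms(1-3)]) auto
    then show ?thesis using nonneg[of p] by linarith
  qed
qed

subsection \<open>Point families with bounded Cauchy sums\<close>

locale bounded_cauchy_sums =
  fixes a :: "'i \<Rightarrow> real"
  assumes cauchy_summable: "(\<lambda>n. 1 / (1 + (a n - x)\<^sup>2)) summable_on UNIV"
    and cauchy_bdd_above: "bdd_above (range (\<lambda>x. \<Sum>\<^sub>\<infinity>n. 1 / (1 + (a n - x)\<^sup>2)))"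

lemma bounded_cauchy_sumsI:
  assumes "\<And>x X. finite X \<Longrightarrow> (\<Sum>n\<in>X. 1 / (1 + (a n - x)\<^sup>2)) \<le> B"
  shows "bounded_cauchy_sums a"
proof
  fix x
  show summable: "(\<lambda>n. 1 / (1 + (a n - x)\<^sup>2)) summable_on UNIV" for x
    using assms by (intro nonneg_bdd_above_summable_on bdd_aboveI[where M = B]) auto
  show "bdd_above (range (\<lambda>x. \<Sum>\<^sub>\<infinity>n. 1 / (1 + (a n - x)\<^sup>2)))"
    using infsum_le_finite_sums[OF summable assms] by (intro bdd_aboveI[where M = B]) auto
qed

lemma cauchy_kernel_le_gaussian:
  fixes t :: real
  shows "1 / (1 + t\<^sup>2) \<le> 3 * exp pi * (1 / (1 + (real_of_int \<lfloor>t\<rfloor>)\<^sup>2)) * exp (- (pi * (t - \<lfloor>t\<rfloor>)\<^sup>2))"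
proof -
  define s where "s = t - \<lfloor>t\<rfloor>"
  have "0 \<le> s" "s \<le> 1" unfolding s_def by linarith+
  then have "s\<^sup>2 \<le> 1\<^sup>2" by (intro power_mono) auto
  then have gaussian_ge: "1 \<le> exp pi * exp (- (pi * s\<^sup>2))" by (simp add: mult_exp_exp)
  have "(real_of_int \<lfloor>t\<rfloor>)\<^sup>2 = (t - s)\<^sup>2" by (simp add: s_def)
  also have "\<dots> \<le> 2 * t\<^sup>2 + 2 * s\<^sup>2"
    using sum_squares_bound[of t "- s"] by (simp add: power2_eq_square algebra_simps)
  also have "\<dots> \<le> 2 * t\<^sup>2 + 2" using \<open>s\<^sup>2 \<le> 1\<^sup>2\<close> by simp
  finally have "1 + (real_of_int \<lfloor>t\<rfloor>)\<^sup>2 \<le> 3 * (1 + t\<^sup>2)"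
    using zero_le_power2[of t] unfolding distrib_left by linarith
  then have "1 / (1 + t\<^sup>2) \<le> 3 * (1 / (1 + (real_of_int \<lfloor>t\<rfloor>)\<^sup>2)) * 1"
    using one_plus_square_pos[of t] one_plus_square_pos[of "real_of_int \<lfloor>t\<rfloor>"]
    by (simp add: field_simps)
  also have "\<dots> \<le> 3 * (1 / (1 + (real_of_int \<lfloor>t\<rfloor>)\<^sup>2)) * (exp pi * exp (- (pi * s\<^sup>2)))"
    by (intro mult_left_mono gaussian_ge) auto
  finally show ?thesis by (simp add: s_def mult_ac)
qed

lemma bounded_cauchy_sums_of_gaussian:
  assumes gaussian: "\<And>x X. finite X \<Longrightarrow> (\<Sum>n\<in>X. exp (- (pi * (a n - x)\<^sup>2))) \<le> B"
  shows "bounded_cauchy_sums a"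
proof (rule bounded_cauchy_sumsI)
  fix x and X :: "'a set" assume X: "finite X"
  define k where "k n = \<lfloor>a n - x\<rfloor>" for n
  define w where "w j = 3 * exp pi * (1 / (1 + (real_of_int j)\<^sup>2))" for j
  have "B \<ge> 0" using gaussian[of "{}"] by simp
  have "(\<Sum>n\<in>X. 1 / (1 + (a n - x)\<^sup>2)) \<le> (\<Sum>n\<in>X. w (k n) * exp (- (pi * (a n - (x + k n))\<^sup>2)))"
    using cauchy_kernel_le_gaussian[of "a _ - x"]
    by (intro sum_mono) (simp add: w_def k_def diff_diff_eq)
  also have "\<dots> = (\<Sum>j\<in>k ` X. \<Sum>n\<in>{n\<in>X. k n = j}. w (k n) * exp (- (pi * (a n - (x + k n))\<^sup>2)))"
    by (rule sum.image_gen[OF X])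
  also have "\<dots> = (\<Sum>j\<in>k ` X. w j * (\<Sum>n\<in>{n\<in>X. k n = j}. exp (- (pi * (a n - (x + j))\<^sup>2))))"
    by (intro sum.cong refl) (simp add: sum_distrib_left)
  also have "\<dots> \<le> (\<Sum>j\<in>k ` X. w j * B)"
    using X by (intro sum_mono mult_left_mono gaussian) (auto simp: w_def)
  also have "\<dots> = 3 * exp pi * B * (\<Sum>j\<in>k ` X. 1 / (1 + (real_of_int j)\<^sup>2))"
    by (simp add: w_def sum_distrib_left mult_ac)
  also have "\<dots> \<le> 3 * exp pi * B * (\<Sum>\<^sub>\<infinity>j::int. 1 / (1 + (real_of_int j)\<^sup>2))"
    using X \<open>B \<ge> 0\<close>
    by (intro mult_left_mono finite_sum_le_infsum summable_on_int_inverse_square) auto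
  finally show "(\<Sum>n\<in>X. 1 / (1 + (a n - x)\<^sup>2))
      \<le> 3 * exp pi * B * (\<Sum>\<^sub>\<infinity>j::int. 1 / (1 + (real_of_int j)\<^sup>2))" .
qed

context bounded_cauchy_sums
begin

definition cauchy_sup :: real where
  "cauchy_sup = (SUP x. \<Sum>\<^sub>\<infinity>n. 1 / (1 + (a n - x)\<^sup>2))"

lemma cauchy_sum_le: "(\<Sum>\<^sub>\<infinity>n. 1 / (1 + (a n - x)\<^sup>2)) \<le> cauchy_sup"
  unfolding cauchy_sup_def by (rule cSUP_upper[OF UNIV_I cauchy_bdd_above])

lemma cauchy_sup_nonneg: "cauchy_sup \<ge> 0"
  using order.trans[OF infsum_nonneg cauchy_sum_le] by simp

lemma summable_cauchy_kernel_diff: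
  assumes "Im z > 0" "Im w > 0"
  shows "(\<lambda>n. norm (1 / (z - of_real (a n)) - 1 / (w - of_real (a n)))) summable_on UNIV"
proof (rule summable_on_comparison_test)
  let ?C = "norm (w - z) * (cauchy_const z + cauchy_const w)"
  show "(\<lambda>n. ?C * (1 / (1 + (a n - 0)\<^sup>2))) summable_on UNIV"
    by (rule summable_on_cmult_right[OF cauchy_summable])
qed (use norm_cauchy_kernel_diff_le[OF assms] in auto)

definition poisson_sum :: "real \<Rightarrow> real \<Rightarrow> real" where
  "poisson_sum y x = (\<Sum>\<^sub>\<infinity>n. poisson_kernel y (x - a n))"

lemma summable_poisson_majorant:
  "(\<lambda>n. y * cauchy_const (Complex R y) * (1 / (1 + (a n)\<^sup>2))) summable_on UNIV"
  using summable_on_cmult_right[OF cauchy_summable[of 0]] by simp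

lemma summable_poisson_kernel:
  assumes "y > 0"
  shows "(\<lambda>n. poisson_kernel y (x - a n)) summable_on UNIV"
  by (rule summable_on_comparison_test
        [OF summable_poisson_majorant poisson_kernel_le[OF assms order_refl]])
     (use poisson_kernel_nonneg[OF assms] in auto)

definition weight_sum :: "real \<Rightarrow> real \<Rightarrow> real \<Rightarrow> real" where
  "weight_sum y p q = (\<Sum>\<^sub>\<infinity>n. arctan_weight y p q (a n))"

lemma
  assumes "y > 0" "p \<le> q"
  shows summable_arctan_weight: "(\<lambda>n. arctan_weight y p q (a n)) summable_on UNIV"
    and has_integral_poisson_sum: "(poisson_sum y has_integral weight_sum y p q) {p..q}"
proof -
  have dominated: "norm (poisson_kernel y (u - a n))
      \<le> y * cauchy_const (Complex (max \<bar>p\<bar> \<bar>q\<bar>) y) * (1 / (1 + (a n)\<^sup>2))" if "u \<in> {p..q}" for n u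
    using poisson_kernel_nonneg[OF assms(1)] that
      poisson_kernel_le[OF assms(1), of u "max \<bar>p\<bar> \<bar>q\<bar>" "a n"]
    by auto
  note exchange = has_integral_infsum_dominated[where I = UNIV
      and f = "\<lambda>n u. poisson_kernel y (u - a n)", OF has_integral_poisson_kernel[OF assms]
      continuous_on_poisson_kernel[OF assms(1)] dominated summable_poisson_majorant]
  show "(\<lambda>n. arctan_weight y p q (a n)) summable_on UNIV" by (rule exchange(1))
  show "(poisson_sum y has_integral weight_sum y p q) {p..q}"
    unfolding poisson_sum_def[abs_def] weight_sum_def by (rule exchange(2))
qed

definition poisson_almost_period :: "real \<Rightarrow> real \<Rightarrow> real \<Rightarrow> bool" where
  "poisson_almost_period y \<eta> \<tau> \<longleftrightarrow> (\<forall>x. \<bar>poisson_sum y (x + \<tau>) - poisson_sum y x\<bar> \<le> \<eta>)"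

lemma weight_sum_shift:
  assumes "y > 0" "p \<le> q" "poisson_almost_period y \<eta> \<tau>"
  shows "\<bar>weight_sum y (p + \<tau>) (q + \<tau>) - weight_sum y p q\<bar> \<le> \<eta> * (q - p)"
proof -
  have period: "\<bar>poisson_sum y (x + \<tau>) - poisson_sum y x\<bar> \<le> \<eta>" for x
    using assms(3) by (simp add: poisson_almost_period_def)
  have "\<eta> \<ge> 0" using order.trans[OF abs_ge_zero period] .
  have "(poisson_sum y has_integral weight_sum y (p + \<tau>) (q + \<tau>)) (cbox (p + \<tau>) (q + \<tau>))"
    using has_integral_poisson_sum[OF assms(1), of "p + \<tau>" "q + \<tau>"] assms(2) by simp
  from has_integral_affinity'[OF this, of 1 \<tau>]
  have "((\<lambda>u. poisson_sum y (u + \<tau>)) has_integral weight_sum y (p + \<tau>) (q + \<tau>)) {p..q}"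
    by simp
  then have "((\<lambda>u. poisson_sum y (u + \<tau>) - poisson_sum y u) has_integral
      (weight_sum y (p + \<tau>) (q + \<tau>) - weight_sum y p q)) (cbox p q)"
    using has_integral_diff[OF _ has_integral_poisson_sum[OF assms(1,2)]] by simp
  then have "norm (weight_sum y (p + \<tau>) (q + \<tau>) - weight_sum y p q) \<le> \<eta> * measure lborel (cbox p q)"
    by (rule has_integral_bound[OF \<open>\<eta> \<ge> 0\<close>]) (use period in auto)
  then show ?thesis using assms(2) by simp
qed

lemma weight_sum_ge:
  assumes "y > 0" "d > 0" "p \<le> q" "finite X" "\<And>n. n \<in> X \<Longrightarrow> p + d \<le> a n \<and> a n \<le> q - d"
  shows "real (card X) * (pi - 2 * y / d) \<le> weight_sum y p q"
proof -
  have "real (card X) * (pi - 2 * y / d) = (\<Sum>n\<in>X. pi - 2 * y / d)" by simp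
  also have "\<dots> \<le> (\<Sum>n\<in>X. arctan_weight y p q (a n))"
    using assms by (intro sum_mono arctan_weight_inside) auto
  also have "\<dots> \<le> weight_sum y p q"
    unfolding weight_sum_def using assms
    by (intro finite_sum_le_infsum summable_arctan_weight arctan_weight_nonneg) auto
  finally show ?thesis .
qed

lemma weight_sum_le:
  assumes "y > 0" "d > 0" "p \<le> q" "finite X"
    and far: "\<And>n. n \<notin> X \<Longrightarrow> a n \<le> p - d \<or> a n \<ge> q + d"
  shows "weight_sum y p q \<le> real (card X) * pi + (q - p) * y * (1 + 1 / d\<^sup>2) * (2 * cauchy_sup)"
proof -
  define K where "K = (q - p) * y * (1 + 1 / d\<^sup>2)"
  define g where "g n = (if n \<in> X then pi else 0)" for n
  define h where "h s n = K * (1 / (1 + (a n - s)\<^sup>2))" for s n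
  have "K \<ge> 0" using assms by (simp add: K_def)
  then have h_nonneg: "h s n \<ge> 0" for s n by (simp add: h_def)
  have weight_le: "arctan_weight y p q (a n) \<le> g n + (h p n + h q n)" for n
    using arctan_weight_le_pi[of y p q "a n"] h_nonneg[of p n] h_nonneg[of q n]
      arctan_weight_le_tails[OF assms(1-3) far, of n]
    by (cases "n \<in> X") (auto simp: g_def h_def K_def)
  have g: "(g has_sum real (card X) * pi) UNIV"
    using has_sum_finite[OF assms(4), of g]
    by (subst has_sum_cong_neutral[of X _ g g]) (auto simp: g_def)
  have h_summable: "h s summable_on UNIV" for s
    unfolding h_def by (rule summable_on_cmult_right[OF cauchy_summable])
  have h_le: "infsum (h s) UNIV \<le> K * cauchy_sup" for s
    unfolding h_def infsum_cmult_right' by (rule mult_left_mono[OF cauchy_sum_le \<open>K \<ge> 0\<close>])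
  have "weight_sum y p q \<le> (\<Sum>\<^sub>\<infinity>n. g n + (h p n + h q n))"
    unfolding weight_sum_def
    by (intro infsum_mono summable_arctan_weight summable_on_add h_summable
        has_sum_imp_summable[OF g] assms weight_le)
  also have "\<dots> = real (card X) * pi + (infsum (h p) UNIV + infsum (h q) UNIV)"
    using has_sum_imp_summable[OF g] h_summable
    by (simp add: infsum_add summable_on_add infsumI[OF g])
  also have "\<dots> \<le> real (card X) * pi + K * (2 * cauchy_sup)" using h_le[of p] h_le[of q] by simp
  finally show ?thesis by (simp only: K_def)
qed

end

subsection \<open>Counting points\<close>

lemma exists_point_far_from_finite:
  fixes F :: "real set"
  assumes "finite F" "\<delta> \<ge> 0" "2 * \<delta> * real (card F) < q - p"
  obtains x where "p \<le> x" "x \<le> q" "\<And>f. f \<in> F \<Longrightarrow> \<delta> \<le> \<bar>f - x\<bar>"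
proof -
  have "0 \<le> 2 * \<delta> * real (card F)" using assms(2) by simp
  then have "p \<le> q" using assms(3) by linarith
  have "\<not> {p..q} \<subseteq> (\<Union>f\<in>F. {f - \<delta>..f + \<delta>})"
  proof
    assume cover: "{p..q} \<subseteq> (\<Union>f\<in>F. {f - \<delta>..f + \<delta>})"
    have "q - p = measure lborel {p..q}" using \<open>p \<le> q\<close> by simp
    also have "\<dots> \<le> measure lborel (\<Union>f\<in>F. {f - \<delta>..f + \<delta>})"
      using assms(1)
      by (intro measure_mono_fmeasurable[OF cover] fmeasurable_compact compact_UN) auto
    also have "\<dots> \<le> (\<Sum>f\<in>F. measure lborel {f - \<delta>..f + \<delta>})"
      by (rule measure_UNION_le[OF assms(1)]) simp
    also have "\<dots> = 2 * \<delta> * real (card F)" using assms(2) by simp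
    finally show False using assms(3) by simp
  qed
  then obtain x where "x \<in> {p..q}" "x \<notin> (\<Union>f\<in>F. {f - \<delta>..f + \<delta>})" by blast
  then show ?thesis using that[of x] by force
qed

context bounded_cauchy_sums
begin

definition point_count :: "real \<Rightarrow> real \<Rightarrow> real" where
  "point_count p q = real (card {n. p < a n \<and> a n \<le> q})"

lemma card_between_le:
  assumes "q - p \<le> D" "D \<ge> 0"
  shows "finite {n. p \<le> a n \<and> a n \<le> q}"
    and "real (card {n. p \<le> a n \<and> a n \<le> q}) \<le> cauchy_sup * (1 + D\<^sup>2)"
proof -
  have card_le: "real (card X) \<le> cauchy_sup * (1 + D\<^sup>2)"
    if X: "finite X" "X \<subseteq> {n. p \<le> a n \<and> a n \<le> q}" for X
  proof -
    have "real (card X) * (1 / (1 + D\<^sup>2)) = (\<Sum>n\<in>X. 1 / (1 + D\<^sup>2))" by simp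
    also have "\<dots> \<le> (\<Sum>n\<in>X. 1 / (1 + (a n - p)\<^sup>2))"
    proof (intro sum_mono divide_left_mono mult_pos_pos one_plus_square_pos add_left_mono power_mono)
      show "a n - p \<le> D" "0 \<le> a n - p" if "n \<in> X" for n using that X assms by auto
    qed auto
    also have "\<dots> \<le> (\<Sum>\<^sub>\<infinity>n. 1 / (1 + (a n - p)\<^sup>2))"
      using X by (intro finite_sum_le_infsum cauchy_summable) auto
    also have "\<dots> \<le> cauchy_sup" by (rule cauchy_sum_le)
    finally show ?thesis using one_plus_square_pos[of D] by (simp add: field_simps)
  qed
  then have "card X \<le> nat \<lceil>cauchy_sup * (1 + D\<^sup>2)\<rceil>"
    if "finite X" "X \<subseteq> {n. p \<le> a n \<and> a n \<le> q}" for X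
    using card_le[OF that] by linarith
  then show "finite {n. p \<le> a n \<and> a n \<le> q}"
    by (intro finite_if_finite_subsets_card_bdd[THEN conjunct1]) auto
  then show "real (card {n. p \<le> a n \<and> a n \<le> q}) \<le> cauchy_sup * (1 + D\<^sup>2)"
    by (rule card_le) simp
qed

lemma finite_between: "finite {n. p \<le> a n \<and> a n \<le> q}"
  by (rule card_between_le(1)[of _ _ "max 0 (q - p)"]) auto

lemma summable_inverse_square:
  assumes nonzero: "\<And>n. a n \<noteq> 0"
  shows "(\<lambda>n. 1 / (a n)\<^sup>2) summable_on UNIV"
proof (rule summable_on_comparison_test)
  define N where "N = {n. -1 \<le> a n \<and> a n \<le> 1}"
  define e where "e = Min (insert 1 ((\<lambda>n. \<bar>a n\<bar>) ` N))"
  have "finite N" unfolding N_def by (rule finite_between)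
  then have e: "e > 0" "e \<le> 1" unfolding e_def using nonzero by (auto simp: Min_gr_iff)
  have "e \<le> \<bar>a n\<bar>" for n
  proof (cases "n \<in> N")
    case True
    then show ?thesis unfolding e_def using \<open>finite N\<close> by (intro Min_le) auto
  next
    case False
    then show ?thesis using e(2) unfolding N_def by auto
  qed
  then show "1 / (a n)\<^sup>2 \<le> (1 + 1 / e\<^sup>2) * (1 / (1 + (a n - 0)\<^sup>2))" for n
    using inverse_square_le[OF e(1)] by simp
  show "(\<lambda>n. (1 + 1 / e\<^sup>2) * (1 / (1 + (a n - 0)\<^sup>2))) summable_on UNIV"
    by (rule summable_on_cmult_right[OF cauchy_summable])
qed auto

lemma finite_point_count: "finite {n. p < a n \<and> a n \<le> q}"
  by (rule finite_subset[OF _ finite_between[of p q]]) auto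

lemma point_count_le:
  assumes "q - p \<le> D" "D \<ge> 0"
  shows "point_count p q \<le> cauchy_sup * (1 + D\<^sup>2)"
proof -
  have "point_count p q \<le> real (card {n. p \<le> a n \<and> a n \<le> q})"
    unfolding point_count_def by (intro of_nat_mono card_mono finite_between) auto
  also have "\<dots> \<le> cauchy_sup * (1 + D\<^sup>2)" by (rule card_between_le(2)[OF assms])
  finally show ?thesis .
qed

lemma point_count_refl [simp]: "point_count p p = 0"
proof -
  have "{n. p < a n \<and> a n \<le> p} = {}" by auto
  then show ?thesis unfolding point_count_def by (simp only: card.empty of_nat_0)
qed

lemma point_count_add:
  assumes "p \<le> q" "q \<le> r"
  shows "point_count p r = point_count p q + point_count q r"
proof -
  have "{n. p < a n \<and> a n \<le> r} = {n. p < a n \<and> a n \<le> q} \<union> {n. q < a n \<and> a n \<le> r}"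
    using assms by auto
  moreover have "{n. p < a n \<and> a n \<le> q} \<inter> {n. q < a n \<and> a n \<le> r} = {}" by auto
  ultimately show ?thesis
    using card_Un_disjoint[OF finite_point_count finite_point_count] by (simp add: point_count_def)
qed

lemma point_count_mono: "p' \<le> p \<Longrightarrow> q \<le> q' \<Longrightarrow> point_count p q \<le> point_count p' q'"
  unfolding point_count_def by (intro of_nat_mono card_mono finite_point_count) auto

lemma point_count_le_perturb:
  assumes "\<bar>p - p'\<bar> \<le> D" "\<bar>q - q'\<bar> \<le> D"
  shows "point_count p q \<le> point_count p' q' + 2 * (cauchy_sup * (1 + D\<^sup>2))"
proof -
  have "{n. p < a n \<and> a n \<le> q}
      \<subseteq> {n. p' < a n \<and> a n \<le> q'} \<union> ({n. p < a n \<and> a n \<le> p'} \<union> {n. q' < a n \<and> a n \<le> q})"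
    by auto
  then have "card {n. p < a n \<and> a n \<le> q}
      \<le> card ({n. p' < a n \<and> a n \<le> q'} \<union> ({n. p < a n \<and> a n \<le> p'} \<union> {n. q' < a n \<and> a n \<le> q}))"
    by (intro card_mono) (auto intro: finite_point_count)
  also have "\<dots> \<le> card {n. p' < a n \<and> a n \<le> q'}
      + (card {n. p < a n \<and> a n \<le> p'} + card {n. q' < a n \<and> a n \<le> q})"
    by (intro order.trans[OF card_Un_le] add_left_mono card_Un_le)
  finally have "point_count p q \<le> point_count p' q' + (point_count p p' + point_count q' q)"
    unfolding point_count_def by linarith
  moreover have "point_count p p' \<le> cauchy_sup * (1 + D\<^sup>2)"
      "point_count q' q \<le> cauchy_sup * (1 + D\<^sup>2)"
    using assms by (intro point_count_le; linarith)+
  ultimately show ?thesis by linarith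
qed

definition cell_error :: "real \<Rightarrow> real \<Rightarrow> real" where
  "cell_error d y = 5 * cauchy_sup * (2 * y / d) + 3 * y * (1 + 1 / d\<^sup>2) * (2 * cauchy_sup)"

lemma cell_error_small:
  assumes "d > 0"
  obtains y where "y > 0" "cell_error d y \<le> 1"
proof
  define y where "y = 1 / (cell_error d 1 + 1)"
  have "cell_error d 1 \<ge> 0" using assms cauchy_sup_nonneg by (simp add: cell_error_def)
  then show "y > 0" by (simp add: y_def)
  have "cell_error d y = y * cell_error d 1" by (simp add: cell_error_def algebra_simps)
  also have "\<dots> \<le> 1" using \<open>cell_error d 1 \<ge> 0\<close> by (simp add: y_def)
  finally show "cell_error d y \<le> 1" .
qed

text \<open>Integrality enters here: the smoothed counts determine the numbers of points up to an error
  smaller than one.\<close>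

lemma card_le_of_weight_sum_le:
  assumes y: "0 < y" "cell_error d y \<le> 1" and "d > 0"
    and pq: "p \<le> q" "q - p \<le> 3" "q' - p' = q - p"
    and X: "finite X" "real (card X) \<le> 5 * cauchy_sup" "\<And>n. n \<in> X \<Longrightarrow> p + d \<le> a n \<and> a n \<le> q - d"
    and X': "finite X'" "\<And>n. n \<notin> X' \<Longrightarrow> a n \<le> p' - d \<or> a n \<ge> q' + d"
    and weights: "weight_sum y p q \<le> weight_sum y p' q' + 1 / 2 * (q - p)"
  shows "card X \<le> card X'"
proof -
  define e where "e = (q - p) * y * (1 + 1 / d\<^sup>2) * (2 * cauchy_sup)"
  have "real (card X) * (2 * y / d) + e \<le> cell_error d y"
    unfolding cell_error_def e_def using y(1) \<open>d > 0\<close> pq(2) X(2) cauchy_sup_nonneg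
    by (intro add_mono mult_right_mono) auto
  then have error: "real (card X) * (2 * y / d) + e + 1 / 2 * (q - p) < pi"
    using y(2) pq(2) pi_gt3 by argo
  have "real (card X) * (pi - 2 * y / d) \<le> weight_sum y p q"
    using X by (intro weight_sum_ge y(1) \<open>d > 0\<close> pq(1))
  also note weights
  also have "weight_sum y p' q' \<le> real (card X') * pi + e"
    unfolding e_def pq(3)[symmetric]
    using X' pq by (intro weight_sum_le y(1) \<open>d > 0\<close>) auto
  finally have "(real (card X) - real (card X')) * pi < 1 * pi"
    using error by (simp add: algebra_simps)
  then have "real (card X) - real (card X') < 1" by (rule mult_right_less_imp_less) simp
  then show ?thesis by linarith
qed

lemma point_count_cell_shift:
  assumes d: "0 < d" "d \<le> 1 / 2" and y: "0 < y" "cell_error d y \<le> 1"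
    and cell: "p \<le> q" "q - p \<le> 2" "\<And>n. 2 * d \<le> \<bar>a n - p\<bar>" "\<And>n. 2 * d \<le> \<bar>a n - q\<bar>"
    and \<tau>: "poisson_almost_period y (1 / 2) \<tau>"
  shows "point_count (p + \<tau>) (q + \<tau>) = point_count p q"
proof -
  define X X' where "X = {n. p < a n \<and> a n \<le> q}" and "X' = {n. p + \<tau> < a n \<and> a n \<le> q + \<tau>}"
  have finite: "finite X" "finite X'" unfolding X_def X'_def by (rule finite_point_count)+
  have card: "real (card X) \<le> 5 * cauchy_sup" "real (card X') \<le> 5 * cauchy_sup"
    using point_count_le[of q p 2] point_count_le[of "q + \<tau>" "p + \<tau>" 2] cell(2)
    by (auto simp: X_def X'_def point_count_def)
  have far: "a n \<le> p - 2 * d \<or> a n \<ge> p + 2 * d" "a n \<le> q - 2 * d \<or> a n \<ge> q + 2 * d" for n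
    using cell(3)[of n] cell(4)[of n] by linarith+
  have "card X' \<le> card X"
  proof (rule card_le_of_weight_sum_le[OF y d(1), where p = "p - d + \<tau>" and q = "q + d + \<tau>"
        and p' = "p - d" and q' = "q + d"])
    show "weight_sum y (p - d + \<tau>) (q + d + \<tau>)
        \<le> weight_sum y (p - d) (q + d) + 1 / 2 * (q + d + \<tau> - (p - d + \<tau>))"
      using abs_le_D1[OF weight_sum_shift[OF y(1) _ \<tau>, of "p - d" "q + d"]] cell(1) d by argo
    show "a n \<le> p - d - d \<or> a n \<ge> q + d + d" if "n \<notin> X" for n
      using that far[of n] d unfolding X_def by auto
  qed (use cell(1,2) d finite card in \<open>auto simp: X'_def\<close>)
  moreover have "card X \<le> card X'"
  proof (cases "X = {}")
    case False
    then obtain n where "p < a n" "a n \<le> q" by (auto simp: X_def)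
    then have "p + d \<le> q - d" using far[of n] d by auto
    show ?thesis
    proof (rule card_le_of_weight_sum_le[OF y d(1), where p = "p + d" and q = "q - d"
          and p' = "p + d + \<tau>" and q' = "q - d + \<tau>"])
      show "weight_sum y (p + d) (q - d)
          \<le> weight_sum y (p + d + \<tau>) (q - d + \<tau>) + 1 / 2 * (q - d - (p + d))"
        using abs_le_D2[OF weight_sum_shift[OF y(1) \<open>p + d \<le> q - d\<close> \<tau>]] by argo
      show "p + d + d \<le> a n \<and> a n \<le> q - d - d" if "n \<in> X" for n
        using that far[of n] d unfolding X_def by auto
    qed (use cell(2) d finite card \<open>p + d \<le> q - d\<close> in \<open>auto simp: X'_def\<close>)
  qed simp
  ultimately show ?thesis by (simp add: point_count_def X_def X'_def)
qed

lemma cut_points_exist: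
  obtains d P where "0 < d" "d \<le> 1 / 2" "\<And>j::int. of_int j \<le> P j \<and> P j \<le> of_int j + 1"
    "\<And>j n. 2 * d \<le> \<bar>a n - P j\<bar>"
proof -
  define d where "d = 1 / (8 * (10 * cauchy_sup + 1))"
  have d: "0 < d" "d \<le> 1 / 2" "4 * d * (10 * cauchy_sup) < 1"
    using cauchy_sup_nonneg by (auto simp: d_def field_simps)
  have "\<exists>x. of_int j \<le> x \<and> x \<le> of_int j + 1 \<and> (\<forall>n. 2 * d \<le> \<bar>a n - x\<bar>)" for j :: int
  proof -
    define N where "N = {n. of_int j - 1 \<le> a n \<and> a n \<le> of_int j + 2}"
    have "finite N" unfolding N_def by (rule finite_between)
    have "real (card (a ` N)) \<le> real (card N)" by (simp add: card_image_le[OF \<open>finite N\<close>])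
    also have "\<dots> \<le> cauchy_sup * (1 + 3\<^sup>2)" unfolding N_def by (rule card_between_le(2)) auto
    finally have "4 * d * real (card (a ` N)) \<le> 4 * d * (10 * cauchy_sup)"
      using d(1) by (intro mult_left_mono) auto
    then have "2 * (2 * d) * real (card (a ` N)) < (of_int j + 1) - of_int j" using d(3) by simp
    then obtain x where x: "of_int j \<le> x" "x \<le> of_int j + 1" "\<And>f. f \<in> a ` N \<Longrightarrow> 2 * d \<le> \<bar>f - x\<bar>"
      by (rule exists_point_far_from_finite[rotated 2]) (use \<open>finite N\<close> d(1) in auto)
    have "2 * d \<le> \<bar>a n - x\<bar>" if "n \<notin> N" for n
      using that x(1,2) d(2) unfolding N_def by auto
    then show ?thesis using x by blast
  qed
  then show ?thesis using that[OF d(1,2)] by metis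
qed

lemma point_count_shift_between_cuts:
  assumes d: "0 < d" "d \<le> 1 / 2" and y: "0 < y" "cell_error d y \<le> 1"
    and P: "\<And>j::int. of_int j \<le> P j \<and> P j \<le> of_int j + 1" "\<And>j n. 2 * d \<le> \<bar>a n - P j\<bar>"
    and \<tau>: "poisson_almost_period y (1 / 2) \<tau>" and "i \<le> j"
  shows "point_count (P i + \<tau>) (P j + \<tau>) = point_count (P i) (P j)"
  using \<open>i \<le> j\<close>
proof (induction j rule: int_ge_induct)
  case (step j)
  have cell: "P i \<le> P j" "P j \<le> P (j + 1)" "P (j + 1) - P j \<le> 2"
    using P(1)[of i] P(1)[of j] P(1)[of "j + 1"] step.hyps by (cases "i = j"; simp)+
  have "point_count (P j + \<tau>) (P (j + 1) + \<tau>) = point_count (P j) (P (j + 1))"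
    by (rule point_count_cell_shift[OF d y cell(2,3) P(2) P(2) \<tau>])
  then show ?case
    using point_count_add[OF cell(1,2)] point_count_add[of "P i + \<tau>" "P j + \<tau>" "P (j + 1) + \<tau>"]
      cell step.IH by simp
qed simp

end

locale almost_periodic_points = bounded_cauchy_sums a for a :: "'i \<Rightarrow> real" +
  assumes relatively_dense_poisson_almost_periods:
    "y > 0 \<Longrightarrow> \<eta> > 0 \<Longrightarrow> relatively_dense {\<tau>. poisson_almost_period y \<eta> \<tau>}"
begin

lemma point_count_translation_bounded:
  obtains C where "\<And>x x' h. h \<ge> 0 \<Longrightarrow> \<bar>point_count x (x + h) - point_count x' (x' + h)\<bar> \<le> C"
proof -
  obtain d P where d: "0 < d" "d \<le> 1 / 2"
    and P: "\<And>j::int. of_int j \<le> P j \<and> P j \<le> of_int j + 1" "\<And>j n. 2 * d \<le> \<bar>a n - P j\<bar>"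
    using cut_points_exist by blast
  obtain y where y: "y > 0" "cell_error d y \<le> 1" using cell_error_small[OF d(1)] .
  obtain L where "L > 0"
    and period: "\<And>x. \<exists>\<tau>\<in>{x..x+L}. poisson_almost_period y (1 / 2) \<tau>"
    using relatively_dense_poisson_almost_periods[OF y(1), of "1 / 2"]
    by (auto simp: relatively_dense_def)
  define C where "C = 2 * (cauchy_sup * (1 + 1\<^sup>2)) + 2 * (cauchy_sup * (1 + (1 + L)\<^sup>2))"
  have count_le: "point_count x (x + h) \<le> point_count x' (x' + h) + C" if "h \<ge> 0" for x x' h
  proof -
    obtain \<tau> where \<tau>: "x' - x \<le> \<tau>" "\<tau> \<le> x' - x + L" "poisson_almost_period y (1 / 2) \<tau>"
      using period by force
    define i j where "i = \<lfloor>x\<rfloor>" and "j = \<lfloor>x + h\<rfloor>"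
    have "i \<le> j" unfolding i_def j_def using that by (intro floor_mono) simp
    have near: "\<bar>x - P i\<bar> \<le> 1" "\<bar>x + h - P j\<bar> \<le> 1"
      using P(1)[of i] P(1)[of j] unfolding i_def j_def by linarith+
    have "point_count x (x + h) \<le> point_count (P i) (P j) + 2 * (cauchy_sup * (1 + 1\<^sup>2))"
      by (rule point_count_le_perturb[OF near])
    also have "point_count (P i) (P j) = point_count (P i + \<tau>) (P j + \<tau>)"
      by (rule point_count_shift_between_cuts[OF d y P \<tau>(3) \<open>i \<le> j\<close>, symmetric])
    also have "\<dots> \<le> point_count x' (x' + h) + 2 * (cauchy_sup * (1 + (1 + L)\<^sup>2))"
      using near \<tau>(1,2) by (intro point_count_le_perturb) auto
    finally show ?thesis by (simp add: C_def)
  qed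
  show ?thesis
  proof (rule that)
    show "\<bar>point_count x (x + h) - point_count x' (x' + h)\<bar> \<le> C" if "h \<ge> 0" for x x' h
      using count_le[OF that, of x x'] count_le[OF that, of x' x] by linarith
  qed
qed

end

locale almost_periodic_sequence = almost_periodic_points a for a :: "int \<Rightarrow> real" +
  assumes a_mono: "mono a"
begin

lemma multiplicity_le: "finite {n. a n = x}" "real (card {n. a n = x}) \<le> cauchy_sup"
proof -
  have "{n. a n = x} = {n. x \<le> a n \<and> a n \<le> x}" by auto
  then show "finite {n. a n = x}" "real (card {n. a n = x}) \<le> cauchy_sup"
    using card_between_le[of x x 0] by simp_all
qed

lemma point_count_enumeration:
  assumes "i \<le> j"
  shows "\<bar>point_count (a i) (a j) - real_of_int (j - i)\<bar> \<le> cauchy_sup"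
proof -
  let ?N = "{n. a i < a n \<and> a n \<le> a j}"
  have "?N \<subseteq> {i<..j} \<union> {n. a n = a j}"
  proof
    fix n assume n: "n \<in> ?N"
    then have "i < n" using monoD[OF a_mono, of n i] by force
    moreover have "a n = a j" if "j < n" using monoD[OF a_mono, of j n] n that by simp
    ultimately show "n \<in> {i<..j} \<union> {n. a n = a j}" by force
  qed
  then have "card ?N \<le> card ({i<..j} \<union> {n. a n = a j})"
    by (intro card_mono) (auto intro: multiplicity_le)
  also have "\<dots> \<le> nat (j - i) + card {n. a n = a j}"
    using card_Un_le[of "{i<..j}" "{n. a n = a j}"] by simp
  finally have upper: "point_count (a i) (a j) \<le> real_of_int (j - i) + cauchy_sup"
    unfolding point_count_def using multiplicity_le(2)[of "a j"] assms by linarith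
  have "{i<..j} \<subseteq> ?N \<union> {n. a n = a i}"
    using monoD[OF a_mono, of i] monoD[OF a_mono, of _ j] by (auto simp: less_le)
  then have "card {i<..j} \<le> card (?N \<union> {n. a n = a i})"
    by (intro card_mono) (auto intro: multiplicity_le finite_point_count)
  also have "\<dots> \<le> card ?N + card {n. a n = a i}" by (rule card_Un_le)
  finally have "nat (j - i) \<le> card ?N + card {n. a n = a i}" by simp
  then have "real_of_int (j - i) \<le> point_count (a i) (a j) + cauchy_sup"
    unfolding point_count_def using multiplicity_le(2)[of "a i"] assms by linarith
  then show ?thesis using upper by linarith
qed

lemma point_count_eventually_large:
  obtains h where "h \<ge> 0" "\<And>x. point_count x (x + h) \<ge> M"
proof -
  obtain C where C: "\<And>x x' h. h \<ge> 0 \<Longrightarrow> \<bar>point_count x (x + h) - point_count x' (x' + h)\<bar> \<le> C"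
    using point_count_translation_bounded by blast
  define N where "N = nat \<lceil>M + C + cauchy_sup\<rceil>"
  define h where "h = a (int N) - a 0"
  have "h \<ge> 0" using monoD[OF a_mono, of 0 "int N"] by (simp add: h_def)
  have "real N - cauchy_sup \<le> point_count (a 0) (a 0 + h)"
    using point_count_enumeration[of 0 "int N"] by (simp add: h_def)
  moreover have "M + C + cauchy_sup \<le> real N" unfolding N_def by linarith
  ultimately have "point_count x (x + h) \<ge> M" for x
    using C[OF \<open>h \<ge> 0\<close>, of x "a 0"] by linarith
  then show ?thesis using that[OF \<open>h \<ge> 0\<close>] by blast
qed

lemma symmetric_sum_bounded:
  obtains H where "\<And>n::nat. \<bar>a (int n) + a (- int n)\<bar> \<le> H"
proof -
  obtain C where C: "\<And>x x' h. h \<ge> 0 \<Longrightarrow> \<bar>point_count x (x + h) - point_count x' (x' + h)\<bar> \<le> C"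
    using point_count_translation_bounded by blast
  obtain h0 where h0: "h0 \<ge> 0" "\<And>x. point_count x (x + h0) \<ge> C + 2 * cauchy_sup + 1"
    using point_count_eventually_large by blast
  have gap: "s < t + h0"
    if "t \<ge> 0" "\<bar>point_count (a 0 - s) (a 0) - point_count (a 0 - t) (a 0)\<bar> \<le> C + 2 * cauchy_sup" for s t
  proof (rule ccontr)
    assume "\<not> s < t + h0"
    then have "t + h0 \<le> s" by simp
    then have "point_count (a 0 - s) (a 0)
        = point_count (a 0 - s) (a 0 - t) + point_count (a 0 - t) (a 0)"
      using h0(1) that(1) by (intro point_count_add) auto
    moreover have "point_count (a 0 - s) (a 0 - s + h0) \<le> point_count (a 0 - s) (a 0 - t)"
      using \<open>t + h0 \<le> s\<close> by (intro point_count_mono) auto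
    ultimately show False using that(2) h0(2)[of "a 0 - s"] by linarith
  qed
  show ?thesis
  proof (rule that[of "2 * \<bar>a 0\<bar> + h0"])
    fix n :: nat
    define s t where "s = a (int n) - a 0" and "t = a 0 - a (- int n)"
    have nonneg: "s \<ge> 0" "t \<ge> 0"
      using monoD[OF a_mono, of 0 "int n"] monoD[OF a_mono, of "- int n" 0]
      by (auto simp: s_def t_def)
    have "\<bar>point_count (a 0) (a 0 + s) - real n\<bar> \<le> cauchy_sup"
      using point_count_enumeration[of 0 "int n"] by (simp add: s_def)
    moreover have "\<bar>point_count (a 0 - t) (a 0) - real n\<bar> \<le> cauchy_sup"
      using point_count_enumeration[of "- int n" 0] by (simp add: t_def)
    moreover have "\<bar>point_count (a 0 - s) (a 0) - point_count (a 0) (a 0 + s)\<bar> \<le> C"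
      using C[OF nonneg(1), of "a 0 - s" "a 0"] by simp
    ultimately have "\<bar>point_count (a 0 - s) (a 0) - point_count (a 0 - t) (a 0)\<bar>
        \<le> C + 2 * cauchy_sup"
      by linarith
    then have "s < t + h0" "t < s + h0"
      using gap[OF nonneg(2), of s] gap[OF nonneg(1), of t] by (auto simp: abs_minus_commute)
    then show "\<bar>a (int n) + a (- int n)\<bar> \<le> 2 * \<bar>a 0\<bar> + h0"
      unfolding s_def t_def by linarith
  qed
qed

end

subsection \<open>Symmetric products over balanced zeros\<close>

lemma symmetric_interval_Suc:
  "{- int (Suc N)..int (Suc N)} = insert (int (Suc N)) (insert (- int (Suc N)) {- int N..int N})"
  by auto

lemma sum_symmetric_interval:
  "(\<Sum>k\<in>{- int N..int N}. f k) = f 0 + (\<Sum>n<N. f (int (Suc n)) + f (- int (Suc n)))"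
  by (induction N) (simp_all add: symmetric_interval_Suc ac_simps del: of_nat_Suc)

lemma prod_symmetric_interval:
  "(\<Prod>k\<in>{- int N..int N}. f k) = f 0 * (\<Prod>n<N. f (int (Suc n)) * f (- int (Suc n)))"
  by (induction N) (simp_all add: symmetric_interval_Suc ac_simps del: of_nat_Suc)

lemma filterlim_symmetric_interval:
  "filterlim (\<lambda>N. {- int N..int N}) (finite_subsets_at_top UNIV) sequentially"
  unfolding filterlim_finite_subsets_at_top
proof (intro allI impI)
  fix X :: "int set" assume X: "finite X \<and> X \<subseteq> UNIV"
  define m where "m = nat (Max (insert 0 (abs ` X)))"
  have m: "\<bar>x\<bar> \<le> int m" if "x \<in> X" for x
  proof -
    have "\<bar>x\<bar> \<le> Max (insert 0 (abs ` X))" using X that by (intro Max_ge) auto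
    then show ?thesis unfolding m_def by linarith
  qed
  show "\<forall>\<^sub>F N in sequentially. finite {- int N..int N} \<and> X \<subseteq> {- int N..int N}
      \<and> {- int N..int N} \<subseteq> UNIV"
    using eventually_ge_at_top[of m]
  proof eventually_elim
    case (elim N)
    then show ?case using m by fastforce
  qed
qed

lemma symmetric_sums_tendsto_infsum:
  fixes f :: "int \<Rightarrow> 'a :: {comm_monoid_add, t2_space}"
  assumes "f summable_on UNIV"
  shows "(\<lambda>N. \<Sum>k\<in>{- int N..int N}. f k) \<longlonglongrightarrow> infsum f UNIV"
  using has_sum_infsum[OF assms] unfolding has_sum_def
  by (rule filterlim_compose[OF _ filterlim_symmetric_interval])

lemma inverse_abs_mult_le:
  fixes p q :: real
  shows "1 / \<bar>p * q\<bar> \<le> 1 / p\<^sup>2 + 1 / q\<^sup>2"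
proof -
  have "0 \<le> (1 / \<bar>p\<bar> - 1 / \<bar>q\<bar>)\<^sup>2" by simp
  then have "2 * (1 / \<bar>p * q\<bar>) \<le> 1 / p\<^sup>2 + 1 / q\<^sup>2"
    by (simp add: power2_diff power_divide abs_mult)
  moreover have "0 \<le> 1 / \<bar>p * q\<bar>" by simp
  ultimately show ?thesis by linarith
qed

definition conjugate_kernel :: "real \<Rightarrow> real \<Rightarrow> real" where
  "conjugate_kernel y x = x / (x\<^sup>2 + y\<^sup>2)"

lemma Re_cauchy_kernel_imaginary_axis:
  "Re (1 / (\<i> * of_real y - of_real x)) = - conjugate_kernel y x"
  by (simp add: conjugate_kernel_def Re_divide)

lemma conjugate_kernel_0: "conjugate_kernel 0 x = 1 / x"
  by (simp add: conjugate_kernel_def power2_eq_square)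

lemma conjugate_kernel_tendsto_0: "((\<lambda>y. conjugate_kernel y x) \<longlongrightarrow> 0) at_top"
  unfolding conjugate_kernel_def by real_asymp

lemma abs_conjugate_kernel_pair_le:
  assumes "p \<noteq> 0" "q \<noteq> 0"
  shows "\<bar>conjugate_kernel y p + conjugate_kernel y q\<bar> \<le> \<bar>p + q\<bar> * (1 / \<bar>p * q\<bar>)"
proof -
  define t where "t = y\<^sup>2"
  have "t \<ge> 0" by (simp add: t_def)
  define D where "D = (p\<^sup>2 + t) * (q\<^sup>2 + t)"
  have pos: "p\<^sup>2 + t > 0" "q\<^sup>2 + t > 0" using assms \<open>t \<ge> 0\<close> by (auto intro: add_pos_nonneg)
  have "0 \<le> t * (\<bar>p\<bar> - \<bar>q\<bar>)\<^sup>2 + t * \<bar>p * q\<bar> + t\<^sup>2" using \<open>t \<ge> 0\<close> by simp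
  then have "(t + \<bar>p * q\<bar>) * \<bar>p * q\<bar> \<le> D"
    unfolding D_def by (simp add: power2_eq_square algebra_simps abs_mult)
  moreover have "\<bar>t + p * q\<bar> \<le> t + \<bar>p * q\<bar>" using \<open>t \<ge> 0\<close> by simp
  ultimately have "\<bar>t + p * q\<bar> * \<bar>p * q\<bar> \<le> D"
    by (meson abs_ge_zero mult_right_mono order.trans)
  moreover have "D > 0" using pos by (simp add: D_def)
  ultimately have "\<bar>t + p * q\<bar> / D \<le> 1 / \<bar>p * q\<bar>" using assms by (simp add: field_simps)
  from mult_left_mono[OF this abs_ge_zero[of "p + q"]]
  have "\<bar>p + q\<bar> * (\<bar>t + p * q\<bar> / D) \<le> \<bar>p + q\<bar> * (1 / \<bar>p * q\<bar>)" .
  moreover have "conjugate_kernel y p + conjugate_kernel y q = (p + q) * ((t + p * q) / D)"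
    using pos unfolding conjugate_kernel_def D_def t_def[symmetric]
    by (simp add: divide_simps) (simp add: algebra_simps power2_eq_square)
  moreover have "\<bar>(p + q) * ((t + p * q) / D)\<bar> = \<bar>p + q\<bar> * (\<bar>t + p * q\<bar> / D)"
    using pos by (simp add: abs_mult D_def)
  ultimately show ?thesis by simp
qed

locale balanced_zeros =
  fixes a :: "int \<Rightarrow> real"
  assumes a_nonzero: "a n \<noteq> 0"
    and inverse_square_summable: "(\<lambda>n. 1 / (a n)\<^sup>2) summable_on UNIV"
    and symmetric_sum_bdd_above: "bdd_above (range (\<lambda>n::nat. \<bar>a (int n) + a (- int n)\<bar>))"
begin

definition balance :: real where
  "balance = (SUP n::nat. \<bar>a (int n) + a (- int n)\<bar>)"

lemma symmetric_sum_le: "\<bar>a (int n) + a (- int n)\<bar> \<le> balance"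
  unfolding balance_def by (rule cSUP_upper[OF UNIV_I symmetric_sum_bdd_above])

lemma balance_nonneg: "balance \<ge> 0"
  by (rule order.trans[OF abs_ge_zero symmetric_sum_le])

definition pair_weight :: "nat \<Rightarrow> real" where
  "pair_weight n = 1 / (a (int n))\<^sup>2 + 1 / (a (- int n))\<^sup>2"

lemma pair_weight_nonneg: "pair_weight n \<ge> 0"
  by (simp add: pair_weight_def)

lemma summable_pair_weight: "summable pair_weight"
proof -
  have "summable (\<lambda>n::nat. 1 / (a (\<iota> n))\<^sup>2)" if "inj \<iota>" for \<iota>
  proof (rule summable_on_imp_summable)
    have "(\<lambda>k. 1 / (a k)\<^sup>2) summable_on range \<iota>"
      using inverse_square_summable by (rule summable_on_subset_banach) auto
    then show "(\<lambda>n. 1 / (a (\<iota> n))\<^sup>2) summable_on UNIV"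
      using summable_on_reindex[OF that, of "\<lambda>k. 1 / (a k)\<^sup>2"] by (simp add: o_def)
  qed
  then show ?thesis unfolding pair_weight_def by (intro summable_add) (auto simp: inj_def)
qed

lemma pair_term_le:
  "\<bar>a (int n) + a (- int n)\<bar> * (1 / \<bar>a (int n) * a (- int n)\<bar>) \<le> balance * pair_weight n"
  unfolding pair_weight_def
  by (intro mult_mono symmetric_sum_le inverse_abs_mult_le balance_nonneg) auto

definition partial_product :: "nat \<Rightarrow> complex \<Rightarrow> complex" where
  "partial_product N z = (\<Prod>k\<in>{- int N..int N}. 1 - z / of_real (a k))"

definition zero_product :: "complex \<Rightarrow> complex" where
  "zero_product z = lim (\<lambda>N. partial_product N z)"

definition pair_deviation :: "nat \<Rightarrow> complex \<Rightarrow> complex" where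
  "pair_deviation n z = (1 - z / of_real (a (int n))) * (1 - z / of_real (a (- int n))) - 1"

lemma partial_product_eq_pairs:
  "partial_product N z = (1 - z / of_real (a 0)) * (\<Prod>n<N. 1 + pair_deviation (Suc n) z)"
  by (simp add: partial_product_def pair_deviation_def prod_symmetric_interval)

lemma norm_pair_deviation_le:
  "norm (pair_deviation n z) \<le> (norm z * balance + (norm z)\<^sup>2) * pair_weight n"
proof -
  define p q where "p = a (int n)" and "q = a (- int n)"
  have "pair_deviation n z
      = - z * of_real (p + q) * of_real (1 / (p * q)) + z\<^sup>2 * of_real (1 / (p * q))"
    using a_nonzero by (simp add: pair_deviation_def p_def q_def field_simps power2_eq_square)
  also have "norm \<dots> \<le> norm z * (\<bar>p + q\<bar> * (1 / \<bar>p * q\<bar>)) + (norm z)\<^sup>2 * (1 / \<bar>p * q\<bar>)"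
    by (rule order.trans[OF norm_triangle_ineq])
       (simp only: norm_mult norm_of_real norm_power norm_minus_cancel abs_divide abs_one mult.assoc
          order_refl)
  also have "\<dots> \<le> norm z * (balance * pair_weight n) + (norm z)\<^sup>2 * pair_weight n"
    using pair_term_le[of n] inverse_abs_mult_le[of p q]
    unfolding p_def[symmetric] q_def[symmetric] pair_weight_def
    by (intro add_mono mult_left_mono) auto
  finally show ?thesis by (simp add: algebra_simps)
qed

lemma pair_deviation_holomorphic: "pair_deviation n holomorphic_on A"
  unfolding pair_deviation_def by (intro holomorphic_intros) (auto simp: a_nonzero)

lemma partial_product_holomorphic: "partial_product N holomorphic_on A"
  unfolding partial_product_def by (intro holomorphic_intros) (auto simp: a_nonzero)

lemma uniform_limit_zero_product_0:
  "uniform_limit (cball 0 R) partial_product zero_product sequentially"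
proof -
  let ?pairs = "\<lambda>N z. \<Prod>n<N. 1 + pair_deviation (Suc n) z"
  define M where "M n = (R * balance + R\<^sup>2) * pair_weight (Suc n)" for n
  have "summable M"
    unfolding M_def using summable_pair_weight
    by (intro summable_mult) (simp add: summable_Suc_iff)
  have "norm (pair_deviation (Suc n) z) \<le> M n" if "z \<in> cball 0 R" for n z
  proof -
    have "(norm z * balance + (norm z)\<^sup>2) * pair_weight (Suc n) \<le> M n"
      unfolding M_def using that balance_nonneg pair_weight_nonneg
      by (intro mult_right_mono add_mono power_mono) auto
    then show ?thesis using norm_pair_deviation_le order.trans by blast
  qed
  then have "uniformly_convergent_on (cball 0 R) (\<lambda>N z. \<Sum>n<N. norm (pair_deviation (Suc n) z))"
    by (intro Weierstrass_m_test'[OF _ \<open>summable M\<close>]) auto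
  then have "uniformly_convergent_on (cball 0 R) ?pairs"
    by (intro uniformly_convergent_on_prod holomorphic_on_imp_continuous_on
        pair_deviation_holomorphic) auto
  then obtain G where G: "uniform_limit (cball 0 R) ?pairs G sequentially"
    by (auto simp: uniformly_convergent_on_def)
  have "continuous_on (cball 0 R) (?pairs N)" for N
    by (intro holomorphic_on_imp_continuous_on holomorphic_intros pair_deviation_holomorphic)
  then have "continuous_on (cball 0 R) G"
    by (intro uniform_limit_theorem[OF _ G]) auto
  moreover have "continuous_on (cball 0 R) (\<lambda>z :: complex. 1 - z / of_real (a 0))"
    by (intro continuous_intros) (simp add: a_nonzero)
  ultimately have "uniform_limit (cball 0 R) (\<lambda>N z. (1 - z / of_real (a 0)) * ?pairs N z)
      (\<lambda>z. (1 - z / of_real (a 0)) * G z) sequentially"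
    by (intro uniform_lim_mult[OF uniform_limit_const G] compact_imp_bounded
        compact_continuous_image) auto
  then have "uniformly_convergent_on (cball 0 R) partial_product"
    unfolding uniformly_convergent_on_def partial_product_eq_pairs[abs_def] by blast
  then show ?thesis unfolding uniformly_convergent_uniform_limit_iff zero_product_def .
qed

lemma uniform_limit_zero_product:
  "uniform_limit (cball z d) partial_product zero_product sequentially"
proof (rule uniform_limit_on_subset[OF uniform_limit_zero_product_0[of "norm z + d"]])
  show "cball z d \<subseteq> cball 0 (norm z + d)"
    by (rule cball_subset_cball_iff[THEN iffD2]) (simp add: dist_norm)
qed

lemma partial_product_tendsto: "(\<lambda>N. partial_product N z) \<longlonglongrightarrow> zero_product z"
  by (rule tendsto_uniform_limitI[OF uniform_limit_zero_product[of z 0]]) simp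

lemma zero_product_holomorphic: "zero_product holomorphic_on UNIV"
proof (rule holomorphic_uniform_sequence)
  show "\<exists>d>0. cball z d \<subseteq> UNIV
      \<and> uniform_limit (cball z d) partial_product zero_product sequentially" for z
    using uniform_limit_zero_product by (intro exI[of _ 1]) auto
qed (auto intro: partial_product_holomorphic)

lemma norm_zero_product_vertical_mono:
  assumes "\<bar>y\<bar> \<le> s"
  shows "norm (zero_product (Complex x y)) \<le> norm (zero_product (Complex x s))"
proof -
  have norm_factor: "norm (1 - Complex x u / of_real r) = sqrt ((1 - x / r)\<^sup>2 + (u / r)\<^sup>2)" for u r
  proof -
    have "1 - Complex x u / of_real r = Complex (1 - x / r) (- (u / r))"
      by (simp add: complex_eq_iff Re_divide_of_real Im_divide_of_real)
    then show ?thesis by (simp add: cmod_def)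
  qed
  have "norm (1 - Complex x y / of_real r) \<le> norm (1 - Complex x s / of_real r)" for r
  proof -
    have "\<bar>y / r\<bar> \<le> \<bar>s / r\<bar>" using assms by (simp add: divide_right_mono)
    then have "(y / r)\<^sup>2 \<le> (s / r)\<^sup>2" by (simp only: abs_le_square_iff)
    then show ?thesis unfolding norm_factor by simp
  qed
  then have "norm (partial_product N (Complex x y)) \<le> norm (partial_product N (Complex x s))" for N
    unfolding partial_product_def prod_norm[symmetric] by (intro prod_mono) auto
  then show ?thesis
    by (intro LIMSEQ_le[OF tendsto_norm[OF partial_product_tendsto]
          tendsto_norm[OF partial_product_tendsto]]) auto
qed

subsection \<open>The logarithmic derivative of the product\<close>

definition reciprocal_sum :: real where
  "reciprocal_sum = lim (\<lambda>N. \<Sum>k\<in>{- int N..int N}. 1 / a k)"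

text \<open>The term \<open>1 / a k\<close> makes the sum converge absolutely, in whatever order it is taken.\<close>

definition log_deriv :: "complex \<Rightarrow> complex" where
  "log_deriv z = (\<Sum>\<^sub>\<infinity>k. 1 / (z - of_real (a k)) + 1 / of_real (a k)) - of_real reciprocal_sum"

lemma reciprocal_sum_tendsto: "(\<lambda>N. \<Sum>k\<in>{- int N..int N}. 1 / a k) \<longlonglongrightarrow> reciprocal_sum"
proof -
  have "summable (\<lambda>n. 1 / a (int (Suc n)) + 1 / a (- int (Suc n)))"
  proof (rule summable_comparison_test')
    show "summable (\<lambda>n. balance * pair_weight (Suc n))"
      using summable_pair_weight by (intro summable_mult) (simp add: summable_Suc_iff)
    show "norm (1 / a (int (Suc n)) + 1 / a (- int (Suc n))) \<le> balance * pair_weight (Suc n)" for n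
      using order.trans[OF abs_conjugate_kernel_pair_le[OF a_nonzero a_nonzero] pair_term_le, of 0]
      by (simp only: conjugate_kernel_0 real_norm_def)
  qed
  then have "convergent (\<lambda>N. \<Sum>k\<in>{- int N..int N}. 1 / a k)"
    unfolding sum_symmetric_interval
    by (intro convergent_add convergent_const) (simp add: summable_iff_convergent)
  then show ?thesis unfolding reciprocal_sum_def by (simp add: convergent_LIMSEQ_iff)
qed

lemma summable_log_deriv:
  assumes "Im z > 0"
  shows "(\<lambda>k. 1 / (z - of_real (a k)) + 1 / of_real (a k)) summable_on UNIV"
proof (rule abs_summable_summable, rule summable_on_comparison_test)
  define C where "C = 1 + norm z / Im z"
  show "(\<lambda>k. norm z * C * (1 / (a k)\<^sup>2)) summable_on UNIV"
    by (rule summable_on_cmult_right[OF inverse_square_summable])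
  fix k
  define x r d where "x = complex_of_real (a k)" and "r = norm x" and "d = norm (z - x)"
  have "r > 0" by (simp add: r_def x_def a_nonzero)
  have "Im z \<le> d" using abs_Im_le_cmod[of "z - x"] by (simp add: d_def x_def)
  then have "d > 0" "norm z \<le> norm z / Im z * d"
    using assms mult_left_mono[OF \<open>Im z \<le> d\<close>, of "norm z / Im z"] by auto
  moreover have "r \<le> d + norm z"
    unfolding r_def d_def using norm_triangle_ineq[of "x - z" z] by (simp add: norm_minus_commute)
  ultimately have "r \<le> C * d" by (simp add: C_def distrib_right)
  from mult_right_mono[OF this, of r] have "1 / (r * d) \<le> C * (1 / r\<^sup>2)"
    using \<open>r > 0\<close> \<open>d > 0\<close> by (simp add: field_simps power2_eq_square)
  from mult_left_mono[OF this norm_ge_zero[of z]]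
  have "norm z * (1 / (r * d)) \<le> norm z * C * (1 / (a k)\<^sup>2)"
    by (simp add: r_def x_def mult.assoc)
  moreover have "1 / (z - x) + 1 / x = z / (x * (z - x))"
    using \<open>r > 0\<close> \<open>d > 0\<close> by (simp add: r_def d_def field_simps)
  ultimately show "norm (1 / (z - of_real (a k)) + 1 / of_real (a k)) \<le> norm z * C * (1 / (a k)\<^sup>2)"
    unfolding x_def[symmetric] by (simp add: r_def d_def norm_divide norm_mult)
qed auto

lemma log_deriv_tendsto:
  assumes "Im z > 0"
  shows "(\<lambda>N. \<Sum>k\<in>{- int N..int N}. 1 / (z - of_real (a k))) \<longlonglongrightarrow> log_deriv z"
proof -
  have "(\<lambda>N. (\<Sum>k\<in>{- int N..int N}. 1 / (z - of_real (a k)) + 1 / of_real (a k))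
      - of_real (\<Sum>k\<in>{- int N..int N}. 1 / a k)) \<longlonglongrightarrow> log_deriv z"
    unfolding log_deriv_def
    by (intro tendsto_diff symmetric_sums_tendsto_infsum summable_log_deriv assms
        tendsto_of_real reciprocal_sum_tendsto)
  then show ?thesis by (simp add: sum.distrib)
qed

lemma log_deriv_diff:
  assumes "Im z > 0" "Im w > 0"
  shows "log_deriv z - log_deriv w = (\<Sum>\<^sub>\<infinity>k. 1 / (z - of_real (a k)) - 1 / (w - of_real (a k)))"
  unfolding log_deriv_def
  using infsum_diff[OF summable_log_deriv[OF assms(1)] summable_log_deriv[OF assms(2)]] by simp

lemma partial_product_has_field_derivative:
  assumes "Im z > 0"
  shows "(partial_product N has_field_derivative
    partial_product N z * (\<Sum>k\<in>{- int N..int N}. 1 / (z - of_real (a k)))) (at z)"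
proof -
  have nonzero: "z \<noteq> of_real x" for x using assms by auto
  have "((\<lambda>u. \<Prod>k\<in>{- int N..int N}. 1 - u / of_real (a k)) has_field_derivative
      (\<Prod>k\<in>{- int N..int N}. 1 - z / of_real (a k))
        * (\<Sum>k\<in>{- int N..int N}. - (1 / of_real (a k)) / (1 - z / of_real (a k)))) (at z)"
  proof (rule has_field_derivative_prod')
    show "1 - z / of_real (a k) \<noteq> 0" for k using nonzero[of "a k"] a_nonzero
      by (simp add: field_simps)
    show "((\<lambda>u. 1 - u / of_real (a k)) has_field_derivative - (1 / of_real (a k))) (at z)" for k
      using a_nonzero by (auto intro!: derivative_eq_intros)
  qed
  moreover have "- (1 / of_real (a k)) / (1 - z / of_real (a k)) = 1 / (z - of_real (a k))" for k
    using nonzero[of "a k"] a_nonzero[of k] by (simp add: field_simps)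
  ultimately show ?thesis by (simp only: partial_product_def[abs_def])
qed

lemma zero_product_has_field_derivative:
  assumes "Im z > 0"
  shows "(zero_product has_field_derivative zero_product z * log_deriv z) (at z)"
proof -
  let ?H = "{z. Im z > 0}"
  let ?L = "\<lambda>N z. \<Sum>k\<in>{- int N..int N}. 1 / (z - of_real (a k))"
  have "open ?H" by (rule open_halfspace_Im_gt)
  then have "\<exists>g'. \<forall>w\<in>?H. (zero_product has_field_derivative g' w) (at w) \<and>
      (\<lambda>N. partial_product N w * ?L N w) \<longlonglongrightarrow> g' w"
  proof (rule has_complex_derivative_uniform_sequence)
    show "(partial_product N has_field_derivative partial_product N w * ?L N w) (at w)"
      if "w \<in> ?H" for N w
      using that by (intro partial_product_has_field_derivative) simp
    show "\<exists>d>0. cball w d \<subseteq> ?H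
        \<and> uniform_limit (cball w d) partial_product zero_product sequentially"
      if "w \<in> ?H" for w
      using open_contains_cball[THEN iffD1, OF \<open>open ?H\<close>] that uniform_limit_zero_product by blast
  qed
  then obtain g' where g': "(zero_product has_field_derivative g' z) (at z)"
    "(\<lambda>N. partial_product N z * ?L N z) \<longlonglongrightarrow> g' z"
    using assms by blast
  have "(\<lambda>N. partial_product N z * ?L N z) \<longlonglongrightarrow> zero_product z * log_deriv z"
    by (intro tendsto_mult partial_product_tendsto log_deriv_tendsto assms)
  from LIMSEQ_unique[OF g'(2) this] g'(1) show ?thesis by simp
qed

definition conjugate_pair :: "real \<Rightarrow> nat \<Rightarrow> real" where
  "conjugate_pair y n
      = conjugate_kernel y (a (int (Suc n))) + conjugate_kernel y (a (- int (Suc n)))"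

lemma abs_conjugate_pair_le: "\<bar>conjugate_pair y n\<bar> \<le> balance * pair_weight (Suc n)"
  unfolding conjugate_pair_def
  using abs_conjugate_kernel_pair_le[OF a_nonzero a_nonzero] pair_term_le order.trans by blast

lemma summable_conjugate_majorant: "(\<lambda>n. balance * pair_weight (Suc n)) summable_on UNIV"
  using summable_pair_weight balance_nonneg pair_weight_nonneg
  by (intro norm_summable_imp_summable_on) (simp add: abs_mult summable_Suc_iff summable_mult)

lemma Re_log_deriv_imaginary_axis:
  assumes "y > 0"
  shows "Re (log_deriv (\<i> * of_real y)) = - (conjugate_kernel y (a 0) + (\<Sum>\<^sub>\<infinity>n. conjugate_pair y n))"
proof -
  have "conjugate_pair y summable_on UNIV"
    by (rule abs_summable_summable, rule summable_on_comparison_test[OF summable_conjugate_majorant])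
       (use abs_conjugate_pair_le in auto)
  then have "(\<lambda>N. \<Sum>n<N. conjugate_pair y n) \<longlonglongrightarrow> (\<Sum>\<^sub>\<infinity>n. conjugate_pair y n)"
    using has_sum_imp_sums[OF has_sum_infsum] by (simp add: sums_def)
  then have "(\<lambda>N. - (conjugate_kernel y (a 0) + (\<Sum>n<N. conjugate_pair y n)))
      \<longlonglongrightarrow> - (conjugate_kernel y (a 0) + (\<Sum>\<^sub>\<infinity>n. conjugate_pair y n))"
    by (intro tendsto_intros)
  moreover have "Re (\<Sum>k\<in>{- int N..int N}. 1 / (\<i> * of_real y - of_real (a k)))
      = - (conjugate_kernel y (a 0) + (\<Sum>n<N. conjugate_pair y n))" for N
    unfolding Re_sum Re_cauchy_kernel_imaginary_axis sum_negf
    unfolding sum_symmetric_interval conjugate_pair_def ..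
  moreover have "(\<lambda>N. Re (\<Sum>k\<in>{- int N..int N}. 1 / (\<i> * of_real y - of_real (a k))))
      \<longlonglongrightarrow> Re (log_deriv (\<i> * of_real y))"
    using assms by (intro tendsto_Re log_deriv_tendsto) simp
  ultimately show ?thesis using LIMSEQ_unique by simp
qed

lemma Re_log_deriv_tendsto_0: "((\<lambda>y. Re (log_deriv (\<i> * of_real y))) \<longlongrightarrow> 0) at_top"
proof -
  have "((\<lambda>y. \<Sum>\<^sub>\<infinity>n. conjugate_pair y n) \<longlongrightarrow> (\<Sum>\<^sub>\<infinity>n::nat. 0)) at_top"
  proof (rule infsum_dominated_convergence[OF _ summable_conjugate_majorant])
    show "((\<lambda>y. conjugate_pair y n) \<longlongrightarrow> 0) at_top" for n
      unfolding conjugate_pair_def by (intro tendsto_add_zero conjugate_kernel_tendsto_0)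
  qed (use abs_conjugate_pair_le in auto)
  then have "((\<lambda>y. conjugate_kernel y (a 0) + (\<Sum>\<^sub>\<infinity>n. conjugate_pair y n)) \<longlongrightarrow> 0) at_top"
    by (intro tendsto_add_zero conjugate_kernel_tendsto_0) simp
  from tendsto_minus[OF this]
  have "((\<lambda>y. - (conjugate_kernel y (a 0) + (\<Sum>\<^sub>\<infinity>n. conjugate_pair y n))) \<longlongrightarrow> 0) at_top"
    by simp
  then show ?thesis
    by (rule Lim_transform_eventually)
       (rule eventually_mono[OF eventually_gt_at_top[of 0]], simp only: Re_log_deriv_imaginary_axis)
qed

end

subsection \<open>Bounded functions on strips\<close>

lemma norm_le_on_rectangle:
  assumes hol: "f holomorphic_on {w. \<bar>Re w\<bar> \<le> R \<and> \<bar>Im w\<bar> \<le> S}"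
    and edge: "\<And>w. \<bar>Re w\<bar> \<le> R \<Longrightarrow> \<bar>Im w\<bar> \<le> S \<Longrightarrow> \<bar>Re w\<bar> = R \<or> \<bar>Im w\<bar> = S \<Longrightarrow> norm (f w) \<le> m"
    and z: "\<bar>Re z\<bar> \<le> R" "\<bar>Im z\<bar> \<le> S"
  shows "norm (f z) \<le> m"
proof -
  define Q where "Q = cbox (Complex (- R) (- S)) (Complex R S)"
  have Q_eq: "Q = {w. \<bar>Re w\<bar> \<le> R \<and> \<bar>Im w\<bar> \<le> S}"
    by (auto simp: Q_def in_cbox_complex_iff)
  show ?thesis
  proof (rule maximum_modulus_frontier[where S = Q and f = f])
    show "f holomorphic_on interior Q"
      by (rule holomorphic_on_subset[OF hol[folded Q_eq] interior_subset])
    show "continuous_on (closure Q) f"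
      using holomorphic_on_imp_continuous_on[OF hol] by (simp add: Q_def Q_eq[symmetric])
    show "bounded Q" unfolding Q_def by (rule bounded_cbox)
    show "z \<in> Q" using z by (simp add: Q_eq)
    fix w assume "w \<in> frontier Q"
    then have "w \<in> Q" "w \<notin> box (Complex (- R) (- S)) (Complex R S)"
      unfolding Q_def by (auto simp: frontier_def)
    then show "norm (f w) \<le> m"
      by (intro edge) (auto simp: Q_def in_cbox_complex_iff in_box_complex_iff)
  qed
qed

lemma norm_gaussian_damped_le_on_rectangle:
  assumes hol: "h holomorphic_on {w. \<bar>Im w\<bar> \<le> S}" and "m \<ge> 0" "\<delta> \<ge> 0"
    and bound: "\<And>w. \<bar>Im w\<bar> \<le> S \<Longrightarrow> norm (h w) \<le> M"
    and edge: "\<And>w. \<bar>Im w\<bar> = S \<Longrightarrow> norm (h w) \<le> m"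
    and R: "M * exp (- \<delta> * R\<^sup>2) \<le> m" and z: "\<bar>Re z\<bar> \<le> R" "\<bar>Im z\<bar> \<le> S"
  shows "norm (h z * exp (- of_real \<delta> * z\<^sup>2)) \<le> m * exp (\<delta> * S\<^sup>2)"
proof -
  define k where "k w = h w * exp (- of_real \<delta> * w\<^sup>2)" for w
  have norm_k: "norm (k w) = norm (h w) * exp (- \<delta> * (Re w)\<^sup>2) * exp (\<delta> * (Im w)\<^sup>2)" for w
    by (simp add: k_def norm_mult norm_exp_eq_Re power2_eq_square algebra_simps flip: exp_add)
  have "norm (k z) \<le> m * exp (\<delta> * S\<^sup>2)"
  proof (rule norm_le_on_rectangle[where f = k and z = z, OF _ _ z])
    show "k holomorphic_on {w. \<bar>Re w\<bar> \<le> R \<and> \<bar>Im w\<bar> \<le> S}"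
      unfolding k_def by (intro holomorphic_intros holomorphic_on_subset[OF hol]) auto
    fix w assume w: "\<bar>Re w\<bar> \<le> R" "\<bar>Im w\<bar> \<le> S" "\<bar>Re w\<bar> = R \<or> \<bar>Im w\<bar> = S"
    have "norm (h w) * exp (- \<delta> * (Re w)\<^sup>2) \<le> m"
      using w(3)
    proof
      assume "\<bar>Re w\<bar> = R"
      then have "norm (h w) * exp (- \<delta> * (Re w)\<^sup>2) \<le> M * exp (- \<delta> * R\<^sup>2)"
        using bound[OF w(2)] order.trans[OF norm_ge_zero bound[OF w(2)]]
        by (intro mult_mono) auto
      then show ?thesis using R by simp
    next
      assume "\<bar>Im w\<bar> = S"
      then have "norm (h w) * exp (- \<delta> * (Re w)\<^sup>2) \<le> m * 1"
        using edge \<open>m \<ge> 0\<close> \<open>\<delta> \<ge> 0\<close> by (intro mult_mono) auto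
      then show ?thesis by simp
    qed
    moreover have "exp (\<delta> * (Im w)\<^sup>2) \<le> exp (\<delta> * S\<^sup>2)"
      using w(2) \<open>\<delta> \<ge> 0\<close> power_mono[of "\<bar>Im w\<bar>" S 2] by (simp add: mult_left_mono)
    ultimately show "norm (k w) \<le> m * exp (\<delta> * S\<^sup>2)"
      unfolding norm_k using \<open>m \<ge> 0\<close> by (intro mult_mono) auto
  qed
  then show ?thesis by (simp only: k_def)
qed

lemma norm_le_on_strip:
  assumes hol: "h holomorphic_on {w. \<bar>Im w\<bar> \<le> S}" and "m > 0"
    and bound: "\<And>w. \<bar>Im w\<bar> \<le> S \<Longrightarrow> norm (h w) \<le> M"
    and edge: "\<And>w. \<bar>Im w\<bar> = S \<Longrightarrow> norm (h w) \<le> m"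
    and z: "\<bar>Im z\<bar> \<le> S"
  shows "norm (h z) \<le> m"
proof -
  let ?k = "\<lambda>\<delta>. h z * exp (- of_real \<delta> * z\<^sup>2)"
  have "norm (?k \<delta>) \<le> m * exp (\<delta> * S\<^sup>2)" if "\<delta> > 0" for \<delta>
  proof -
    have "((\<lambda>R. M * exp (- \<delta> * R\<^sup>2)) \<longlongrightarrow> 0) at_top" using that by real_asymp
    then have "eventually (\<lambda>R. M * exp (- \<delta> * R\<^sup>2) < m) at_top"
      using \<open>m > 0\<close> by (rule order_tendstoD(2))
    then have "eventually (\<lambda>R. M * exp (- \<delta> * R\<^sup>2) < m \<and> R > \<bar>Re z\<bar>) at_top"
      by (intro eventually_conj eventually_gt_at_top)
    then obtain R where "M * exp (- \<delta> * R\<^sup>2) < m" "R > \<bar>Re z\<bar>"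
      using eventually_happens'[OF trivial_limit_at_top_linorder] by blast
    then show ?thesis
      using that \<open>m > 0\<close>
      by (intro norm_gaussian_damped_le_on_rectangle[where R = R, OF hol _ _ bound edge _ _ z]) auto
  qed
  then have "\<forall>\<^sub>F \<delta> in at_right 0. norm (?k \<delta>) \<le> m * exp (\<delta> * S\<^sup>2)"
    by (intro eventually_mono[OF eventually_at_right_less[of 0]])
  moreover have "((\<lambda>\<delta>. norm (?k \<delta>)) \<longlongrightarrow> norm (?k 0)) (at_right 0)"
    by (intro tendsto_intros)
  moreover have "((\<lambda>\<delta>. m * exp (\<delta> * S\<^sup>2)) \<longlongrightarrow> m * exp (0 * S\<^sup>2)) (at_right 0)"
    by (intro tendsto_intros)
  ultimately have "norm (?k 0) \<le> m * exp (0 * S\<^sup>2)"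
    by (intro tendsto_le[of "at_right (0::real)"]) auto
  then show ?thesis by simp
qed

lemma norm_le_tilted_on_strip:
  assumes hol: "h holomorphic_on {w. \<bar>Im w\<bar> \<le> S}" and "m > 0"
    and bound: "\<And>w. \<bar>Im w\<bar> \<le> S \<Longrightarrow> norm (h w) \<le> M"
    and upper: "\<And>w. Im w = S \<Longrightarrow> norm (h w) \<le> m * exp (- k * S)"
    and lower: "\<And>w. Im w = - S \<Longrightarrow> norm (h w) \<le> m * exp (k * S)"
    and z: "\<bar>Im z\<bar> \<le> S"
  shows "norm (h z) \<le> m * exp (- k * Im z)"
proof -
  define G where "G w = h w * exp (- \<i> * of_real k * w)" for w
  have norm_G: "norm (G w) = norm (h w) * exp (k * Im w)" for w
    by (simp add: G_def norm_mult norm_exp_eq_Re)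
  have "norm (G z) \<le> m"
  proof (rule norm_le_on_strip[where h = G and z = z, OF _ \<open>m > 0\<close> _ _ z])
    show "G holomorphic_on {w. \<bar>Im w\<bar> \<le> S}" unfolding G_def by (intro holomorphic_intros hol)
    show "norm (G w) \<le> M * exp (\<bar>k\<bar> * S)" if "\<bar>Im w\<bar> \<le> S" for w
    proof -
      have "k * Im w \<le> \<bar>k\<bar> * S"
        using abs_ge_self[of "k * Im w"] mult_left_mono[OF that abs_ge_zero[of k]]
        by (simp add: abs_mult)
      then show ?thesis
        unfolding norm_G using bound[OF that] order.trans[OF norm_ge_zero bound[OF that]]
        by (intro mult_mono) auto
    qed
    show "norm (G w) \<le> m" if "\<bar>Im w\<bar> = S" for w
    proof (cases "Im w = S")
      case True
      then show ?thesis
        using mult_right_mono[OF upper, of w "exp (k * S)"]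
        by (simp add: norm_G mult.assoc mult_exp_exp)
    next
      case False
      then have "Im w = - S" using that by auto
      then show ?thesis
        using mult_right_mono[OF lower, of w "exp (- k * S)"]
        by (simp add: norm_G mult.assoc mult_exp_exp)
    qed
  qed
  from mult_right_mono[OF this, of "exp (- k * Im z)"]
  show ?thesis by (simp add: norm_G mult.assoc mult_exp_exp)
qed

lemma norm_le_three_lines:
  assumes hol: "h holomorphic_on {w. \<bar>Im w\<bar> \<le> S}" and pos: "S > 0" "\<eta> > 0" "M > 0"
    and bound: "\<And>w. \<bar>Im w\<bar> \<le> S \<Longrightarrow> norm (h w) \<le> M"
    and edge: "\<And>w. Im w = S \<Longrightarrow> norm (h w) \<le> \<eta>"
    and z: "\<bar>Im z\<bar> \<le> S"
  shows "norm (h z) \<le> M * (\<eta> / M) powr ((S + Im z) / (2 * S))"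
proof -
  define k where "k = - ln (\<eta> / M) / (2 * S)"
  have "exp (- k * S) * exp (- k * S) = exp (ln (\<eta> / M))"
    using pos(1) unfolding mult_exp_exp by (simp add: k_def)
  then have upper_eq: "M * exp (- k * S) * exp (- k * S) = \<eta>" using pos by (simp add: mult.assoc)
  have lower_eq: "M * exp (- k * S) * exp (k * S) = M" by (simp add: mult.assoc mult_exp_exp)
  have "norm (h z) \<le> M * exp (- k * S) * exp (- k * Im z)"
  proof (rule norm_le_tilted_on_strip[OF hol _ bound _ _ z])
    show "norm (h w) \<le> M * exp (- k * S) * exp (- k * S)" if "Im w = S" for w
      unfolding upper_eq by (rule edge[OF that])
    show "norm (h w) \<le> M * exp (- k * S) * exp (k * S)" if "Im w = - S" for w
      unfolding lower_eq using that pos(1) by (intro bound) simp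
  qed (use pos in auto)
  also have "\<dots> = M * exp ((S + Im z) / (2 * S) * ln (\<eta> / M))"
    by (simp add: k_def mult.assoc mult_exp_exp field_simps)
  finally show ?thesis using pos by (simp add: powr_def)
qed

lemma three_lines_margin:
  fixes M \<epsilon> S \<alpha> :: real
  assumes "M > 0" "\<epsilon> > 0" "S > 0" "- S < \<alpha>"
  obtains \<eta> where "\<eta> > 0" "\<And>y. \<alpha> \<le> y \<Longrightarrow> M * (\<eta> / M) powr ((S + y) / (2 * S)) \<le> \<epsilon>"
proof
  define \<theta> t where "\<theta> = (S + \<alpha>) / (2 * S)" and "t = min 1 (\<epsilon> / M)"
  define \<eta> where "\<eta> = M * t powr (1 / \<theta>)"
  have t: "0 < t" "t \<le> 1" "M * t \<le> \<epsilon>" using assms by (auto simp: t_def min_def field_simps)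
  have "\<theta> > 0" using assms by (simp add: \<theta>_def)
  have ratio: "\<eta> / M = t powr (1 / \<theta>)" using assms(1) by (simp add: \<eta>_def)
  show "\<eta> > 0" using assms(1) t(1) by (simp add: \<eta>_def)
  fix y assume "\<alpha> \<le> y"
  then have "\<theta> \<le> (S + y) / (2 * S)" using assms(3) by (simp add: \<theta>_def divide_right_mono)
  moreover have "0 \<le> \<eta> / M" "\<eta> / M \<le> 1"
    unfolding ratio using t \<open>\<theta> > 0\<close> by (auto intro: powr_le1)
  ultimately have "(\<eta> / M) powr ((S + y) / (2 * S)) \<le> (\<eta> / M) powr \<theta>" by (rule powr_mono')
  also have "\<dots> = t" unfolding ratio powr_powr using t(1) \<open>\<theta> > 0\<close> by simp
  finally have "M * (\<eta> / M) powr ((S + y) / (2 * S)) \<le> M * t"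
    using assms(1) by (intro mult_left_mono) auto
  then show "M * (\<eta> / M) powr ((S + y) / (2 * S)) \<le> \<epsilon>" using t(3) by linarith
qed

lemma norm_translate_diff_three_lines:
  assumes hol: "F holomorphic_on UNIV" and pos: "S > 0" "\<eta> > 0" "B > 0"
    and bound: "\<And>w. \<bar>Im w\<bar> \<le> S \<Longrightarrow> norm (F w) \<le> B"
    and edge: "\<And>w. Im w = S \<Longrightarrow> norm (F (w + of_real \<tau>) - F w) \<le> \<eta>"
    and z: "\<bar>Im z\<bar> \<le> S"
  shows "norm (F (z + of_real \<tau>) - F z) \<le> 2 * B * (\<eta> / (2 * B)) powr ((S + Im z) / (2 * S))"
proof (rule norm_le_three_lines[where h = "\<lambda>w. F (w + of_real \<tau>) - F w", OF _ pos(1,2) _ _ edge z])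
  show "(\<lambda>w. F (w + of_real \<tau>) - F w) holomorphic_on {w. \<bar>Im w\<bar> \<le> S}"
    by (intro holomorphic_intros holomorphic_on_compose_gen[OF _ hol, unfolded comp_def]
        holomorphic_on_subset[OF hol]) auto
  show "norm (F (w + of_real \<tau>) - F w) \<le> 2 * B" if "\<bar>Im w\<bar> \<le> S" for w
    using norm_triangle_ineq4[of "F (w + of_real \<tau>)" "F w"] bound[of w] bound[of "w + of_real \<tau>"] that
    by simp
qed (use pos in auto)

lemma almost_periodic_entireI:
  assumes hol: "F holomorphic_on UNIV"
    and bounded: "\<And>S. S > 0 \<Longrightarrow> \<exists>B. \<forall>z. \<bar>Im z\<bar> \<le> S \<longrightarrow> norm (F z) \<le> B"
    and periods: "\<And>S \<eta>. S > 0 \<Longrightarrow> \<eta> > 0 \<Longrightarrow>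
      relatively_dense {\<tau>. \<forall>z. Im z = S \<longrightarrow> norm (F (z + of_real \<tau>) - F z) \<le> \<eta>}"
  shows "almost_periodic_entire F"
proof -
  have "relatively_dense {\<tau>. \<exists>\<delta><\<epsilon>. \<forall>x y. \<alpha> \<le> y \<longrightarrow> y \<le> \<beta> \<longrightarrow>
      norm (F (Complex (x + \<tau>) y) - F (Complex x y)) \<le> \<delta>}" if "\<epsilon> > 0" for \<alpha> \<beta> \<epsilon>
  proof -
    define S where "S = max \<bar>\<alpha>\<bar> \<bar>\<beta>\<bar> + 1"
    have S: "S > 0" "- S < \<alpha>" "\<beta> \<le> S" by (auto simp: S_def)
    obtain B0 where B0: "\<And>z. \<bar>Im z\<bar> \<le> S \<Longrightarrow> norm (F z) \<le> B0" using bounded[OF S(1)] by blast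
    define B where "B = \<bar>B0\<bar> + 1"
    have "B > 0" by (simp add: B_def)
    have bound: "norm (F z) \<le> B" if "\<bar>Im z\<bar> \<le> S" for z using B0[OF that] by (simp add: B_def)
    obtain \<eta> where "\<eta> > 0" and small: "\<And>y. \<alpha> \<le> y \<Longrightarrow>
        2 * B * (\<eta> / (2 * B)) powr ((S + y) / (2 * S)) \<le> \<epsilon> / 2"
      using three_lines_margin[OF _ _ S(1,2), of "2 * B" "\<epsilon> / 2"] \<open>\<epsilon> > 0\<close> \<open>B > 0\<close> by auto
    show ?thesis
    proof (rule relatively_dense_mono[OF periods[OF S(1) \<open>\<eta> > 0\<close>]], intro subsetI CollectI)
      fix \<tau> assume \<tau>: "\<tau> \<in> {\<tau>. \<forall>z. Im z = S \<longrightarrow> norm (F (z + of_real \<tau>) - F z) \<le> \<eta>}"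
      have "norm (F (Complex (x + \<tau>) y) - F (Complex x y)) \<le> \<epsilon> / 2" if y: "\<alpha> \<le> y" "y \<le> \<beta>" for x y
      proof -
        have "norm (F (Complex x y + of_real \<tau>) - F (Complex x y))
            \<le> 2 * B * (\<eta> / (2 * B)) powr ((S + Im (Complex x y)) / (2 * S))"
          using y S \<tau>
          by (intro norm_translate_diff_three_lines[OF hol S(1) \<open>\<eta> > 0\<close> \<open>B > 0\<close> bound]) auto
        also have "\<dots> \<le> \<epsilon> / 2" using small[OF y(1)] by simp
        also have "Complex x y + of_real \<tau> = Complex (x + \<tau>) y" by (simp add: complex_eq_iff)
        finally show ?thesis .
      qed
      then show "\<exists>\<delta><\<epsilon>. \<forall>x y. \<alpha> \<le> y \<longrightarrow> y \<le> \<beta> \<longrightarrow>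
          norm (F (Complex (x + \<tau>) y) - F (Complex x y)) \<le> \<delta>"
        using \<open>\<epsilon> > 0\<close> by (intro exI[of _ "\<epsilon> / 2"]) auto
    qed
  qed
  then show ?thesis
    using hol unfolding almost_periodic_entire_def relatively_dense_def mem_Collect_eq by blast
qed

subsection \<open>Integer measures whose Fourier transform is a measure\<close>

lemma sum_over_enumeration:
  fixes a :: "'i \<Rightarrow> real" and \<psi> :: "real \<Rightarrow> complex"
  assumes range: "range a = \<Lambda>"
    and multiplicity: "\<And>x. x \<in> \<Lambda> \<Longrightarrow> card {n. a n = x} = c x" "\<And>x. x \<in> \<Lambda> \<Longrightarrow> c x > 0"
    and summable: "(\<lambda>x. norm (of_nat (c x) * \<psi> x)) summable_on \<Lambda>"
  shows "(\<lambda>n. norm (\<psi> (a n))) summable_on UNIV"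
    and "(\<Sum>\<^sub>\<infinity>n. \<psi> (a n)) = pair_discrete \<Lambda> (\<lambda>x. of_nat (c x)) \<psi>"
proof -
  define I where "I = Sigma \<Lambda> (\<lambda>x. {n. a n = x})"
  have fibre: "finite {n. a n = x}" if "x \<in> \<Lambda>" for x
    using multiplicity[OF that] by (metis card.infinite less_irrefl)
  have bij: "bij_betw snd I UNIV"
    by (rule bij_betwI[of _ _ _ "\<lambda>n. (a n, n)"]) (use range in \<open>auto simp: I_def\<close>)
  have abs_summable: "(\<lambda>p. norm (case p of (x, n) \<Rightarrow> \<psi> x)) summable_on I"
    unfolding I_def
  proof (rule Infinite_Sum.abs_summable_on_Sigma_iff[THEN iffD2], intro conjI ballI)
    show "(\<lambda>n. norm (case (x, n) of (x, n) \<Rightarrow> \<psi> x)) summable_on {n. a n = x}" if "x \<in> \<Lambda>" for x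
      using fibre[OF that] by simp
    show "(\<lambda>x. norm (\<Sum>\<^sub>\<infinity>n\<in>{n. a n = x}. norm (case (x, n) of (x, n) \<Rightarrow> \<psi> x))) summable_on \<Lambda>"
      using summable
      by (rule summable_on_cong[THEN iffD1, rotated]) (simp add: fibre multiplicity norm_mult)
  qed
  then have "(\<lambda>p. norm (\<psi> (a (snd p)))) summable_on I"
    by (rule summable_on_cong[THEN iffD1, rotated]) (auto simp: I_def)
  then show "(\<lambda>n. norm (\<psi> (a n))) summable_on UNIV"
    using summable_on_reindex_bij_betw[OF bij, of "\<lambda>n. norm (\<psi> (a n))"] by simp
  have "(\<Sum>\<^sub>\<infinity>n. \<psi> (a n)) = (\<Sum>\<^sub>\<infinity>p\<in>I. \<psi> (a (snd p)))"
    by (rule infsum_reindex_bij_betw[OF bij, symmetric])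
  also have "\<dots> = (\<Sum>\<^sub>\<infinity>(x, n)\<in>I. \<psi> x)"
    by (rule infsum_cong) (auto simp: I_def)
  also have "\<dots> = (\<Sum>\<^sub>\<infinity>x\<in>\<Lambda>. \<Sum>\<^sub>\<infinity>n\<in>{n. a n = x}. \<psi> x)"
    using Infinite_Sum.abs_summable_summable[OF abs_summable] unfolding I_def
    by (rule infsum_Sigma'_banach[symmetric])
  also have "\<dots> = pair_discrete \<Lambda> (\<lambda>x. of_nat (c x)) \<psi>"
    unfolding pair_discrete_def by (rule infsum_cong) (simp add: fibre multiplicity)
  finally show "(\<Sum>\<^sub>\<infinity>n. \<psi> (a n)) = pair_discrete \<Lambda> (\<lambda>x. of_nat (c x)) \<psi>" .
qed

locale integer_fourier_measure =
  fixes \<Lambda> \<Gamma> :: "real set" and c :: "real \<Rightarrow> nat" and b :: "real \<Rightarrow> complex"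
    and a :: "int \<Rightarrow> real"
  assumes c_pos: "\<And>x. x \<in> \<Lambda> \<Longrightarrow> c x > 0"
    and mu_temp: "tempered_discrete \<Lambda> (\<lambda>x. of_nat (c x))"
    and absmuhat_temp: "tempered_discrete \<Gamma> (\<lambda>x. complex_of_real (norm (b x)))"
    and fourier_eq: "\<And>\<phi>. schwartz \<phi> \<Longrightarrow>
        pair_discrete \<Lambda> (\<lambda>x. of_nat (c x)) (fourier \<phi>) = pair_discrete \<Gamma> b \<phi>"
    and a_mono: "\<And>n. a n \<le> a (n + 1)"
    and a_range: "range a = \<Lambda>"
    and a_mult: "\<And>x. x \<in> \<Lambda> \<Longrightarrow> card {n. a n = x} = c x"
    and zero_notin: "0 \<notin> range a"
begin

lemma summable_b_schwartz:
  assumes "schwartz \<phi>"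
  shows "(\<lambda>\<gamma>. norm (b \<gamma> * \<phi> \<gamma>)) summable_on \<Gamma>"
  using absmuhat_temp assms unfolding tempered_discrete_def by (simp add: norm_mult)

lemma sum_fourier_eq:
  assumes "schwartz \<phi>" "schwartz \<psi>" and dominated: "\<And>x. norm (fourier \<phi> x) \<le> C * norm (\<psi> x)"
  shows "(\<lambda>n. norm (fourier \<phi> (a n))) summable_on UNIV"
    and "(\<Sum>\<^sub>\<infinity>n. fourier \<phi> (a n)) = (\<Sum>\<^sub>\<infinity>\<gamma>\<in>\<Gamma>. b \<gamma> * \<phi> \<gamma>)"
proof -
  have "(\<lambda>x. norm (of_nat (c x) * \<psi> x)) summable_on \<Lambda>"
    using mu_temp assms(2) unfolding tempered_discrete_def by blast
  then have "(\<lambda>x. C * norm (of_nat (c x) * \<psi> x)) summable_on \<Lambda>"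
    by (rule summable_on_cmult_right)
  then have summable: "(\<lambda>x. norm (of_nat (c x) * fourier \<phi> x)) summable_on \<Lambda>"
    by (rule summable_on_comparison_test)
       (use mult_left_mono[OF dominated of_nat_0_le_iff] in \<open>simp_all add: norm_mult mult_ac\<close>)
  note enumeration = sum_over_enumeration[OF a_range a_mult c_pos summable]
  show "(\<lambda>n. norm (fourier \<phi> (a n))) summable_on UNIV" by (rule enumeration(1))
  show "(\<Sum>\<^sub>\<infinity>n. fourier \<phi> (a n)) = (\<Sum>\<^sub>\<infinity>\<gamma>\<in>\<Gamma>. b \<gamma> * \<phi> \<gamma>)"
    using enumeration(2) fourier_eq[OF assms(1)] by (simp only: pair_discrete_def)
qed

lemma gaussian_sum_bound:
  assumes "finite X"
  shows "(\<Sum>n\<in>X. exp (- (pi * (a n - x)\<^sup>2))) \<le> (\<Sum>\<^sub>\<infinity>\<gamma>\<in>\<Gamma>. norm (b \<gamma> * gaussian pi 0 \<gamma>))"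
proof -
  define \<phi> where "\<phi> = gaussian pi (2 * pi * \<i> * of_real x)"
  define g where "g n = exp (- (pi * (a n - x)\<^sup>2))" for n
  have fourier_\<phi>: "fourier \<phi> \<xi> = of_real (exp (- (pi * (\<xi> - x)\<^sup>2)))" for \<xi>
    using fourier_gaussian[of 1 x \<xi>] by (simp add: \<phi>_def)
  have "norm (fourier \<phi> \<xi>) = exp (- (pi * x\<^sup>2)) * norm (gaussian pi (of_real (2 * pi * x)) \<xi>)" for \<xi>
    by (simp add: fourier_\<phi> norm_gaussian mult_exp_exp power2_eq_square algebra_simps)
  moreover have "schwartz \<phi>" "schwartz (gaussian pi (of_real (2 * pi * x)))"
    by (simp_all add: \<phi>_def schwartz_gaussian)
  ultimately have "(\<lambda>n. norm (fourier \<phi> (a n))) summable_on UNIV"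
    and sum_eq: "(\<Sum>\<^sub>\<infinity>n. fourier \<phi> (a n)) = (\<Sum>\<^sub>\<infinity>\<gamma>\<in>\<Gamma>. b \<gamma> * \<phi> \<gamma>)"
    using sum_fourier_eq[of \<phi> "gaussian pi (of_real (2 * pi * x))" "exp (- (pi * x\<^sup>2))"] by simp_all
  then have g: "g summable_on UNIV" by (simp add: fourier_\<phi> g_def[abs_def])
  have norm_\<phi>: "norm (\<phi> \<gamma>) = norm (gaussian pi 0 \<gamma>)" for \<gamma> by (simp add: \<phi>_def norm_gaussian)
  have "complex_of_real (infsum g UNIV) = (\<Sum>\<^sub>\<infinity>n. fourier \<phi> (a n))"
    unfolding fourier_\<phi> g_def[symmetric]
    by (rule infsumI[OF has_sum_of_real[OF has_sum_infsum[OF g]], symmetric])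
  then have "norm (complex_of_real (infsum g UNIV)) \<le> (\<Sum>\<^sub>\<infinity>\<gamma>\<in>\<Gamma>. norm (b \<gamma> * gaussian pi 0 \<gamma>))"
    using norm_infsum_bound[OF summable_b_schwartz[OF \<open>schwartz \<phi>\<close>]]
    by (simp add: sum_eq norm_mult norm_\<phi>)
  moreover have "sum g X \<le> infsum g UNIV"
    using assms by (intro finite_sum_le_infsum g) (auto simp: g_def)
  ultimately show ?thesis by (simp add: g_def)
qed

end

sublocale integer_fourier_measure \<subseteq> bounded_cauchy_sums a
  by (rule bounded_cauchy_sums_of_gaussian[OF gaussian_sum_bound])

context integer_fourier_measure
begin

definition pos_freqs :: "real set" where
  "pos_freqs = \<Gamma> \<inter> {0<..}"

lemma exp_summable_pos_freqs:
  assumes "y > 0"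
  shows "exp_summable pos_freqs b y"
  unfolding exp_summable_def
proof (rule summable_on_comparison_test)
  let ?E = "smooth_exp 1 (\<i> * of_real y)"
  have "(\<lambda>\<gamma>. norm (b \<gamma> * ?E \<gamma>)) summable_on pos_freqs"
    using assms by (intro summable_on_subset_banach[OF summable_b_schwartz] schwartz_smooth_exp)
      (auto simp: pos_freqs_def)
  then show "(\<lambda>\<gamma>. exp (pi + 2 * pi * y) * norm (b \<gamma> * ?E \<gamma>)) summable_on pos_freqs"
    by (rule summable_on_cmult_right)
  fix \<gamma> assume "\<gamma> \<in> pos_freqs"
  then have "\<gamma> > 0" by (simp add: pos_freqs_def)
  have "exp (- 2 * pi * y * \<gamma>)
      = exp (pi + 2 * pi * y) * (exp (- pi - 2 * pi * y) * exp (- 2 * pi * y * \<gamma>))"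
    by (simp add: mult_exp_exp flip: mult.assoc)
  also have "\<dots> \<le> exp (pi + 2 * pi * y) * norm (?E \<gamma>)"
    by (intro mult_left_mono norm_smooth_exp_ge assms \<open>\<gamma> > 0\<close>) auto
  finally have "norm (b \<gamma>) * exp (- 2 * pi * y * \<gamma>)
      \<le> norm (b \<gamma>) * (exp (pi + 2 * pi * y) * norm (?E \<gamma>))"
    by (rule mult_left_mono) simp
  then show "norm (b \<gamma>) * exp (- 2 * pi * y * \<gamma>) \<le> exp (pi + 2 * pi * y) * norm (b \<gamma> * ?E \<gamma>)"
    by (simp add: norm_mult mult_ac)
qed simp

lemma summable_b_one_sided_decay:
  assumes "y > 0"
  shows "(\<lambda>\<gamma>. norm (b \<gamma>) * one_sided_decay y \<gamma>) summable_on \<Gamma>"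
proof -
  have "(\<lambda>\<gamma>. norm (b \<gamma>) * one_sided_decay y \<gamma>) summable_on pos_freqs"
    using exp_summable_pos_freqs[OF assms] unfolding exp_summable_def
    by (rule summable_on_cong[THEN iffD1, rotated]) (auto simp: pos_freqs_def one_sided_decay_def)
  moreover have "(\<lambda>\<gamma>. norm (b \<gamma>) * one_sided_decay y \<gamma>) summable_on (\<Gamma> \<inter> {..0})"
  proof -
    have "(\<lambda>\<gamma>. norm (b \<gamma> * gaussian (pi / 2) 0 \<gamma>)) summable_on (\<Gamma> \<inter> {..0})"
      by (intro summable_on_subset_banach[OF summable_b_schwartz] schwartz_gaussian) auto
    then show ?thesis
      by (rule summable_on_cong[THEN iffD1, rotated])
         (auto simp: one_sided_decay_def norm_gaussian norm_mult)
  qed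
  ultimately have "(\<lambda>\<gamma>. norm (b \<gamma>) * one_sided_decay y \<gamma>) summable_on (pos_freqs \<union> \<Gamma> \<inter> {..0})"
    by (rule summable_on_union)
  moreover have "pos_freqs \<union> \<Gamma> \<inter> {..0} = \<Gamma>" by (auto simp: pos_freqs_def)
  ultimately show ?thesis by simp
qed

subsection \<open>The sum of the Cauchy kernels as an exponential series\<close>

lemma
  assumes "0 < r" "r \<le> 1" "Im z > 0"
  shows summable_smoothed_cauchy: "(\<lambda>n. smoothed_cauchy r z (a n)) summable_on UNIV"
    and smoothed_cauchy_sum:
      "(\<Sum>\<^sub>\<infinity>n. smoothed_cauchy r z (a n)) = (\<Sum>\<^sub>\<infinity>\<gamma>\<in>\<Gamma>. b \<gamma> * smooth_exp r z \<gamma>)"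
proof -
  have "norm (fourier (smooth_exp r z) x)
      \<le> inverse (2 * pi * Im z) * norm (gaussian (pi * r\<^sup>2) 0 x)" for x
  proof -
    have "Im z \<le> norm (of_real x - z)"
      using abs_Im_le_cmod[of "of_real x - z"] assms(3) by simp
    then have "exp (- (pi * (r * x)\<^sup>2)) / (2 * pi * norm (of_real x - z))
        \<le> exp (- (pi * (r * x)\<^sup>2)) / (2 * pi * Im z)"
      using assms(3) by (intro divide_left_mono mult_left_mono mult_pos_pos) auto
    also have "\<dots> = inverse (2 * pi * Im z) * norm (gaussian (pi * r\<^sup>2) 0 x)"
      by (simp add: norm_gaussian power_mult_distrib field_simps)
    finally show ?thesis
      unfolding fourier_smooth_exp[OF assms] smoothed_cauchy_def norm_divide norm_mult by simp
  qed
  moreover have "schwartz (gaussian (pi * r\<^sup>2) 0)" using assms(1) by (intro schwartz_gaussian) simp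
  ultimately have "(\<lambda>n. norm (smoothed_cauchy r z (a n))) summable_on UNIV"
    and sum_eq: "(\<Sum>\<^sub>\<infinity>n. smoothed_cauchy r z (a n)) = (\<Sum>\<^sub>\<infinity>\<gamma>\<in>\<Gamma>. b \<gamma> * smooth_exp r z \<gamma>)"
    using sum_fourier_eq[OF schwartz_smooth_exp[OF assms]]
    unfolding fourier_smooth_exp[OF assms] by blast+
  then show "(\<lambda>n. smoothed_cauchy r z (a n)) summable_on UNIV"
    by (simp add: abs_summable_summable)
  show "(\<Sum>\<^sub>\<infinity>n. smoothed_cauchy r z (a n)) = (\<Sum>\<^sub>\<infinity>\<gamma>\<in>\<Gamma>. b \<gamma> * smooth_exp r z \<gamma>)"
    by (rule sum_eq)
qed

lemma smoothed_freq_sum_tendsto: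
  assumes r: "\<And>k. 0 < r k" "\<And>k. r k \<le> 1" "r \<longlonglongrightarrow> 0" and "Im z > 0"
  shows "(\<lambda>k. \<Sum>\<^sub>\<infinity>\<gamma>\<in>\<Gamma>. b \<gamma> * smooth_exp (r k) z \<gamma>)
    \<longlonglongrightarrow> exp_series pos_freqs b z + (\<Sum>\<gamma>\<in>\<Gamma> \<inter> {0}. b \<gamma> / 2)"
proof -
  let ?l = "\<lambda>\<gamma>. b \<gamma> * (of_real ((1 + sgn \<gamma>) / 2) * freq_exp \<gamma> z)"
  let ?C = "LINT v|lborel. smooth_exp_majorant (Im z) v"
  have "(\<lambda>k. \<Sum>\<^sub>\<infinity>\<gamma>\<in>\<Gamma>. b \<gamma> * smooth_exp (r k) z \<gamma>) \<longlonglongrightarrow> infsum ?l \<Gamma>"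
  proof (rule infsum_dominated_convergence)
    show "(\<lambda>\<gamma>. ?C * (norm (b \<gamma>) * one_sided_decay (Im z) \<gamma>)) summable_on \<Gamma>"
      by (intro summable_on_cmult_right summable_b_one_sided_decay assms(4))
    show "\<forall>\<^sub>F k in sequentially. \<forall>\<gamma>\<in>\<Gamma>. norm (b \<gamma> * smooth_exp (r k) z \<gamma>)
        \<le> ?C * (norm (b \<gamma>) * one_sided_decay (Im z) \<gamma>)"
      using mult_left_mono[OF norm_smooth_exp_le[OF r(1,2) assms(4)]]
      by (intro always_eventually allI ballI) (simp add: norm_mult mult_ac)
    show "(\<lambda>k. b \<gamma> * smooth_exp (r k) z \<gamma>) \<longlonglongrightarrow> ?l \<gamma>" for \<gamma>
      by (intro tendsto_mult_left smooth_exp_tendsto assms)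
  qed simp
  also have "infsum ?l \<Gamma> = infsum ?l (pos_freqs \<union> \<Gamma> \<inter> {0})"
    by (rule infsum_cong_neutral) (auto simp: pos_freqs_def sgn_if)
  also have "\<dots> = infsum ?l pos_freqs + infsum ?l (\<Gamma> \<inter> {0})"
  proof (rule infsum_Un_disjoint)
    show "?l summable_on pos_freqs"
      using exp_series_summable[OF exp_summable_pos_freqs[OF assms(4)]]
      by (rule summable_on_cong[THEN iffD1, rotated]) (simp add: pos_freqs_def)
  qed (auto simp: pos_freqs_def)
  also have "infsum ?l pos_freqs = exp_series pos_freqs b z"
    unfolding exp_series_def by (rule infsum_cong) (simp add: pos_freqs_def)
  also have "infsum ?l (\<Gamma> \<inter> {0}) = (\<Sum>\<gamma>\<in>\<Gamma> \<inter> {0}. b \<gamma> / 2)"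
    by (subst infsum_finite) (auto intro: sum.cong simp: freq_exp_def)
  finally show ?thesis .
qed

text \<open>Only differences survive the removal of the smoothing: the Cauchy kernel alone is not
  absolutely summable, and the frequency \<open>0\<close> contributes half of its mass.\<close>

lemma smoothed_cauchy_sum_diff_tendsto:
  assumes "r \<longlonglongrightarrow> 0" "Im z > 0" "Im w > 0"
  shows "(\<lambda>k. \<Sum>\<^sub>\<infinity>n. smoothed_cauchy (r k) z (a n) - smoothed_cauchy (r k) w (a n))
    \<longlonglongrightarrow> - (1 / (2 * pi * \<i>)) * (\<Sum>\<^sub>\<infinity>n. 1 / (z - of_real (a n)) - 1 / (w - of_real (a n)))"
proof -
  define D where "D n = 1 / (z - complex_of_real (a n)) - 1 / (w - of_real (a n))" for n
  define A where "A = - (1 / (2 * pi * \<i>))"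
  have diff_eq: "smoothed_cauchy (r k) z (a n) - smoothed_cauchy (r k) w (a n)
      = of_real (exp (- (pi * (r k * a n)\<^sup>2))) * (A * D n)" for k n
  proof -
    have "of_real (a n) \<noteq> z" "of_real (a n) \<noteq> w" using assms(2,3) by auto
    then show ?thesis
      unfolding smoothed_cauchy_def A_def D_def
      by (simp add: divide_simps) (simp add: algebra_simps)
  qed
  have "(\<lambda>k. \<Sum>\<^sub>\<infinity>n. of_real (exp (- (pi * (r k * a n)\<^sup>2))) * (A * D n)) \<longlonglongrightarrow> (\<Sum>\<^sub>\<infinity>n. A * D n)"
  proof (rule infsum_dominated_convergence)
    show "(\<lambda>n. norm A * norm (D n)) summable_on UNIV"
      unfolding D_def by (intro summable_on_cmult_right summable_cauchy_kernel_diff assms)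
    have "norm (of_real (exp (- (pi * (r k * a n)\<^sup>2))) * (A * D n)) \<le> norm A * norm (D n)" for k n
      unfolding norm_mult[of "of_real _"] by (simp add: norm_mult mult_left_le_one_le)
    then show "\<forall>\<^sub>F k in sequentially. \<forall>n\<in>UNIV.
        norm (of_real (exp (- (pi * (r k * a n)\<^sup>2))) * (A * D n)) \<le> norm A * norm (D n)"
      by simp
    have "(\<lambda>k. of_real (exp (- (pi * (r k * a n)\<^sup>2))) * (A * D n))
        \<longlonglongrightarrow> of_real (exp (- (pi * (0 * a n)\<^sup>2))) * (A * D n)" for n
      by (intro tendsto_intros assms(1))
    then show "(\<lambda>k. of_real (exp (- (pi * (r k * a n)\<^sup>2))) * (A * D n)) \<longlonglongrightarrow> A * D n" for n
      by simp
  qed simp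
  then show ?thesis unfolding diff_eq infsum_cmult_right' A_def D_def .
qed

lemma cauchy_sum_diff:
  assumes "Im z > 0" "Im w > 0"
  shows "(\<Sum>\<^sub>\<infinity>n. 1 / (z - of_real (a n)) - 1 / (w - of_real (a n)))
    = - (2 * pi * \<i>) * (exp_series pos_freqs b z - exp_series pos_freqs b w)"
proof -
  define r where "r k = inverse (real (Suc k))" for k
  have r: "0 < r k" "r k \<le> 1" for k by (simp_all add: r_def field_simps)
  have r_lim: "r \<longlonglongrightarrow> 0" unfolding r_def by (rule LIMSEQ_inverse_real_of_nat)
  have "(\<Sum>\<^sub>\<infinity>n. smoothed_cauchy (r k) z (a n) - smoothed_cauchy (r k) w (a n))
      = (\<Sum>\<^sub>\<infinity>\<gamma>\<in>\<Gamma>. b \<gamma> * smooth_exp (r k) z \<gamma>) - (\<Sum>\<^sub>\<infinity>\<gamma>\<in>\<Gamma>. b \<gamma> * smooth_exp (r k) w \<gamma>)" for k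
    unfolding smoothed_cauchy_sum[OF r assms(1), symmetric]
      smoothed_cauchy_sum[OF r assms(2), symmetric]
    by (intro infsum_diff summable_smoothed_cauchy r assms)
  moreover note tendsto_diff[OF smoothed_freq_sum_tendsto[OF r r_lim assms(1)]
      smoothed_freq_sum_tendsto[OF r r_lim assms(2)]]
  ultimately have "(\<lambda>k. \<Sum>\<^sub>\<infinity>n. smoothed_cauchy (r k) z (a n) - smoothed_cauchy (r k) w (a n))
      \<longlonglongrightarrow> exp_series pos_freqs b z - exp_series pos_freqs b w"
    by simp
  from LIMSEQ_unique[OF smoothed_cauchy_sum_diff_tendsto[OF r_lim assms] this]
  show ?thesis by (simp add: field_simps)
qed

lemma poisson_sum_shift_le:
  assumes "y > 0"
  shows "\<bar>poisson_sum y (x + \<tau>) - poisson_sum y x\<bar> \<le> 2 * pi * exp_deviation pos_freqs b y \<tau>"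
proof -
  define z where "z = Complex x y"
  define w where "w = z + of_real \<tau>"
  have upper: "Im z > 0" "Im w > 0" using assms by (auto simp: z_def w_def)
  define D where "D n = 1 / (w - complex_of_real (a n)) - 1 / (z - of_real (a n))" for n
  have "w = Complex (x + \<tau>) y" by (simp add: w_def z_def complex_eq_iff)
  then have Im_D: "Im (D n) = - (poisson_kernel y (x + \<tau> - a n) - poisson_kernel y (x - a n))" for n
    by (simp add: D_def z_def Im_cauchy_kernel del: Im_divide)
  have "D summable_on UNIV"
    unfolding D_def by (rule abs_summable_summable[OF summable_cauchy_kernel_diff[OF upper(2,1)]])
  then have "Im (infsum D UNIV) = (\<Sum>\<^sub>\<infinity>n. Im (D n))" by (rule infsum_Im[symmetric])
  also have "\<dots> = - (poisson_sum y (x + \<tau>) - poisson_sum y x)"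
    unfolding Im_D infsum_uminus poisson_sum_def
    by (simp only: infsum_diff[OF summable_poisson_kernel[OF assms] summable_poisson_kernel[OF assms]])
  finally have "\<bar>poisson_sum y (x + \<tau>) - poisson_sum y x\<bar> = \<bar>Im (infsum D UNIV)\<bar>" by simp
  also have "\<dots> \<le> norm (infsum D UNIV)" by (rule abs_Im_le_cmod)
  also have "\<dots> = 2 * pi * norm (exp_series pos_freqs b w - exp_series pos_freqs b z)"
    unfolding D_def cauchy_sum_diff[OF upper(2,1)] by (simp add: norm_mult)
  also have "\<dots> \<le> 2 * pi * exp_deviation pos_freqs b (Im z) \<tau>"
    unfolding w_def
    by (intro mult_left_mono norm_exp_series_shift_le exp_summable_pos_freqs upper) simp
  finally show ?thesis by (simp add: z_def)
qed

lemma relatively_dense_poisson_periods: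
  assumes "y > 0" "\<eta> > 0"
  shows "relatively_dense {\<tau>. poisson_almost_period y \<eta> \<tau>}"
proof -
  have "\<eta> / (2 * pi) > 0" using assms(2) by simp
  from relatively_dense_exp_deviation_less[OF exp_summable_pos_freqs[OF assms(1)] finite.emptyI this]
  show ?thesis
  proof (rule relatively_dense_mono, safe)
    fix \<tau> assume "exp_deviation pos_freqs b y \<tau> < \<eta> / (2 * pi)"
    then have "2 * pi * exp_deviation pos_freqs b y \<tau> \<le> \<eta>" by (simp add: field_simps)
    then show "poisson_almost_period y \<eta> \<tau>"
      using poisson_sum_shift_le[OF assms(1)] order.trans
      unfolding poisson_almost_period_def by blast
  qed
qed

end

sublocale integer_fourier_measure \<subseteq> almost_periodic_sequence a
proof
  show "mono a"
  proof (rule monoI)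
    show "a m \<le> a n" if "m \<le> n" for m n
      using that by (induction n rule: int_ge_induct) (use a_mono order.trans in blast)+
  qed
qed (rule relatively_dense_poisson_periods)

sublocale integer_fourier_measure \<subseteq> balanced_zeros a
proof
  show nonzero: "a n \<noteq> 0" for n using zero_notin by (metis rangeI)
  then show "(\<lambda>n. 1 / (a n)\<^sup>2) summable_on UNIV" by (rule summable_inverse_square)
  obtain H where "\<And>n::nat. \<bar>a (int n) + a (- int n)\<bar> \<le> H" using symmetric_sum_bounded by blast
  then show "bdd_above (range (\<lambda>n::nat. \<bar>a (int n) + a (- int n)\<bar>))"
    by (intro bdd_aboveI[where M = H]) auto
qed

context integer_fourier_measure
begin

subsection \<open>Almost periodicity of the corrected product\<close>

definition low_freqs :: "real set" where
  "low_freqs = \<Gamma> \<inter> {0<..<1}"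

definition high_freqs :: "real set" where
  "high_freqs = \<Gamma> \<inter> {1..}"

abbreviation low_series :: "complex \<Rightarrow> complex" where
  "low_series \<equiv> primitive_series low_freqs b"

abbreviation high_series :: "complex \<Rightarrow> complex" where
  "high_series \<equiv> exp_series high_freqs (\<lambda>\<gamma>. b \<gamma> / of_real \<gamma>)"

lemma low_freqs_subset: "low_freqs \<subseteq> {0<..1}"
  by (auto simp: low_freqs_def)

lemma summable_b_low: "(\<lambda>\<gamma>. norm (b \<gamma>)) summable_on low_freqs"
proof (rule summable_on_comparison_test)
  have "exp_summable low_freqs b 1"
    by (rule exp_summable_subset[OF exp_summable_pos_freqs]) (auto simp: low_freqs_def pos_freqs_def)
  then show "(\<lambda>\<gamma>. exp (2 * pi) * (norm (b \<gamma>) * exp (- 2 * pi * 1 * \<gamma>))) summable_on low_freqs"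
    unfolding exp_summable_def by (rule summable_on_cmult_right)
  fix \<gamma> assume "\<gamma> \<in> low_freqs"
  then have "2 * pi * \<gamma> \<le> 2 * pi * 1" unfolding low_freqs_def by (intro mult_left_mono) auto
  then have "1 \<le> exp (2 * pi) * exp (- 2 * pi * 1 * \<gamma>)" by (simp add: mult_exp_exp)
  from mult_left_mono[OF this, of "norm (b \<gamma>)"]
  show "norm (b \<gamma>) \<le> exp (2 * pi) * (norm (b \<gamma>) * exp (- 2 * pi * 1 * \<gamma>))" by (simp add: mult_ac)
qed auto

lemma exp_summable_high:
  assumes "y > 0"
  shows "exp_summable high_freqs (\<lambda>\<gamma>. b \<gamma> / of_real \<gamma>) y"
proof (rule exp_summable_mono)
  show "exp_summable high_freqs b y"
    by (rule exp_summable_subset[OF exp_summable_pos_freqs[OF assms]])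
       (auto simp: high_freqs_def pos_freqs_def)
  show "norm (b \<gamma> / of_real \<gamma>) \<le> norm (b \<gamma>)" if "\<gamma> \<in> high_freqs" for \<gamma>
    using that
    by (simp add: high_freqs_def norm_divide divide_le_eq mult_left_le mult_le_cancel_left1)
qed

lemma high_series_has_field_derivative:
  assumes "Im z > 0"
  shows "(high_series has_field_derivative 2 * pi * \<i> * exp_series high_freqs b z) (at z)"
proof -
  have "(high_series has_field_derivative
      exp_series high_freqs (\<lambda>\<gamma>. 2 * pi * \<i> * of_real \<gamma> * (b \<gamma> / of_real \<gamma>)) z) (at z)"
    by (rule exp_series_has_field_derivative[OF exp_summable_high, of "Im z / 2"])
       (use assms in \<open>auto simp: high_freqs_def\<close>)
  also have "exp_series high_freqs (\<lambda>\<gamma>. 2 * pi * \<i> * of_real \<gamma> * (b \<gamma> / of_real \<gamma>)) z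
      = (\<Sum>\<^sub>\<infinity>\<gamma>\<in>high_freqs. 2 * pi * \<i> * (b \<gamma> * freq_exp \<gamma> z))"
    unfolding exp_series_def by (rule infsum_cong) (auto simp: high_freqs_def)
  finally show ?thesis by (simp only: infsum_cmult_right' exp_series_def[abs_def])
qed

definition exponent :: complex where
  "exponent = log_deriv \<i> + 2 * pi * \<i> * exp_series pos_freqs b \<i>"

lemma log_deriv_eq:
  assumes "Im z > 0"
  shows "log_deriv z = exponent - 2 * pi * \<i> * exp_series pos_freqs b z"
proof -
  have "log_deriv z - log_deriv \<i>
      = - (2 * pi * \<i>) * (exp_series pos_freqs b z - exp_series pos_freqs b \<i>)"
    using assms by (simp only: log_deriv_diff cauchy_sum_diff imaginary_unit.sel zero_less_one)
  then show ?thesis by (simp add: exponent_def algebra_simps)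
qed

lemma Re_exponent: "Re exponent = 0"
proof -
  let ?s = "\<lambda>y. exp_series pos_freqs b (\<i> * of_real y)"
  have "((\<lambda>y. Re (log_deriv (\<i> * of_real y)) + Re (2 * pi * \<i> * ?s y)) \<longlongrightarrow> 0 + Re (2 * pi * \<i> * 0)) at_top"
    by (intro tendsto_add Re_log_deriv_tendsto_0 tendsto_Re tendsto_mult_left
        exp_series_vertical_tendsto_0[OF exp_summable_pos_freqs[OF zero_less_one]])
       (auto simp: pos_freqs_def)
  moreover have "\<forall>\<^sub>F y in at_top. Re (log_deriv (\<i> * of_real y)) + Re (2 * pi * \<i> * ?s y)
      = Re exponent"
    using eventually_gt_at_top[of "0::real"] by eventually_elim (simp add: log_deriv_eq)
  ultimately have "((\<lambda>y::real. Re exponent) \<longlongrightarrow> 0) at_top"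
    using Lim_transform_eventually by fastforce
  then show ?thesis by (simp add: tendsto_const_iff)
qed

definition corrected_product :: "complex \<Rightarrow> complex" where
  "corrected_product z = exp (low_series z) * zero_product z"

lemma corrected_product_holomorphic: "corrected_product holomorphic_on UNIV"
  unfolding corrected_product_def
  by (intro holomorphic_intros zero_product_holomorphic
      primitive_series_holomorphic[OF summable_b_low low_freqs_subset])

text \<open>The exponential of the low frequency series removes from the logarithmic derivative the
  frequencies whose primitives need not converge absolutely.\<close>

lemma corrected_product_upper_half_plane:
  obtains C where "\<And>z. Im z > 0 \<Longrightarrow> corrected_product z = C * exp (exponent * z - high_series z)"
proof -
  define E where "E z = low_series z + high_series z - exponent * z" for z
  have deriv_E: "(E has_field_derivative - log_deriv z) (at z)" if "Im z > 0" for z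
  proof -
    have "pos_freqs = low_freqs \<union> high_freqs" "low_freqs \<inter> high_freqs = {}"
      by (auto simp: pos_freqs_def low_freqs_def high_freqs_def)
    then have "exp_series low_freqs b z + exp_series high_freqs b z = exp_series pos_freqs b z"
      using exp_series_Un_disjoint[of low_freqs high_freqs b z] exp_summable_pos_freqs[OF that]
      by simp
    then have "2 * pi * \<i> * exp_series low_freqs b z + 2 * pi * \<i> * exp_series high_freqs b z
        - exponent * 1 = - log_deriv z"
      unfolding log_deriv_eq[OF that] by (simp flip: distrib_left)
    then show ?thesis
      unfolding E_def using DERIV_diff[OF DERIV_add[OF
          primitive_series_has_field_derivative[OF summable_b_low low_freqs_subset, of z]
          high_series_has_field_derivative[OF that]] DERIV_cmult[OF DERIV_ident, of exponent]]
      by simp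
  qed
  have "((\<lambda>z. exp (E z) * zero_product z) has_field_derivative 0) (at z)" if "Im z > 0" for z
    using DERIV_mult[OF DERIV_fun_exp[OF deriv_E[OF that]] zero_product_has_field_derivative[OF that]]
    by (simp add: mult_ac)
  then have "\<exists>C. \<forall>z\<in>{z. Im z > 0}. exp (E z) * zero_product z = C"
    by (intro has_field_derivative_zero_constant convex_halfspace_Im_gt)
       (auto intro: has_field_derivative_at_within)
  then obtain C where C: "\<And>z. Im z > 0 \<Longrightarrow> exp (E z) * zero_product z = C" by auto
  show ?thesis
  proof (rule that[of C])
    fix z assume "Im z > 0"
    have "exp (low_series z) = exp (E z) * exp (exponent * z - high_series z)"
      by (simp add: E_def mult_exp_exp)
    then show "corrected_product z = C * exp (exponent * z - high_series z)"
      by (simp add: corrected_product_def C[OF \<open>Im z > 0\<close>, symmetric] mult_ac)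
  qed
qed

lemma corrected_product_bounded_line:
  assumes "s > 0"
  obtains B where "\<And>x. norm (corrected_product (Complex x s)) \<le> B"
proof -
  obtain C where C: "\<And>z. Im z > 0 \<Longrightarrow> corrected_product z = C * exp (exponent * z - high_series z)"
    using corrected_product_upper_half_plane by blast
  define v where "v = (\<Sum>\<^sub>\<infinity>\<gamma>\<in>high_freqs. norm (b \<gamma> / complex_of_real \<gamma>) * exp (- 2 * pi * s * \<gamma>))"
  have "norm (corrected_product (Complex x s)) \<le> norm C * exp (- Im exponent * s + v)" for x
  proof -
    have "norm (high_series (Complex x s)) \<le> v"
      using norm_exp_series_le[of high_freqs _ "Complex x s"] exp_summable_high[OF assms]
      by (simp add: v_def)
    then have "- Re (high_series (Complex x s)) \<le> v"
      using abs_Re_le_cmod[of "high_series (Complex x s)"] by linarith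
    then have "Re (exponent * Complex x s - high_series (Complex x s)) \<le> - Im exponent * s + v"
      using Re_exponent by simp
    then show ?thesis
      using assms by (simp add: C norm_mult norm_exp_eq_Re mult_left_mono)
  qed
  then show ?thesis using that by blast
qed

lemma corrected_product_bounded_strip:
  assumes "s > 0"
  shows "\<exists>B. \<forall>z. \<bar>Im z\<bar> \<le> s \<longrightarrow> norm (corrected_product z) \<le> B"
proof -
  obtain B where B: "\<And>x. norm (corrected_product (Complex x s)) \<le> B"
    using corrected_product_bounded_line[OF assms] by blast
  define d where "d = 2 * pi * (2 * s) * exp (2 * pi * 1 * s) * (\<Sum>\<^sub>\<infinity>\<gamma>\<in>low_freqs. norm (b \<gamma>))"
  have "norm (corrected_product z) \<le> exp d * B" if "\<bar>Im z\<bar> \<le> s" for z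
  proof -
    define w where "w = Complex (Re z) s"
    have "z - w = \<i> * of_real (Im z - s)" by (simp add: w_def complex_eq_iff)
    then have "norm (z - w) = \<bar>Im z - s\<bar>" by (simp only: norm_mult norm_ii norm_of_real mult_1)
    then have "norm (z - w) \<le> 2 * s" using that by linarith
    have "Re (low_series z - low_series w) \<le> norm (low_series z - low_series w)"
      by (rule complex_Re_le_cmod)
    also have "\<dots> \<le> 2 * pi * norm (z - w) * exp (2 * pi * 1 * s) * (\<Sum>\<^sub>\<infinity>\<gamma>\<in>low_freqs. norm (b \<gamma>))"
      using that assms
      by (intro norm_primitive_series_diff_le summable_b_low low_freqs_subset) (auto simp: w_def)
    also have "\<dots> \<le> d"
      unfolding d_def using \<open>norm (z - w) \<le> 2 * s\<close>
      by (intro mult_right_mono mult_left_mono infsum_nonneg) auto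
    finally have "norm (exp (low_series z - low_series w)) \<le> exp d" by (simp add: norm_exp_eq_Re)
    then have "norm (exp (low_series z)) \<le> exp d * norm (exp (low_series w))"
      by (simp add: exp_diff norm_divide divide_le_eq)
    moreover have "norm (zero_product z) \<le> norm (zero_product w)"
      using norm_zero_product_vertical_mono[OF that, of "Re z"] by (simp add: w_def)
    ultimately have "norm (corrected_product z)
        \<le> exp d * norm (exp (low_series w)) * norm (zero_product w)"
      unfolding corrected_product_def norm_mult by (rule mult_mono) auto
    also have "\<dots> = exp d * norm (corrected_product w)"
      by (simp add: corrected_product_def norm_mult)
    also have "\<dots> \<le> exp d * B" unfolding w_def by (intro mult_left_mono B) simp
    finally show ?thesis .
  qed
  then show ?thesis by blast
qed

lemma norm_corrected_product_shift_le:
  assumes "Im z > 0" and \<eta>: "0 < \<eta>" "\<eta> \<le> 1"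
    and high: "norm (high_series (z + of_real \<tau>) - high_series z) \<le> \<eta>"
    and linear: "norm (cis (Im exponent * \<tau>) - 1) \<le> \<eta>"
  shows "norm (corrected_product (z + of_real \<tau>) - corrected_product z)
    \<le> norm (corrected_product z) * (4 * \<eta>)"
proof -
  obtain C where C: "\<And>z. Im z > 0 \<Longrightarrow> corrected_product z = C * exp (exponent * z - high_series z)"
    using corrected_product_upper_half_plane by blast
  define d e where "d = high_series z - high_series (z + of_real \<tau>)" and "e = cis (Im exponent * \<tau>)"
  have "norm d \<le> \<eta>" using high by (simp add: d_def norm_minus_commute)
  have "exponent * of_real \<tau> = \<i> * of_real (Im exponent * \<tau>)"
    using Re_exponent by (simp add: complex_eq_iff)
  then have "exp (exponent * of_real \<tau>) = e" by (simp only: e_def cis_conv_exp)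
  moreover have "exponent * (z + of_real \<tau>) - high_series (z + of_real \<tau>)
      = (exponent * z - high_series z) + (exponent * of_real \<tau> + d)"
    by (simp add: d_def algebra_simps)
  ultimately have "corrected_product (z + of_real \<tau>) = corrected_product z * (e * exp d)"
    using assms(1) by (simp add: C exp_add)
  then have "corrected_product (z + of_real \<tau>) - corrected_product z
      = corrected_product z * (e * (exp d - 1) + (e - 1))"
    by (simp add: algebra_simps)
  moreover have "norm (e * (exp d - 1) + (e - 1)) \<le> 4 * \<eta>"
  proof -
    have "norm (exp d - exp 0) \<le> exp 1 * norm (d - 0)"
      using complex_Re_le_cmod[of d] \<open>norm d \<le> \<eta>\<close> \<eta>(2) by (intro norm_exp_diff_le) auto
    also have "\<dots> \<le> 3 * \<eta>" using exp_le \<open>norm d \<le> \<eta>\<close> by (intro mult_mono) auto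
    finally have "norm (e * (exp d - 1)) \<le> 3 * \<eta>" by (simp add: norm_mult e_def)
    then show ?thesis
      using linear norm_triangle_ineq[of "e * (exp d - 1)" "e - 1"] by (simp add: e_def)
  qed
  ultimately show ?thesis by (simp add: norm_mult mult_left_mono)
qed

lemma corrected_product_periods:
  assumes "S > 0" "\<eta> > 0"
  shows "relatively_dense {\<tau>. \<forall>z. Im z = S \<longrightarrow>
    norm (corrected_product (z + of_real \<tau>) - corrected_product z) \<le> \<eta>}"
proof -
  obtain B where B: "\<And>x. norm (corrected_product (Complex x S)) \<le> B"
    using corrected_product_bounded_line[OF assms(1)] by blast
  define M where "M = \<bar>B\<bar> + 1"
  define \<eta>' where "\<eta>' = min 1 (\<eta> / (4 * M))"
  have "M > 0" by (simp add: M_def)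
  then have \<eta>': "0 < \<eta>'" "\<eta>' \<le> 1" "M * (4 * \<eta>') \<le> \<eta>"
    using assms(2) by (auto simp: \<eta>'_def min_def field_simps)
  have "finite {Im exponent}" by simp
  from relatively_dense_exp_deviation_less[OF exp_summable_high[OF assms(1)] this \<eta>'(1)]
  show ?thesis
  proof (rule relatively_dense_mono, intro subsetI CollectI allI impI, elim CollectE conjE)
    fix \<tau> z
    assume high: "exp_deviation high_freqs (\<lambda>\<gamma>. b \<gamma> / of_real \<gamma>) S \<tau> < \<eta>'"
      and linear: "\<forall>\<kappa>\<in>{Im exponent}. norm (cis (\<kappa> * \<tau>) - 1) < \<eta>'" and S: "Im z = S"
    have "norm (corrected_product (z + of_real \<tau>) - corrected_product z)
        \<le> norm (corrected_product z) * (4 * \<eta>')"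
      using norm_exp_series_shift_le[OF exp_summable_high, of z \<tau>] high linear assms(1) S
      by (intro norm_corrected_product_shift_le \<eta>'(1,2)) auto
    also have "\<dots> \<le> M * (4 * \<eta>')"
      using B[of "Re z"] \<eta>'(1) by (intro mult_right_mono) (auto simp: M_def simp flip: S)
    finally show "norm (corrected_product (z + of_real \<tau>) - corrected_product z) \<le> \<eta>"
      using \<eta>'(3) by linarith
  qed
qed

lemma corrected_product_almost_periodic: "almost_periodic_entire corrected_product"
  by (rule almost_periodic_entireI[OF corrected_product_holomorphic
        corrected_product_bounded_strip corrected_product_periods])

end

theorem theorem2:
  fixes \<Lambda> \<Gamma> :: "real set" and c :: "real \<Rightarrow> nat" and b :: "real \<Rightarrow> complex"
    and a :: "int \<Rightarrow> real"
  assumes loc_fin: "\<And>R. finite (\<Lambda> \<inter> {-R..R})"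
    and c_pos: "\<And>x. x \<in> \<Lambda> \<Longrightarrow> c x > 0"
    and mu_temp: "tempered_discrete \<Lambda> (\<lambda>x. of_nat (c x))"
    and Gamma_countable: "countable \<Gamma>"
    and absmuhat_temp: "tempered_discrete \<Gamma> (\<lambda>x. complex_of_real (norm (b x)))"
    and fourier_eq: "\<And>\<phi>. schwartz \<phi> \<Longrightarrow>
        pair_discrete \<Lambda> (\<lambda>x. of_nat (c x)) (fourier \<phi>) = pair_discrete \<Gamma> b \<phi>"
    and a_mono: "\<And>n. a n \<le> a (n + 1)"
    and a_range: "range a = \<Lambda>"
    and a_mult: "\<And>x. x \<in> \<Lambda> \<Longrightarrow> card {n. a n = x} = c x"
    and zero_notin: "0 \<notin> range a"
  shows "\<exists>f. (\<forall>z. (\<lambda>N. (1 - z / complex_of_real (a 0)) *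
                  (\<Prod>n\<in>{1..N}. (1 - z / complex_of_real (a (int n))) *
                                  (1 - z / complex_of_real (a (- int n)))))
                \<longlonglongrightarrow> f z) \<and>
             almost_periodic_entire
               (\<lambda>z. exp (\<Sum>\<^sub>\<infinity>\<gamma>\<in>\<Gamma> \<inter> {0<..<1}.
                        b \<gamma> * (exp (2 * pi * \<i> * complex_of_real \<gamma> * z) - 1) / complex_of_real \<gamma>)
                    * f z)"
proof -
  interpret integer_fourier_measure \<Lambda> \<Gamma> c b a
    by (rule integer_fourier_measure.intro
        [OF c_pos mu_temp absmuhat_temp fourier_eq a_mono a_range a_mult zero_notin])
  show ?thesis
  proof (intro exI[of _ zero_product] conjI allI)
    fix z
    show "(\<lambda>N. (1 - z / complex_of_real (a 0)) *
                  (\<Prod>n\<in>{1..N}. (1 - z / complex_of_real (a (int n))) *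
                                  (1 - z / complex_of_real (a (- int n))))) \<longlonglongrightarrow> zero_product z"
      using partial_product_tendsto[of z]
      unfolding partial_product_def prod_symmetric_interval One_nat_def prod.atLeast1_atMost_eq .
    show "almost_periodic_entire
               (\<lambda>z. exp (\<Sum>\<^sub>\<infinity>\<gamma>\<in>\<Gamma> \<inter> {0<..<1}.
                        b \<gamma> * (exp (2 * pi * \<i> * complex_of_real \<gamma> * z) - 1) / complex_of_real \<gamma>)
                    * zero_product z)"
      using corrected_product_almost_periodic
      unfolding corrected_product_def primitive_series_def primitive_term_def freq_exp_def
        low_freqs_def .
  qed
qed

end
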